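(* Let $k$ be a field and let $\mathcal D$ be the cluster category of Dynkin type $A_\infty$ over $k$. Let $(\mathcal U,\mathcal V)$ be a co-t-structure in $\mathcal D$, that is, $(\mathcal U,\mathcal V)$ is a torsion theory with $\Sigma^{-1}\,\mathcal U\subseteq\mathcal U$. If $\mathcal U$ is non-zero, then $\mathcal U$ is all of $\mathcal D$.
   Context: The category $\mathcal D$: let $k[T]$ be the DG algebra over the field $k$ with $T$ in homological degree $1$ and zero differential; $\mathcal D = D^{f}(k[T])$ is the finite derived category, i.e. the full subcategory of the derived category of DG $k[T]$-modules consisting of those whose total homology is finite dimensional over $k$. It is $k$-linear, Hom-finite, Krull-Schmidt, triangulated with suspension $\Sigma$, and $2$-Calabi-Yau. (Equivalently, $\mathcal D$ is the algebraic triangulated category generated by a $2$-spherical object.) Write $(x,y)$ for the space of morphisms $x\to y$ in $\mathcal D$. Subcategories: a subcategory of $\mathcal D$ always means a full subcategory closed under (finite) direct sums and direct summands (hence isomorphisms). Torsion theory: a pair $(\mathcal U,\mathcal V)$ of subcategories of $\mathcal D$ such that $(u,v)=0$ for all $u\in\mathcal U$, $v\in\mathcal V$, and such that each $d\in\mathcal D$ admits a distinguished triangle $u\to d\to v\to\Sigma u$ with $u\in\mathcal U$, $v\in\mathcal V$. *)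

theory Defs
  imports "HOL-Library.Function_Algebras" "HOL-Computational_Algebra.Polynomial"
begin

section \<open>Ambient vector spaces\<close>

text \<open>
  HOL has no type of all vector spaces, so the graded pieces of all DG modules are subspaces
  of one vector space, the functions from an index type \<open>'i\<close> to \<open>'k\<close>. The index type is a type
  variable and therefore arbitrarily large. It has to be infinite for the universe to be closed
  under the constructions of homological algebra (cones, semi-free resolutions over \<open>k[T]\<close>).
\<close>

definition fscale :: "'k::field \<Rightarrow> ('i \<Rightarrow> 'k) \<Rightarrow> ('i \<Rightarrow> 'k)" where
  "fscale c v = (\<lambda>i. c * v i)"

global_interpretation fvs: vector_space "fscale :: 'k::field \<Rightarrow> ('i \<Rightarrow> 'k) \<Rightarrow> _"
  by unfold_locales (auto simp: fscale_def algebra_simps)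

definition linear_on ::
    "('i \<Rightarrow> 'k::field) set \<Rightarrow> ('j \<Rightarrow> 'k) set \<Rightarrow> (('i \<Rightarrow> 'k) \<Rightarrow> ('j \<Rightarrow> 'k)) \<Rightarrow> bool" where
  "linear_on S S' f \<longleftrightarrow>
     (\<forall>x\<in>S. f x \<in> S') \<and>
     (\<forall>x\<in>S. \<forall>y\<in>S. f (x + y) = f x + f y) \<and>
     (\<forall>c. \<forall>x\<in>S. f (fscale c x) = fscale c (f x))"

text \<open>The Koszul sign: \<open>ksign n x\<close> is \<open>(-1)\<^sup>n x\<close>.\<close>

definition ksign :: "int \<Rightarrow> 'v::uminus \<Rightarrow> 'v" where
  "ksign n x = (if even n then x else - x)"


section \<open>DG modules over \<open>k[T]\<close>\<close>

text \<open>
  The graded algebra \<open>k[T]\<close> with \<open>T\<close> in homological degree 1: \<open>kT n\<close> is the piece of degree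
  \<open>n\<close>, spanned by \<open>T\<^sup>n\<close> (and zero for \<open>n < 0\<close>). Its differential is zero.
\<close>

definition kT :: "int \<Rightarrow> 'k::field poly set" where
  "kT n = {p. \<forall>m. coeff p m \<noteq> 0 \<longrightarrow> int m = n}"

text \<open>
  \<open>act M i p x\<close> is the product of a homogeneous \<open>p\<close> with \<open>x \<in> piece M i\<close>. The pieces need
  not be disjoint as sets, hence the explicit degree \<open>i\<close>. Values outside the relevant
  pieces are irrelevant. The grading is homological: \<open>dif M i\<close> maps degree \<open>i\<close> to degree \<open>i - 1\<close>.
\<close>

record (overloaded) ('i, 'k) dgmod =
  piece :: "int \<Rightarrow> ('i \<Rightarrow> 'k) set"
  dif :: "int \<Rightarrow> ('i \<Rightarrow> 'k) \<Rightarrow> ('i \<Rightarrow> 'k)"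
  act :: "int \<Rightarrow> 'k poly \<Rightarrow> ('i \<Rightarrow> 'k) \<Rightarrow> ('i \<Rightarrow> 'k)"

text \<open>Left DG modules; the summand \<open>d(p) x\<close> of the Leibniz rule vanishes as \<open>d = 0\<close> on \<open>k[T]\<close>.\<close>

definition dg_module :: "('i, 'k::field) dgmod \<Rightarrow> bool" where
  "dg_module M \<longleftrightarrow>
     (\<forall>i. fvs.subspace (piece M i)) \<and>
     (\<forall>i. linear_on (piece M i) (piece M (i - 1)) (dif M i)) \<and>
     (\<forall>i. \<forall>x\<in>piece M i. dif M (i - 1) (dif M i x) = 0) \<and>
     (\<forall>n i. \<forall>p\<in>kT n. linear_on (piece M i) (piece M (n + i)) (act M i p)) \<and>
     (\<forall>n i. \<forall>p\<in>kT n. \<forall>q\<in>kT n. \<forall>x\<in>piece M i. act M i (p + q) x = act M i p x + act M i q x) \<and>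
     (\<forall>n i c. \<forall>p\<in>kT n. \<forall>x\<in>piece M i. act M i (smult c p) x = fscale c (act M i p x)) \<and>
     (\<forall>i. \<forall>x\<in>piece M i. act M i 1 x = x) \<and>
     (\<forall>m n i. \<forall>q\<in>kT m. \<forall>p\<in>kT n. \<forall>x\<in>piece M i. act M i (q * p) x = act M (n + i) q (act M i p x)) \<and>
     (\<forall>n i. \<forall>p\<in>kT n. \<forall>x\<in>piece M i.
        dif M (n + i) (act M i p x) = ksign n (act M (i - 1) p (dif M i x)))"

type_synonym ('i, 'j, 'k) gmap = "int \<Rightarrow> ('i \<Rightarrow> 'k) \<Rightarrow> ('j \<Rightarrow> 'k)"

definition gid :: "('i, 'i, 'k) gmap" where
  "gid = (\<lambda>i x. x)"

definition gzero :: "('i, 'j, 'k::zero) gmap" where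
  "gzero = (\<lambda>i x. 0)"

definition gcomp :: "('j, 'l, 'k) gmap \<Rightarrow> ('i, 'j, 'k) gmap \<Rightarrow> ('i, 'l, 'k) gmap" where
  "gcomp g f = (\<lambda>i x. g i (f i x))"

definition dg_hom ::
    "('i, 'k::field) dgmod \<Rightarrow> ('j, 'k) dgmod \<Rightarrow> ('i, 'j, 'k) gmap \<Rightarrow> bool" where
  "dg_hom M N f \<longleftrightarrow>
     (\<forall>i. linear_on (piece M i) (piece N i) (f i)) \<and>
     (\<forall>i. \<forall>x\<in>piece M i. f (i - 1) (dif M i x) = dif N i (f i x)) \<and>
     (\<forall>n i. \<forall>p\<in>kT n. \<forall>x\<in>piece M i. f (n + i) (act M i p x) = act N i p (f i x))"

definition dg_iso ::
    "('i, 'k::field) dgmod \<Rightarrow> ('j, 'k) dgmod \<Rightarrow> ('i, 'j, 'k) gmap \<Rightarrow> bool" where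
  "dg_iso M N f \<longleftrightarrow> dg_hom M N f \<and> (\<forall>i. bij_betw (f i) (piece M i) (piece N i))"

text \<open>\<open>f - g = d s + s d\<close> for a \<open>k[T]\<close>-linear \<open>s\<close> of degree 1, so \<open>s (p x) = (-1)\<^sup>|\<^sup>p\<^sup>| p s(x)\<close>.\<close>

definition homotopic ::
    "('i, 'k::field) dgmod \<Rightarrow> ('j, 'k) dgmod \<Rightarrow> ('i, 'j, 'k) gmap \<Rightarrow> ('i, 'j, 'k) gmap \<Rightarrow> bool" where
  "homotopic M N f g \<longleftrightarrow>
     (\<exists>s. (\<forall>i. linear_on (piece M i) (piece N (i + 1)) (s i)) \<and>
          (\<forall>n i. \<forall>p\<in>kT n. \<forall>x\<in>piece M i. s (n + i) (act M i p x) = ksign n (act N (i + 1) p (s i x))) \<and>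
          (\<forall>i. \<forall>x\<in>piece M i. f i x - g i x = dif N (i + 1) (s i x) + s (i - 1) (dif M i x)))"


subsection \<open>Homology\<close>

definition cycles :: "('i, 'k::field) dgmod \<Rightarrow> int \<Rightarrow> ('i \<Rightarrow> 'k) set" where
  "cycles M i = {x \<in> piece M i. dif M i x = 0}"

definition boundaries :: "('i, 'k::field) dgmod \<Rightarrow> int \<Rightarrow> ('i \<Rightarrow> 'k) set" where
  "boundaries M i = dif M (i + 1) ` piece M (i + 1)"

definition hclass :: "('i, 'k::field) dgmod \<Rightarrow> int \<Rightarrow> ('i \<Rightarrow> 'k) \<Rightarrow> ('i \<Rightarrow> 'k) set" where
  "hclass M i x = {x + b | b. b \<in> boundaries M i}"

definition homology :: "('i, 'k::field) dgmod \<Rightarrow> int \<Rightarrow> ('i \<Rightarrow> 'k) set set" where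
  "homology M i = hclass M i ` cycles M i"

definition homology_map ::
    "('j, 'k::field) dgmod \<Rightarrow> ('i, 'j, 'k) gmap \<Rightarrow> int \<Rightarrow> ('i \<Rightarrow> 'k) set \<Rightarrow> ('j \<Rightarrow> 'k) set" where
  "homology_map N f i C = (\<Union>x\<in>C. hclass N i (f i x))"

definition quasi_iso ::
    "('i, 'k::field) dgmod \<Rightarrow> ('j, 'k) dgmod \<Rightarrow> ('i, 'j, 'k) gmap \<Rightarrow> bool" where
  "quasi_iso M N f \<longleftrightarrow>
     dg_hom M N f \<and> (\<forall>i. bij_betw (homology_map N f i) (homology M i) (homology N i))"

definition finite_dim_homology :: "('i, 'k::field) dgmod \<Rightarrow> bool" where
  "finite_dim_homology M \<longleftrightarrow>
     finite {i. homology M i \<noteq> {hclass M i 0}} \<and>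
     (\<forall>i. \<exists>B\<subseteq>cycles M i. finite B \<and> homology M i = hclass M i ` fvs.span B)"


subsection \<open>Shifts and mapping cones\<close>

definition shift :: "int \<Rightarrow> ('i, 'k::field) dgmod \<Rightarrow> ('i, 'k) dgmod" where
  "shift r M =
     \<lparr> piece = (\<lambda>i. piece M (i - r)),
       dif = (\<lambda>i x. ksign r (dif M (i - r) x)),
       act = (\<lambda>i p x. ksign (r * int (degree p)) (act M (i - r) p x)) \<rparr>"

definition gshift :: "int \<Rightarrow> ('i, 'j, 'k) gmap \<Rightarrow> ('i, 'j, 'k) gmap" where
  "gshift r f = (\<lambda>i. f (i - r))"

text \<open>
  The cone of \<open>f : M \<rightarrow> N\<close> is \<open>N \<oplus> \<Sigma>M\<close> with differential \<open>(y, x) \<mapsto> (d y + f x, - d x)\<close>;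
  the pair \<open>(y, x)\<close> is encoded as \<open>case_sum y x\<close>.
\<close>

definition cone ::
    "('i, 'k::field) dgmod \<Rightarrow> ('j, 'k) dgmod \<Rightarrow> ('i, 'j, 'k) gmap \<Rightarrow> ('j + 'i, 'k) dgmod" where
  "cone M N f =
     \<lparr> piece = (\<lambda>i. {case_sum y x | y x. y \<in> piece N i \<and> x \<in> piece (shift 1 M) i}),
       dif = (\<lambda>i z. case_sum (dif N i (z \<circ> Inl) + f (i - 1) (z \<circ> Inr)) (dif (shift 1 M) i (z \<circ> Inr))),
       act = (\<lambda>i p z. case_sum (act N i p (z \<circ> Inl)) (act (shift 1 M) i p (z \<circ> Inr))) \<rparr>"

definition cone_in :: "('j, 'j + 'i, 'k::zero) gmap" where
  "cone_in = (\<lambda>i y. case_sum y 0)"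

definition cone_out :: "('j + 'i, 'i, 'k) gmap" where
  "cone_out = (\<lambda>i z. z \<circ> Inr)"


section \<open>The derived category\<close>

text \<open>
  A roof \<open>(Z, s, f)\<close> is a diagram \<open>X \<leftarrow> Z \<rightarrow> Y\<close> with \<open>s : Z \<rightarrow> X\<close> a quasi-isomorphism.
  Morphisms of the derived category are equivalence classes of roofs, i.e. the
  calculus of fractions in the homotopy category with respect to quasi-isomorphisms.
\<close>

type_synonym ('i, 'k) roof = "('i, 'k) dgmod \<times> ('i, 'i, 'k) gmap \<times> ('i, 'i, 'k) gmap"

fun is_roof :: "('i, 'k::field) dgmod \<Rightarrow> ('i, 'k) dgmod \<Rightarrow> ('i, 'k) roof \<Rightarrow> bool" where
  "is_roof X Y (Z, s, f) \<longleftrightarrow> dg_module Z \<and> quasi_iso Z X s \<and> dg_hom Z Y f"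

fun roof_equiv ::
    "('i, 'k::field) dgmod \<Rightarrow> ('i, 'k) dgmod \<Rightarrow> ('i, 'k) roof \<Rightarrow> ('i, 'k) roof \<Rightarrow> bool" where
  "roof_equiv X Y (Z, s, f) (Z', s', f') \<longleftrightarrow>
     (\<exists>(W :: ('i, 'k) dgmod) a b. dg_module W \<and> dg_hom W Z a \<and> dg_hom W Z' b \<and> quasi_iso W X (gcomp s a) \<and>
        homotopic W X (gcomp s a) (gcomp s' b) \<and> homotopic W Y (gcomp f a) (gcomp f' b))"

definition roof_class ::
    "('i, 'k::field) dgmod \<Rightarrow> ('i, 'k) dgmod \<Rightarrow> ('i, 'k) roof \<Rightarrow> ('i, 'k) roof set" where
  "roof_class X Y r = {r'. is_roof X Y r' \<and> roof_equiv X Y r r'}"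

definition Hom :: "('i, 'k::field) dgmod \<Rightarrow> ('i, 'k) dgmod \<Rightarrow> ('i, 'k) roof set set" where
  "Hom X Y = roof_class X Y ` {r. is_roof X Y r}"

definition hom_class ::
    "('i, 'k::field) dgmod \<Rightarrow> ('i, 'k) dgmod \<Rightarrow> ('i, 'i, 'k) gmap \<Rightarrow> ('i, 'k) roof set" where
  "hom_class X Y f = roof_class X Y (X, gid, f)"

definition D_id :: "('i, 'k::field) dgmod \<Rightarrow> ('i, 'k) roof set" where
  "D_id X = hom_class X X gid"

definition D_zero :: "('i, 'k::field) dgmod \<Rightarrow> ('i, 'k) dgmod \<Rightarrow> ('i, 'k) roof set" where
  "D_zero X Y = hom_class X Y gzero"

text \<open>
  Composition of \<open>F : X \<rightarrow> Y\<close> with \<open>G : Y \<rightarrow> Z\<close>: complete \<open>W \<rightarrow> Y \<leftarrow> W'\<close> to a square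
  \<open>W \<leftarrow> P \<rightarrow> W'\<close>, commutative up to homotopy, with \<open>P \<rightarrow> W\<close> a quasi-isomorphism.
\<close>

definition D_comp ::
    "('i, 'k::field) dgmod \<Rightarrow> ('i, 'k) dgmod \<Rightarrow> ('i, 'k) dgmod \<Rightarrow>
     ('i, 'k) roof set \<Rightarrow> ('i, 'k) roof set \<Rightarrow> ('i, 'k) roof set" where
  "D_comp X Y Z G F =
     {r. is_roof X Z r \<and>
        (\<exists>W s f W' t g P a b.
           (W, s, f) \<in> F \<and> (W', t, g) \<in> G \<and>
           dg_module P \<and> quasi_iso P W a \<and> dg_hom P W' b \<and>
           homotopic P Y (gcomp f a) (gcomp t b) \<and>
           roof_equiv X Z (P, gcomp s a, gcomp g b) r)}"

definition D_susp ::
    "('i, 'k::field) dgmod \<Rightarrow> ('i, 'k) dgmod \<Rightarrow> ('i, 'k) roof set \<Rightarrow> ('i, 'k) roof set" where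
  "D_susp X Y F =
     {r. is_roof (shift 1 X) (shift 1 Y) r \<and>
        (\<exists>W s f. (W, s, f) \<in> F \<and>
           roof_equiv (shift 1 X) (shift 1 Y) (shift 1 W, gshift 1 s, gshift 1 f) r)}"

definition D_iso :: "('i, 'k::field) dgmod \<Rightarrow> ('i, 'k) dgmod \<Rightarrow> ('i, 'k) roof set \<Rightarrow> bool" where
  "D_iso X Y F \<longleftrightarrow>
     F \<in> Hom X Y \<and> (\<exists>G\<in>Hom Y X. D_comp X Y X G F = D_id X \<and> D_comp Y X Y F G = D_id Y)"

text \<open>
  Standard triangles are \<open>M \<rightarrow> N \<rightarrow> C \<rightarrow> \<Sigma>M\<close> with \<open>C\<close> the cone of a DG homomorphism \<open>f\<close>. The cone
  has index type \<open>'i + 'i\<close>; the DG isomorphism \<open>e\<close> transports it back to index type \<open>'i\<close>.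
\<close>

definition standard_triangle ::
    "('i, 'k::field) dgmod \<Rightarrow> ('i, 'k) dgmod \<Rightarrow> ('i, 'k) dgmod \<Rightarrow>
     ('i, 'i, 'k) gmap \<Rightarrow> ('i, 'i, 'k) gmap \<Rightarrow> ('i, 'i, 'k) gmap \<Rightarrow> bool" where
  "standard_triangle M N C f g h \<longleftrightarrow>
     dg_module M \<and> dg_module N \<and> dg_module C \<and> dg_hom M N f \<and>
     (\<exists>e. dg_iso (cone M N f) C e \<and>
        (\<forall>i. \<forall>y\<in>piece N i. g i y = e i (cone_in i y)) \<and>
        (\<forall>i. \<forall>z\<in>piece (cone M N f) i. h i (e i z) = cone_out i z))"

definition dist_triangle ::
    "('i, 'k::field) dgmod \<Rightarrow> ('i, 'k) dgmod \<Rightarrow> ('i, 'k) dgmod \<Rightarrow>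
     ('i, 'k) roof set \<Rightarrow> ('i, 'k) roof set \<Rightarrow> ('i, 'k) roof set \<Rightarrow> bool" where
  "dist_triangle X Y Z F G H \<longleftrightarrow>
     F \<in> Hom X Y \<and> G \<in> Hom Y Z \<and> H \<in> Hom Z (shift 1 X) \<and>
     (\<exists>M N C f g h A B E.
        standard_triangle M N C f g h \<and>
        D_iso X M A \<and> D_iso Y N B \<and> D_iso Z C E \<and>
        D_comp X Y N B F = D_comp X M N (hom_class M N f) A \<and>
        D_comp Y Z C E G = D_comp Y N C (hom_class N C g) B \<and>
        D_comp Z (shift 1 X) (shift 1 M) (D_susp X M A) H =
          D_comp Z C (shift 1 M) (hom_class C (shift 1 M) h) E)"


section \<open>The finite derived category and torsion theories\<close>

text \<open>The objects of \<open>D\<^sup>f(k[T])\<close>, a full subcategory; its morphism spaces are given by \<open>Hom\<close>.\<close>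

definition Df :: "('i, 'k::field) dgmod set" where
  "Df = {M. dg_module M \<and> finite_dim_homology M}"

definition zero_object :: "('i, 'k::field) dgmod \<Rightarrow> bool" where
  "zero_object Z \<longleftrightarrow>
     Z \<in> Df \<and> (\<forall>X\<in>Df. (\<exists>!F. F \<in> Hom Z X) \<and> (\<exists>!F. F \<in> Hom X Z))"

text \<open>Finite direct sums in an additive category are its finite coproducts.\<close>

definition direct_sum ::
    "('i, 'k::field) dgmod \<Rightarrow> ('i, 'k) dgmod \<Rightarrow> ('i, 'k) dgmod \<Rightarrow> bool" where
  "direct_sum X Y Z \<longleftrightarrow>
     X \<in> Df \<and> Y \<in> Df \<and> Z \<in> Df \<and>
     (\<exists>I\<in>Hom X Z. \<exists>J\<in>Hom Y Z. \<forall>W\<in>Df. \<forall>F\<in>Hom X W. \<forall>G\<in>Hom Y W.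
        \<exists>!H. H \<in> Hom Z W \<and> D_comp X Z W H I = F \<and> D_comp Y Z W H J = G)"

text \<open>
  A full subcategory is given by its objects. The empty direct sum is a zero object. Closure
  under isomorphism follows from the other conditions and is listed for convenience.
\<close>

definition subcategory :: "('i, 'k::field) dgmod set \<Rightarrow> bool" where
  "subcategory U \<longleftrightarrow>
     U \<subseteq> Df \<and>
     (\<forall>X\<in>U. \<forall>Y\<in>Df. (\<exists>F. D_iso X Y F) \<longrightarrow> Y \<in> U) \<and>
     (\<forall>Z. zero_object Z \<longrightarrow> Z \<in> U) \<and>
     (\<forall>X\<in>U. \<forall>Y\<in>U. \<forall>Z. direct_sum X Y Z \<longrightarrow> Z \<in> U) \<and>
     (\<forall>X Y. \<forall>Z\<in>U. direct_sum X Y Z \<longrightarrow> X \<in> U \<and> Y \<in> U)"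

definition torsion_theory :: "('i, 'k::field) dgmod set \<Rightarrow> ('i, 'k) dgmod set \<Rightarrow> bool" where
  "torsion_theory U V \<longleftrightarrow>
     subcategory U \<and> subcategory V \<and>
     (\<forall>u\<in>U. \<forall>v\<in>V. Hom u v = {D_zero u v}) \<and>
     (\<forall>d\<in>Df. \<exists>u\<in>U. \<exists>v\<in>V. \<exists>F G H. dist_triangle u d v F G H)"

definition co_t_structure :: "('i, 'k::field) dgmod set \<Rightarrow> ('i, 'k) dgmod set \<Rightarrow> bool" where
  "co_t_structure U V \<longleftrightarrow> torsion_theory U V \<and> shift (-1) ` U \<subseteq> U"

end

(* If the top homological degree of X and the bottom one of Y differ by 2, there is a nonzero
   morphism X -> Y: it is dual, by the 2-Calabi-Yau property, to the evident one Y -> Sigma^2 X, but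
   it is written down explicitly below. As U is closed under Sigma^-1, every degree in which an object
   of U has homology is therefore smaller by more than 2 than every such degree for V. Suppose that
   some object of V is not acyclic. Let t be the largest degree in which some object of U has
   homology, and take a triangle u -> d -> v with H_(t+1) d nonzero. Since H_(t+1) u = 0, v has
   homology in degree t + 1, which is too small. So V consists of acyclic modules, and u -> d is
   an isomorphism for every d. *)

theory Submission
  imports Defs
begin

text \<open>The 2 arises as 1 + 1. If X is extended by Sigma^-1 Y with split differential, only the
  action of \<open>T\<close> can mix the summands, by a map \<phi> from X_i to (Sigma^-1 Y)_(i+1) =
  Y_(i+2). As k[T] is free on \<open>T\<close>, every chain map \<phi> of degree 2 is admissible,
  and the extension is classified by a morphism X \<rightarrow> Y. This morphism vanishes on
  homology, so homology cannot detect it: a supposed null homotopy has to be evaluated on a top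
  class instead.

  Most of the length comes from the derived category itself. Morphisms are classes of roofs whose
  apices all have one index type, so homotopy pullbacks must be repacked into that type. One
  construction, a homotopy pullback with optional twist, serves the calculus of fractions and the
  nonzero morphism alike. Distinguished triangles are only isomorphic to cones, so isomorphisms have
  to be turned into pairs of quasi-isomorphisms, and back.

  The maximum t exists because a single object of V with homology bounds all degrees of U from
  above.\<close>

section \<open>Linear maps between subspaces of the ambient spaces\<close>

lemma linear_onD:
  assumes "linear_on S S' f" "fvs.subspace S"
  shows "x \<in> S \<Longrightarrow> f x \<in> S'"
    and "x \<in> S \<Longrightarrow> y \<in> S \<Longrightarrow> f (x + y) = f x + f y"
    and "x \<in> S \<Longrightarrow> f (fscale c x) = fscale c (f x)"
    and "f 0 = 0"
    and "x \<in> S \<Longrightarrow> f (- x) = - f x"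
    and "x \<in> S \<Longrightarrow> y \<in> S \<Longrightarrow> f (x - y) = f x - f y"
proof -
  show 1: "x \<in> S \<Longrightarrow> f x \<in> S'" for x using assms by (auto simp: linear_on_def)
  show 2: "x \<in> S \<Longrightarrow> y \<in> S \<Longrightarrow> f (x + y) = f x + f y" for x y
    using assms by (auto simp: linear_on_def)
  show 3: "x \<in> S \<Longrightarrow> f (fscale c x) = fscale c (f x)" for x c
    using assms by (auto simp: linear_on_def)
  have "0 \<in> S" using assms(2) by (simp add: fvs.subspace_0)
  from 3[OF this, of 0] show "f 0 = 0" by (simp add: fvs.scale_zero_left)
  show 4: "x \<in> S \<Longrightarrow> f (- x) = - f x" for x
    using 3[of x "- 1"] by simp
  show "x \<in> S \<Longrightarrow> y \<in> S \<Longrightarrow> f (x - y) = f x - f y"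
    using 2[of x "- y"] 4[of y] assms(2) by (simp add: fvs.subspace_neg)
qed

lemma linear_on_gid: "linear_on S S (\<lambda>x. x)"
  by (simp add: linear_on_def)

lemma linear_on_zero: "fvs.subspace S' \<Longrightarrow> linear_on S S' (\<lambda>x. 0)"
  by (simp add: linear_on_def fvs.subspace_0)

lemma linear_on_comp:
  "linear_on S S' f \<Longrightarrow> linear_on S' S'' g \<Longrightarrow> linear_on S S'' (\<lambda>x. g (f x))"
  by (simp add: linear_on_def)

lemma linear_on_add:
  "linear_on S S' f \<Longrightarrow> linear_on S S' g \<Longrightarrow> fvs.subspace S' \<Longrightarrow> linear_on S S' (\<lambda>x. f x + g x)"
  by (auto simp: linear_on_def fvs.subspace_add fvs.scale_right_distrib)

lemma linear_on_neg:
  "linear_on S S' f \<Longrightarrow> fvs.subspace S' \<Longrightarrow> linear_on S S' (\<lambda>x. - f x)"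
  by (auto simp: linear_on_def fvs.subspace_neg)

lemma linear_on_diff:
  "linear_on S S' f \<Longrightarrow> linear_on S S' g \<Longrightarrow> fvs.subspace S' \<Longrightarrow> linear_on S S' (\<lambda>x. f x - g x)"
  by (auto simp: linear_on_def fvs.subspace_diff fvs.scale_right_diff_distrib)

lemma linear_on_scale:
  "linear_on S S' f \<Longrightarrow> fvs.subspace S' \<Longrightarrow> linear_on S S' (\<lambda>x. fscale c (f x))"
  by (auto simp: linear_on_def fvs.subspace_scale fvs.scale_right_distrib mult.commute)


section \<open>DG modules in terms of the action of \<open>T\<close>\<close>

definition Tact :: "('i, 'k::field) dgmod \<Rightarrow> int \<Rightarrow> ('i \<Rightarrow> 'k) \<Rightarrow> ('i \<Rightarrow> 'k)" where
  "Tact M i = act M i (monom 1 1)"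

fun Tpow :: "(int \<Rightarrow> 'v \<Rightarrow> 'v) \<Rightarrow> nat \<Rightarrow> int \<Rightarrow> 'v \<Rightarrow> 'v" where
  "Tpow t 0 i x = x"
| "Tpow t (Suc n) i x = t (i + int n) (Tpow t n i x)"

text \<open>A homogeneous polynomial has at most one nonzero coefficient. Zero is a case of its own
  because it lies in every degree and hence does not determine \<open>n\<close>.\<close>

lemma kT_cases:
  assumes "p \<in> kT n"
  obtains "p = 0" | c a where "n = int a" "p = monom c a"
proof (cases "p = 0")
  case False
  then have n: "int (degree p) = n"
    using assms by (auto simp: kT_def)
  have "coeff p m = coeff (monom (lead_coeff p) (degree p)) m" for m
    using assms n by (auto simp: kT_def)
  then have "p = monom (lead_coeff p) (degree p)"
    by (intro poly_eqI)
  then show ?thesis using n that(2) by metis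
qed (use that in auto)

lemma monom_in_kT: "monom c a \<in> kT (int a)"
  by (auto simp: kT_def split: if_splits)

lemma zero_in_kT: "0 \<in> kT n"
  by (auto simp: kT_def)

lemma dg_moduleD:
  fixes M :: "('i, 'k::field) dgmod"
  assumes "dg_module M"
  shows "fvs.subspace (piece M i)"
    and "linear_on (piece M i) (piece M (i - 1)) (dif M i)"
    and "x \<in> piece M i \<Longrightarrow> dif M (i - 1) (dif M i x) = 0"
    and "linear_on (piece M i) (piece M (i + 1)) (Tact M i)"
    and "x \<in> piece M i \<Longrightarrow> dif M (i + 1) (Tact M i x) = - Tact M (i - 1) (dif M i x)"
proof -
  show "fvs.subspace (piece M i)" "linear_on (piece M i) (piece M (i - 1)) (dif M i)"
    "x \<in> piece M i \<Longrightarrow> dif M (i - 1) (dif M i x) = 0"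
    using assms by (auto simp: dg_module_def)
  have k: "monom 1 1 \<in> (kT 1 :: 'k poly set)" using monom_in_kT[of 1 1] by simp
  have "\<forall>n i. \<forall>p\<in>kT n. linear_on (piece M i) (piece M (n + i)) (act M i p)"
    using assms unfolding dg_module_def by (elim conjE)
  from this[rule_format, OF k, of i]
  show "linear_on (piece M i) (piece M (i + 1)) (Tact M i)"
    by (simp add: Tact_def add.commute)
  assume "x \<in> piece M i"
  then have "dif M (1 + i) (act M i (monom 1 1) x) = ksign 1 (act M (i - 1) (monom 1 1) (dif M i x))"
    using assms k unfolding dg_module_def by blast
  then show "dif M (i + 1) (Tact M i x) = - Tact M (i - 1) (dif M i x)"
    by (simp add: Tact_def add.commute ksign_def)
qed

lemmas piece_0 = fvs.subspace_0[OF dg_moduleD(1)]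
lemmas piece_add = fvs.subspace_add[OF dg_moduleD(1)]
lemmas piece_neg = fvs.subspace_neg[OF dg_moduleD(1)]
lemmas piece_diff = fvs.subspace_diff[OF dg_moduleD(1)]
lemmas piece_scale = fvs.subspace_scale[OF dg_moduleD(1)]

lemma dif_linear:
  assumes "dg_module M"
  shows "x \<in> piece M i \<Longrightarrow> dif M i x \<in> piece M (i - 1)"
    and "x \<in> piece M i \<Longrightarrow> y \<in> piece M i \<Longrightarrow> dif M i (x + y) = dif M i x + dif M i y"
    and "x \<in> piece M i \<Longrightarrow> dif M i (fscale c x) = fscale c (dif M i x)"
    and "dif M i 0 = 0"
    and "x \<in> piece M i \<Longrightarrow> dif M i (- x) = - dif M i x"
    and "x \<in> piece M i \<Longrightarrow> y \<in> piece M i \<Longrightarrow> dif M i (x - y) = dif M i x - dif M i y"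
  using linear_onD[OF dg_moduleD(2)[OF assms] dg_moduleD(1)[OF assms]] by blast+

lemma Tact_linear:
  assumes "dg_module M"
  shows "x \<in> piece M i \<Longrightarrow> Tact M i x \<in> piece M (i + 1)"
    and "x \<in> piece M i \<Longrightarrow> y \<in> piece M i \<Longrightarrow> Tact M i (x + y) = Tact M i x + Tact M i y"
    and "x \<in> piece M i \<Longrightarrow> Tact M i (fscale c x) = fscale c (Tact M i x)"
    and "Tact M i 0 = 0"
    and "x \<in> piece M i \<Longrightarrow> Tact M i (- x) = - Tact M i x"
    and "x \<in> piece M i \<Longrightarrow> y \<in> piece M i \<Longrightarrow> Tact M i (x - y) = Tact M i x - Tact M i y"
  using linear_onD[OF dg_moduleD(4)[OF assms] dg_moduleD(1)[OF assms]] by blast+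

lemma Tpow_in: "dg_module M \<Longrightarrow> x \<in> piece M i \<Longrightarrow> Tpow (Tact M) a i x \<in> piece M (i + int a)"
proof (induction a)
  case (Suc a)
  then show ?case
    using Tact_linear(1)[of M "Tpow (Tact M) a i x" "i + int a"] by (simp add: ac_simps)
qed auto

lemma act_zero:
  fixes M :: "('i, 'k::field) dgmod"
  assumes "dg_module M" "x \<in> piece M i"
  shows "act M i 0 x = 0"
proof -
  have "act M i (smult 0 0) x = fscale 0 (act M i 0 x)"
    using assms zero_in_kT[of 0] unfolding dg_module_def by blast
  then show ?thesis by simp
qed

lemma act_monom:
  fixes M :: "('i, 'k::field) dgmod"
  assumes "dg_module M" "x \<in> piece M i"
  shows "act M i (monom c a) x = fscale c (Tpow (Tact M) a i x)"
proof -
  have 1: "act M i (monom 1 a) x = Tpow (Tact M) a i x" for a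
  proof (induction a)
    case 0
    then show ?case using assms by (simp add: dg_module_def)
  next
    case (Suc a)
    have "monom 1 1 \<in> (kT 1 :: 'k poly set)" using monom_in_kT[of 1 1] by simp
    then have "act M i (monom 1 1 * monom 1 a) x = act M (int a + i) (monom 1 1) (act M i (monom 1 a) x)"
      using assms monom_in_kT[of "1 :: 'k" a] unfolding dg_module_def by blast
    then show ?case by (simp add: mult_monom Suc Tact_def ac_simps)
  qed
  have "act M i (smult c (monom 1 a)) x = fscale c (act M i (monom 1 a) x)"
    using assms monom_in_kT[of "1 :: 'k" a] unfolding dg_module_def by blast
  then show ?thesis by (simp add: 1 smult_monom)
qed

text \<open>\<open>T\<close> generates k[T], so compatibility with \<open>T\<close> extends to its
  powers by induction and to all homogeneous elements by \<open>kT_cases\<close>.\<close>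

lemma dg_hom_iff:
  fixes M :: "('i, 'k::field) dgmod"
  assumes "dg_module M" "dg_module N"
  shows "dg_hom M N f \<longleftrightarrow>
     (\<forall>i. linear_on (piece M i) (piece N i) (f i)) \<and>
     (\<forall>i. \<forall>x\<in>piece M i. f (i - 1) (dif M i x) = dif N i (f i x)) \<and>
     (\<forall>i. \<forall>x\<in>piece M i. f (i + 1) (Tact M i x) = Tact N i (f i x))" (is "_ \<longleftrightarrow> ?R")
proof
  assume d: "dg_hom M N f"
  have "f (1 + i) (act M i (monom 1 1) x) = act N i (monom 1 1) (f i x)" if "x \<in> piece M i" for i x
    using d that monom_in_kT[of "1 :: 'k" 1] unfolding dg_hom_def by simp
  then show ?R using d by (simp add: dg_hom_def Tact_def add.commute)
next
  assume R: ?R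
  note lin = linear_onD[OF R[THEN conjunct1, rule_format] dg_moduleD(1)[OF assms(1)]]
  have P: "f (i + int a) (Tpow (Tact M) a i x) = Tpow (Tact N) a i (f i x)" if "x \<in> piece M i" for i a x
  proof (induction a)
    case (Suc a)
    have "f (i + int a + 1) (Tact M (i + int a) (Tpow (Tact M) a i x)) =
        Tact N (i + int a) (f (i + int a) (Tpow (Tact M) a i x))"
      using R Tpow_in[OF assms(1) that] by blast
    then show ?case using Suc by (simp add: ac_simps)
  qed auto
  have "f (n + i) (act M i p x) = act N i p (f i x)" if "p \<in> kT n" "x \<in> piece M i" for n i p x
    using that(1)
  proof (cases rule: kT_cases)
    case 1
    then show ?thesis using that(2) assms lin by (simp add: act_zero)
  next
    case (2 c a)
    have "f (n + i) (act M i p x) = f (i + int a) (fscale c (Tpow (Tact M) a i x))"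
      using 2 that(2) assms by (simp add: act_monom add.commute)
    also have "\<dots> = fscale c (f (i + int a) (Tpow (Tact M) a i x))"
      using lin(3) Tpow_in[OF assms(1) that(2)] by blast
    also have "\<dots> = act N i p (f i x)"
      using P[OF that(2)] 2 assms lin(1)[OF that(2)] by (simp add: act_monom)
    finally show ?thesis .
  qed
  then show "dg_hom M N f" using R by (simp add: dg_hom_def)
qed

lemma ksign_Suc: "ksign (1 + int a) (x :: 'v::group_add) = - ksign (int a) x"
  by (simp add: ksign_def)

text \<open>A homotopy has degree 1 and picks up one sign for each factor \<open>T\<close> it
  passes; after \<open>n\<close> factors these signs make up \<open>ksign n\<close>.\<close>

lemma homotopic_iff:
  fixes M :: "('i, 'k::field) dgmod"
  assumes "dg_module M" "dg_module N"
  shows "homotopic M N f g \<longleftrightarrow>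
     (\<exists>s. (\<forall>i. linear_on (piece M i) (piece N (i + 1)) (s i)) \<and>
          (\<forall>i. \<forall>x\<in>piece M i. s (i + 1) (Tact M i x) = - Tact N (i + 1) (s i x)) \<and>
          (\<forall>i. \<forall>x\<in>piece M i. f i x - g i x = dif N (i + 1) (s i x) + s (i - 1) (dif M i x)))"
    (is "_ \<longleftrightarrow> (\<exists>s. ?R s)")
proof
  assume "homotopic M N f g"
  then obtain s where
    s: "\<And>i. linear_on (piece M i) (piece N (i + 1)) (s i)"
      "\<And>n i p x. p \<in> kT n \<Longrightarrow> x \<in> piece M i \<Longrightarrow>
          s (n + i) (act M i p x) = ksign n (act N (i + 1) p (s i x))"
      "\<And>i x. x \<in> piece M i \<Longrightarrow> f i x - g i x = dif N (i + 1) (s i x) + s (i - 1) (dif M i x)"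
    unfolding homotopic_def by metis
  have "s (i + 1) (Tact M i x) = - Tact N (i + 1) (s i x)" if "x \<in> piece M i" for i x
    using s(2)[of "monom 1 1" 1 x i] that monom_in_kT[of "1 :: 'k" 1]
    by (simp add: Tact_def add.commute ksign_def)
  then show "\<exists>s. ?R s" using s(1,3) by auto
next
  assume "\<exists>s. ?R s"
  then obtain s where R: "?R s" ..
  note lin = linear_onD[OF R[THEN conjunct1, rule_format] dg_moduleD(1)[OF assms(1)]]
  have P: "s (i + int a) (Tpow (Tact M) a i x) = ksign (int a) (Tpow (Tact N) a (i + 1) (s i x))"
    if "x \<in> piece M i" for i a x
  proof (induction a)
    case 0
    show ?case by (simp add: ksign_def)
  next
    case (Suc a)
    have *: "Tpow (Tact N) a (i + 1) (s i x) \<in> piece N (i + 1 + int a)"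
      by (rule Tpow_in[OF assms(2) lin(1)[OF that]])
    have "s (i + int a + 1) (Tact M (i + int a) (Tpow (Tact M) a i x)) =
        - Tact N (i + int a + 1) (s (i + int a) (Tpow (Tact M) a i x))"
      using R Tpow_in[OF assms(1) that] by blast
    also have "\<dots> = - ksign (int a) (Tact N (i + 1 + int a) (Tpow (Tact N) a (i + 1) (s i x)))"
      using Suc Tact_linear(5)[OF assms(2) *] by (simp add: ksign_def ac_simps)
    finally show ?case by (simp add: ksign_Suc ac_simps)
  qed
  have "s (n + i) (act M i p x) = ksign n (act N (i + 1) p (s i x))" if "p \<in> kT n" "x \<in> piece M i" for n i p x
    using that(1)
  proof (cases rule: kT_cases)
    case 1
    then show ?thesis using that(2) assms lin by (simp add: act_zero ksign_def)
  next
    case (2 c a)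
    have "s (n + i) (act M i p x) = s (i + int a) (fscale c (Tpow (Tact M) a i x))"
      using 2 that(2) assms by (simp add: act_monom add.commute)
    also have "\<dots> = fscale c (s (i + int a) (Tpow (Tact M) a i x))"
      using lin(3) Tpow_in[OF assms(1) that(2)] by blast
    also have "\<dots> = ksign n (act N (i + 1) p (s i x))"
      using P[OF that(2)] 2 assms lin(1)[OF that(2)] by (simp add: act_monom ksign_def)
    finally show ?thesis .
  qed
  then show "homotopic M N f g" using R unfolding homotopic_def by blast
qed

text \<open>\<open>act\<close> looks only at the leading coefficient and the degree. For homogeneous
  polynomials this is all there is, zero included; other polynomials are irrelevant.\<close>

definition mk_dg ::
    "(int \<Rightarrow> ('i \<Rightarrow> 'k::field) set) \<Rightarrow> ('i, 'i, 'k) gmap \<Rightarrow> ('i, 'i, 'k) gmap \<Rightarrow> ('i, 'k) dgmod" where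
  "mk_dg P d t = \<lparr> piece = P, dif = d,
     act = (\<lambda>i p x. fscale (coeff p (degree p)) (Tpow t (degree p) i x)) \<rparr>"

lemma mk_dg_sel: "piece (mk_dg P d t) = P" "dif (mk_dg P d t) = d"
  by (simp_all add: mk_dg_def)

lemma act_mk_dg_monom: "act (mk_dg P d t) i (monom c a) x = fscale c (Tpow t a i x)"
  by (cases "c = 0") (simp_all add: mk_dg_def degree_monom_eq)

lemma Tact_mk_dg: "Tact (mk_dg P d t) = t"
  by (intro ext) (simp add: Tact_def act_mk_dg_monom del: One_nat_def, simp)

text \<open>As k[T] is free on \<open>T\<close>, any degree 1 map anticommuting with the
  differential may serve as the action of \<open>T\<close>: there is no relation to check. This
  freedom is what later permits the twists.\<close>

lemma dg_module_mk_dg: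
  assumes P: "\<And>i. fvs.subspace (P i)"
    and d: "\<And>i. linear_on (P i) (P (i - 1)) (d i)"
    and t: "\<And>i. linear_on (P i) (P (i + 1)) (t i)"
    and dd: "\<And>i x. x \<in> P i \<Longrightarrow> d (i - 1) (d i x) = 0"
    and dt: "\<And>i x. x \<in> P i \<Longrightarrow> d (i + 1) (t i x) = - t (i - 1) (d i x)"
  shows "dg_module (mk_dg P d t)"
proof -
  let ?M = "mk_dg P d t"
  note td = linear_onD[OF t P] note dl = linear_onD[OF d P]
  have lin: "linear_on (P i) (P (i + int a)) (Tpow t a i)" for i a
  proof (induction a)
    case 0
    then show ?case by (simp add: linear_on_def)
  next
    case (Suc a)
    from linear_on_comp[OF this t] show ?case by (simp add: ac_simps)
  qed
  note ll = linear_onD[OF lin P]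
  have comm: "d (i + int a) (Tpow t a i x) = ksign (int a) (Tpow t a (i - 1) (d i x))" if "x \<in> P i" for i a x
  proof (induction a)
    case 0
    then show ?case by (simp add: ksign_def)
  next
    case (Suc a)
    have *: "Tpow t a (i - 1) (d i x) \<in> P (i - 1 + int a)"
      using ll(1) dl(1) that by blast
    have "d (i + int a + 1) (t (i + int a) (Tpow t a i x)) = - t (i + int a - 1) (d (i + int a) (Tpow t a i x))"
      using dt ll(1) that by blast
    also have "\<dots> = - ksign (int a) (t (i - 1 + int a) (Tpow t a (i - 1) (d i x)))"
      using Suc td(5)[OF *] by (simp add: ksign_def algebra_simps)
    finally show ?case by (simp add: ksign_Suc ac_simps)
  qed
  have pow: "Tpow t (b + a) i x = Tpow t b (i + int a) (Tpow t a i x)" for a b i x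
    by (induction b) (simp_all add: ac_simps)
  have act0: "act ?M i 0 x = 0" for i x by (simp add: mk_dg_def)
  note am = act_mk_dg_monom
  have act_lin: "linear_on (P i) (P (n + i)) (act ?M i p)" if "p \<in> kT n" for n i p
    using that
  proof (cases rule: kT_cases)
    case 1
    then have "act ?M i p = (\<lambda>x. 0)" using act0 by auto
    then show ?thesis using linear_on_zero[OF P] by simp
  next
    case (2 c a)
    then have "act ?M i p = (\<lambda>x. fscale c (Tpow t a i x))"
      by (intro ext) (simp add: am)
    then show ?thesis using 2 linear_on_scale[OF lin P, of i a c] by (simp add: add.commute)
  qed
  have 2: "act ?M i (p + q) x = act ?M i p x + act ?M i q x"
    if "p \<in> kT n" "q \<in> kT n" "x \<in> P i" for n i p q x
    using that(1)
  proof (cases rule: kT_cases)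
    case 1
    then show ?thesis by (simp add: act0)
  next
    case a: (2 c a)
    show ?thesis
      using that(2)
    proof (cases rule: kT_cases)
      case 1
      then show ?thesis by (simp add: act0)
    next
      case (2 c' a')
      then show ?thesis using a by (simp add: am add_monom fvs.scale_left_distrib)
    qed
  qed
  have 3: "act ?M i (smult c p) x = fscale c (act ?M i p x)" if "p \<in> kT n" for n i c p x
    using that by (cases rule: kT_cases) (simp_all add: act0 am smult_monom)
  have 4: "act ?M i 1 x = x" for i x
    using am[of P d t i 1 0 x] by simp
  have 5: "act ?M i (q * p) x = act ?M (n + i) q (act ?M i p x)"
    if "q \<in> kT m" "p \<in> kT n" "x \<in> P i" for m n i p q x
    using that(2)
  proof (cases rule: kT_cases)
    case 1
    then show ?thesis using linear_onD(4)[OF act_lin[OF that(1)] P] by (simp add: act0)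
  next
    case a: (2 c a)
    show ?thesis
      using that(1)
    proof (cases rule: kT_cases)
      case 1
      then show ?thesis by (simp add: act0)
    next
      case (2 c' a')
      then show ?thesis using a ll(1,3)[OF that(3)] ll(3)[OF ll(1)[OF that(3)]]
        by (simp add: am mult_monom pow add.commute)
    qed
  qed
  have 6: "d (n + i) (act ?M i p x) = ksign n (act ?M (i - 1) p (d i x))"
    if "p \<in> kT n" "x \<in> P i" for n i p x
    using that(1)
  proof (cases rule: kT_cases)
    case 1
    then show ?thesis using dl(4) by (simp add: act0 ksign_def)
  next
    case (2 c a)
    have "d (i + int a) (fscale c (Tpow t a i x)) = fscale c (d (i + int a) (Tpow t a i x))"
      using dl(3) ll(1) that(2) by blast
    then show ?thesis using 2 comm[OF that(2)] by (simp add: am ksign_def add.commute)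
  qed
  show ?thesis
    unfolding dg_module_def mk_dg_sel
    by (intro conjI allI ballI; (rule P d dd act_lin 2 3 4 5 6; assumption))
qed

section \<open>Homology and homotopies\<close>

lemma dg_homD:
  assumes "dg_hom M N f" "dg_module M"
  shows "linear_on (piece M i) (piece N i) (f i)"
    and "x \<in> piece M i \<Longrightarrow> f i x \<in> piece N i"
    and "x \<in> piece M i \<Longrightarrow> y \<in> piece M i \<Longrightarrow> f i (x + y) = f i x + f i y"
    and "f i 0 = 0"
    and "x \<in> piece M i \<Longrightarrow> f i (- x) = - f i x"
    and "x \<in> piece M i \<Longrightarrow> y \<in> piece M i \<Longrightarrow> f i (x - y) = f i x - f i y"
    and "x \<in> piece M i \<Longrightarrow> dif N i (f i x) = f (i - 1) (dif M i x)"
proof -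
  show "linear_on (piece M i) (piece N i) (f i)"
    "x \<in> piece M i \<Longrightarrow> dif N i (f i x) = f (i - 1) (dif M i x)"
    using assms(1) by (auto simp: dg_hom_def)
  note linear_onD[OF this(1) dg_moduleD(1)[OF assms(2)]]
  then show "x \<in> piece M i \<Longrightarrow> f i x \<in> piece N i"
    "x \<in> piece M i \<Longrightarrow> y \<in> piece M i \<Longrightarrow> f i (x + y) = f i x + f i y"
    "f i 0 = 0" "x \<in> piece M i \<Longrightarrow> f i (- x) = - f i x"
    "x \<in> piece M i \<Longrightarrow> y \<in> piece M i \<Longrightarrow> f i (x - y) = f i x - f i y"
    by blast+
qed

lemma dg_hom_Tact:
  assumes "dg_hom M N f" "dg_module M" "dg_module N" "x \<in> piece M i"
  shows "Tact N i (f i x) = f (i + 1) (Tact M i x)"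
  using assms dg_hom_iff[of M N f] by auto

lemma dg_hom_gid: "dg_hom M M gid"
  by (simp add: dg_hom_def gid_def linear_on_def)

lemma dg_hom_gzero: "dg_module M \<Longrightarrow> dg_module N \<Longrightarrow> dg_hom M N gzero"
  by (simp add: dg_hom_iff gzero_def linear_on_zero[OF dg_moduleD(1)] dif_linear(4) Tact_linear(4))

lemma dg_hom_gcomp: "dg_hom M N f \<Longrightarrow> dg_hom N K g \<Longrightarrow> dg_hom M K (gcomp g f)"
  by (auto simp: dg_hom_def gcomp_def linear_on_def)

lemma gcomp_assoc: "gcomp (gcomp h g) f = gcomp h (gcomp g f)"
  by (simp add: gcomp_def)

lemma gcomp_gid: "gcomp f gid = f" "gcomp gid f = f"
  by (simp_all add: gcomp_def gid_def)

lemma gcomp_gzero: "gcomp gzero f = gzero"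
  unfolding gcomp_def gzero_def ..

lemma boundariesI: "x \<in> piece M (i + 1) \<Longrightarrow> dif M (i + 1) x \<in> boundaries M i"
  by (auto simp: boundaries_def)

lemma boundariesE:
  assumes "b \<in> boundaries M i"
  obtains x where "x \<in> piece M (i + 1)" "b = dif M (i + 1) x"
  using assms by (auto simp: boundaries_def)

lemma subspace_cycles: "dg_module M \<Longrightarrow> fvs.subspace (cycles M i)"
  by (auto intro!: fvs.subspaceI simp: cycles_def piece_0 piece_add piece_scale dif_linear)

lemma subspace_boundaries:
  assumes "dg_module M"
  shows "fvs.subspace (boundaries M i)"
proof (rule fvs.subspaceI)
  show "0 \<in> boundaries M i"
    using boundariesI[OF piece_0[OF assms]] dif_linear(4)[OF assms] by metis
next
  fix x y assume "x \<in> boundaries M i" "y \<in> boundaries M i"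
  then show "x + y \<in> boundaries M i"
    by (elim boundariesE)
      (metis assms boundariesI piece_add dif_linear(2))
next
  fix x c assume "x \<in> boundaries M i"
  then show "fscale c x \<in> boundaries M i"
    by (elim boundariesE)
      (metis assms boundariesI piece_scale dif_linear(3))
qed

lemmas cycles_diff = fvs.subspace_diff[OF subspace_cycles]
lemmas boundaries_0 = fvs.subspace_0[OF subspace_boundaries]
lemmas boundaries_diff = fvs.subspace_diff[OF subspace_boundaries]
lemmas boundaries_add = fvs.subspace_add[OF subspace_boundaries]
lemmas boundaries_neg = fvs.subspace_neg[OF subspace_boundaries]

lemma boundaries_subset_cycles:
  assumes "dg_module M"
  shows "boundaries M i \<subseteq> cycles M i"
proof
  fix b assume "b \<in> boundaries M i"
  then obtain x where "x \<in> piece M (i + 1)" "b = dif M (i + 1) x" by (rule boundariesE)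
  then show "b \<in> cycles M i"
    using dif_linear(1)[OF assms, of x "i + 1"] dg_moduleD(3)[OF assms, of x "i + 1"]
    by (simp add: cycles_def)
qed

lemma dg_hom_cycles: "dg_hom M N f \<Longrightarrow> dg_module M \<Longrightarrow> x \<in> cycles M i \<Longrightarrow> f i x \<in> cycles N i"
  by (auto simp: cycles_def dg_homD)

lemma dg_hom_boundaries:
  "dg_hom M N f \<Longrightarrow> dg_module M \<Longrightarrow> x \<in> boundaries M i \<Longrightarrow> f i x \<in> boundaries N i"
  by (elim boundariesE) (metis add_diff_cancel_right' boundariesI dg_homD(2,7))

section \<open>Homology maps and quasi-isomorphisms in terms of cycles and boundaries\<close>

lemma image_eq_image_iff:
  assumes "f ` S \<subseteq> g ` T"
  shows "f ` S = g ` T \<longleftrightarrow> (\<forall>y\<in>T. \<exists>x\<in>S. g y = f x)"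
proof -
  have "f ` S = g ` T \<longleftrightarrow> g ` T \<subseteq> f ` S" using assms by blast
  also have "\<dots> \<longleftrightarrow> (\<forall>y\<in>T. \<exists>x\<in>S. g y = f x)" by (simp add: image_subset_iff image_iff)
  finally show ?thesis .
qed

lemma hclass_eq_iff:
  assumes "dg_module M"
  shows "hclass M i x = hclass M i y \<longleftrightarrow> x - y \<in> boundaries M i"
proof
  assume "hclass M i x = hclass M i y"
  moreover have "x \<in> hclass M i x"
    using boundaries_0[OF assms, of i] by (force simp: hclass_def)
  ultimately show "x - y \<in> boundaries M i" by (auto simp: hclass_def)
next
  assume *: "x - y \<in> boundaries M i"
  have "hclass M i a \<subseteq> hclass M i b" if "a - b \<in> boundaries M i" for a b
  proof
    fix z assume "z \<in> hclass M i a"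
    then obtain c where c: "c \<in> boundaries M i" "z = a + c" by (auto simp: hclass_def)
    then have "z = b + ((a - b) + c)" by (simp add: algebra_simps)
    then show "z \<in> hclass M i b"
      using c boundaries_add[OF assms that c(1)] unfolding hclass_def by blast
  qed
  from this[OF *] this[of y x] boundaries_neg[OF assms *]
  show "hclass M i x = hclass M i y" by auto
qed

lemma homology_map_hclass:
  assumes "dg_module M" "dg_module N" "dg_hom M N f" "x \<in> cycles M i"
  shows "homology_map N f i (hclass M i x) = hclass N i (f i x)"
proof -
  have "hclass N i (f i (x + b)) = hclass N i (f i x)" if "b \<in> boundaries M i" for b
  proof -
    have "b \<in> piece M i" "x \<in> piece M i"
      using boundaries_subset_cycles[OF assms(1)] that assms(4) by (auto simp: cycles_def)
    then show ?thesis
      using dg_hom_boundaries[OF assms(3,1) that] dg_homD(3)[OF assms(3,1)]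
      by (simp add: hclass_eq_iff assms(2))
  qed
  note const = this
  have "hclass N i (f i y) = hclass N i (f i x)" if "y \<in> hclass M i x" for y
  proof -
    obtain b where "b \<in> boundaries M i" "y = x + b" using \<open>y \<in> hclass M i x\<close> by (auto simp: hclass_def)
    then show ?thesis using const[of b] by simp
  qed
  then have "(\<Union>y\<in>hclass M i x. hclass N i (f i y)) = (\<Union>y\<in>hclass M i x. hclass N i (f i x))"
    by (intro SUP_cong refl)
  moreover have "x \<in> hclass M i x"
    using boundaries_0[OF assms(1), of i] by (force simp: hclass_def)
  ultimately show ?thesis unfolding homology_map_def by (metis UN_constant empty_iff)
qed

text \<open>Bijectivity on sets of cosets becomes two conditions on representatives: no new
  boundaries arise, and every cycle is hit up to a boundary. Later arguments chase elements with
  these two and avoid quotients.\<close>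

lemma quasi_iso_iff:
  assumes M: "dg_module M" and N: "dg_module N"
  shows "quasi_iso M N f \<longleftrightarrow> dg_hom M N f \<and>
     (\<forall>i. \<forall>x\<in>cycles M i. f i x \<in> boundaries N i \<longrightarrow> x \<in> boundaries M i) \<and>
     (\<forall>i. \<forall>y\<in>cycles N i. \<exists>x\<in>cycles M i. y - f i x \<in> boundaries N i)"
proof (cases "dg_hom M N f")
  case True
  note hm = homology_map_hclass[OF M N True]
  have "inj_on (homology_map N f i) (homology M i) \<longleftrightarrow>
      (\<forall>x\<in>cycles M i. f i x \<in> boundaries N i \<longrightarrow> x \<in> boundaries M i)" for i
  proof
    assume L: "inj_on (homology_map N f i) (homology M i)"
    show "\<forall>x\<in>cycles M i. f i x \<in> boundaries N i \<longrightarrow> x \<in> boundaries M i"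
    proof (intro ballI impI)
      fix x assume x: "x \<in> cycles M i" "f i x \<in> boundaries N i"
      have 0: "0 \<in> cycles M i" using subspace_cycles[OF M] by (rule fvs.subspace_0)
      have "homology_map N f i (hclass M i x) = homology_map N f i (hclass M i 0)"
        using x hm[OF x(1)] hm[OF 0] by (simp add: hclass_eq_iff[OF N] dg_homD(4)[OF True M])
      then have "hclass M i x = hclass M i 0"
        using L x(1) 0 by (auto simp: inj_on_def homology_def)
      then show "x \<in> boundaries M i" by (simp add: hclass_eq_iff[OF M])
    qed
  next
    assume R: "\<forall>x\<in>cycles M i. f i x \<in> boundaries N i \<longrightarrow> x \<in> boundaries M i"
    show "inj_on (homology_map N f i) (homology M i)"
      unfolding homology_def
    proof (rule inj_onI, elim imageE, simp)
      fix x y assume xy: "x \<in> cycles M i" "y \<in> cycles M i"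
        and "homology_map N f i (hclass M i x) = homology_map N f i (hclass M i y)"
      then have "f i x - f i y \<in> boundaries N i"
        by (simp add: hm hclass_eq_iff[OF N])
      moreover have "x \<in> piece M i" "y \<in> piece M i" using xy by (auto simp: cycles_def)
      ultimately have "f i (x - y) \<in> boundaries N i"
        using dg_homD(6)[OF True M] by simp
      then show "hclass M i x = hclass M i y"
        using R cycles_diff[OF M xy] by (simp add: hclass_eq_iff[OF M])
    qed
  qed
  moreover have "homology_map N f i ` homology M i = homology N i \<longleftrightarrow>
      (\<forall>y\<in>cycles N i. \<exists>x\<in>cycles M i. y - f i x \<in> boundaries N i)" for i
  proof -
    have im: "homology_map N f i ` homology M i = (\<lambda>x. hclass N i (f i x)) ` cycles M i"
      by (auto simp: homology_def image_image hm)
    have "homology_map N f i ` homology M i \<subseteq> homology N i"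
      unfolding im using dg_hom_cycles[OF True M] by (auto simp: homology_def)
    then have "homology_map N f i ` homology M i = homology N i \<longleftrightarrow>
        (\<forall>y\<in>cycles N i. \<exists>x\<in>cycles M i. hclass N i y = hclass N i (f i x))"
      unfolding im unfolding homology_def by (rule image_eq_image_iff)
    then show ?thesis by (simp add: hclass_eq_iff[OF N])
  qed
  ultimately show ?thesis
    using True by (simp add: quasi_iso_def bij_betw_def all_conj_distrib)
qed (simp add: quasi_iso_def)

lemma quasi_isoD:
  assumes "quasi_iso M N f" "dg_module M" "dg_module N"
  shows "dg_hom M N f"
    and "x \<in> cycles M i \<Longrightarrow> f i x \<in> boundaries N i \<Longrightarrow> x \<in> boundaries M i"
    and "y \<in> cycles N i \<Longrightarrow> \<exists>x\<in>cycles M i. y - f i x \<in> boundaries N i"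
  using assms quasi_iso_iff[OF assms(2,3), of f] by auto

lemma quasi_iso_hom: "quasi_iso M N f \<Longrightarrow> dg_hom M N f"
  by (simp add: quasi_iso_def)

lemma quasi_iso_gid: "dg_module M \<Longrightarrow> quasi_iso M M gid"
  by (auto simp: quasi_iso_iff dg_hom_gid) (auto simp: gid_def intro!: bexI boundaries_0)

lemma quasi_iso_gcomp:
  assumes "quasi_iso M N f" "quasi_iso N K g" "dg_module M" "dg_module N" "dg_module K"
  shows "quasi_iso M K (gcomp g f)"
proof -
  note f = quasi_isoD[OF assms(1,3,4)] and g = quasi_isoD[OF assms(2,4,5)]
  have "\<exists>x\<in>cycles M i. z - g i (f i x) \<in> boundaries K i" if z: "z \<in> cycles K i" for i z
  proof -
    obtain y where y: "y \<in> cycles N i" "z - g i y \<in> boundaries K i"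
      using g(3)[OF z] by blast
    obtain x where x: "x \<in> cycles M i" "y - f i x \<in> boundaries N i"
      using f(3)[OF y(1)] by blast
    have "g i (y - f i x) = g i y - g i (f i x)"
      using y x dg_hom_cycles[OF f(1) assms(3)] by (intro dg_homD(6)[OF g(1) assms(4)]) (auto simp: cycles_def)
    then have eq: "z - g i (f i x) = (z - g i y) + g i (y - f i x)" by (simp add: algebra_simps)
    have "z - g i (f i x) \<in> boundaries K i"
      unfolding eq by (rule boundaries_add[OF assms(5) y(2) dg_hom_boundaries[OF g(1) assms(4) x(2)]])
    then show ?thesis using x(1) by blast
  qed
  then show ?thesis
    using f(1,2) g(1,2) dg_hom_cycles[OF f(1) assms(3)] dg_hom_gcomp[OF f(1) g(1)]
    by (auto simp: quasi_iso_iff assms gcomp_def)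
qed

lemma quasi_iso_cancel_left:
  assumes "quasi_iso M K (gcomp g f)" "quasi_iso N K g" "dg_hom M N f"
    "dg_module M" "dg_module N" "dg_module K"
  shows "quasi_iso M N f"
proof -
  note h = quasi_isoD[OF assms(1,4,6)] and g = quasi_isoD[OF assms(2,5,6)]
  have "\<exists>x\<in>cycles M i. y - f i x \<in> boundaries N i" if y: "y \<in> cycles N i" for i y
  proof -
    obtain x where x: "x \<in> cycles M i" "g i y - g i (f i x) \<in> boundaries K i"
      using h(3)[OF dg_hom_cycles[OF g(1) assms(5) y]] by (auto simp: gcomp_def)
    have fx: "f i x \<in> cycles N i" by (rule dg_hom_cycles[OF assms(3,4) x(1)])
    have "g i (y - f i x) = g i y - g i (f i x)"
      using y fx by (intro dg_homD(6)[OF g(1) assms(5)]) (auto simp: cycles_def)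
    then show ?thesis using x g(2)[OF cycles_diff[OF assms(5) y fx]] by auto
  qed
  moreover have "x \<in> boundaries M i" if "x \<in> cycles M i" "f i x \<in> boundaries N i" for i x
    using h(2)[OF that(1)] dg_hom_boundaries[OF g(1) assms(5) that(2)] by (simp add: gcomp_def)
  ultimately show ?thesis
    using assms by (auto simp: quasi_iso_iff)
qed

lemma quasi_iso_cancel_right:
  assumes "quasi_iso M K (gcomp g f)" "quasi_iso M N f" "dg_hom N K g"
    "dg_module M" "dg_module N" "dg_module K"
  shows "quasi_iso N K g"
proof -
  note h = quasi_isoD[OF assms(1,4,6)] and f = quasi_isoD[OF assms(2,4,5)]
  have "y \<in> boundaries N i" if y: "y \<in> cycles N i" "g i y \<in> boundaries K i" for i y
  proof -
    obtain x where x: "x \<in> cycles M i" "y - f i x \<in> boundaries N i"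
      using f(3)[OF y(1)] by blast
    have fx: "f i x \<in> cycles N i" by (rule dg_hom_cycles[OF f(1) assms(4) x(1)])
    have "g i (y - f i x) = g i y - g i (f i x)"
      using y fx by (intro dg_homD(6)[OF assms(3,5)]) (auto simp: cycles_def)
    then have "g i (f i x) = g i y - g i (y - f i x)" by simp
    then have "g i (f i x) \<in> boundaries K i"
      using boundaries_diff[OF assms(6) y(2) dg_hom_boundaries[OF assms(3,5) x(2)]] by simp
    then have "x \<in> boundaries M i" using h(2)[OF x(1)] by (simp add: gcomp_def)
    then show ?thesis
      using boundaries_add[OF assms(5) x(2) dg_hom_boundaries[OF f(1) assms(4)]] by fastforce
  qed
  moreover have "\<exists>x\<in>cycles N i. y - g i x \<in> boundaries K i" if "y \<in> cycles K i" for i y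
    using h(3)[OF that] dg_hom_cycles[OF f(1) assms(4)] by (auto simp: gcomp_def)
  ultimately show ?thesis
    using assms by (auto simp: quasi_iso_iff)
qed

section \<open>Homotopies\<close>

text \<open>Values outside the pieces carry no meaning, so agreement on the pieces is the right
  notion of equality; the homotopy is zero.\<close>

lemma homotopic_refl:
  assumes "dg_module M" "dg_module N" "\<And>i x. x \<in> piece M i \<Longrightarrow> f i x = g i x"
  shows "homotopic M N f g"
  unfolding homotopic_iff[OF assms(1,2)]
  by (rule exI[of _ gzero])
    (simp add: assms(3) gzero_def linear_on_zero[OF dg_moduleD(1)[OF assms(2)]]
      dif_linear(4)[OF assms(2)] Tact_linear(4)[OF assms(2)])

lemma homotopicE:
  assumes "homotopic M N f g" "dg_module M" "dg_module N"
  obtains s where "\<And>i. linear_on (piece M i) (piece N (i + 1)) (s i)"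
    and "\<And>i x. x \<in> piece M i \<Longrightarrow> s i x \<in> piece N (i + 1)"
    and "\<And>i x. x \<in> piece M i \<Longrightarrow> s (i + 1) (Tact M i x) = - Tact N (i + 1) (s i x)"
    and "\<And>i x. x \<in> piece M i \<Longrightarrow> f i x - g i x = dif N (i + 1) (s i x) + s (i - 1) (dif M i x)"
proof -
  obtain s where s: "(\<forall>i. linear_on (piece M i) (piece N (i + 1)) (s i)) \<and>
          (\<forall>i. \<forall>x\<in>piece M i. s (i + 1) (Tact M i x) = - Tact N (i + 1) (s i x)) \<and>
          (\<forall>i. \<forall>x\<in>piece M i. f i x - g i x = dif N (i + 1) (s i x) + s (i - 1) (dif M i x))"
    using assms homotopic_iff[of M N f g] by auto
  show ?thesis
    using s by (intro that[of s]) (auto simp: linear_on_def)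
qed

lemma homotopicI:
  assumes "dg_module M" "dg_module N"
    and "\<And>i. linear_on (piece M i) (piece N (i + 1)) (s i)"
    and "\<And>i x. x \<in> piece M i \<Longrightarrow> s (i + 1) (Tact M i x) = - Tact N (i + 1) (s i x)"
    and "\<And>i x. x \<in> piece M i \<Longrightarrow> f i x - g i x = dif N (i + 1) (s i x) + s (i - 1) (dif M i x)"
  shows "homotopic M N f g"
  unfolding homotopic_iff[OF assms(1,2)] using assms(3-) by (intro exI[of _ s]) auto

lemma homotopic_sym:
  assumes "homotopic M N f g" "dg_module M" "dg_module N"
  shows "homotopic M N g f"
proof -
  obtain s where s: "\<And>i. linear_on (piece M i) (piece N (i + 1)) (s i)"
    "\<And>i x. x \<in> piece M i \<Longrightarrow> s i x \<in> piece N (i + 1)"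
    "\<And>i x. x \<in> piece M i \<Longrightarrow> s (i + 1) (Tact M i x) = - Tact N (i + 1) (s i x)"
    "\<And>i x. x \<in> piece M i \<Longrightarrow> f i x - g i x = dif N (i + 1) (s i x) + s (i - 1) (dif M i x)"
    using assms by (rule homotopicE) blast
  show ?thesis
  proof (rule homotopicI[OF assms(2,3), of "\<lambda>i x. - s i x"])
    fix i x assume x: "x \<in> piece M i"
    show "- s (i + 1) (Tact M i x) = - Tact N (i + 1) (- s i x)"
      using x s(2)[OF x] by (simp add: s(3) Tact_linear(5)[OF assms(3)])
    have "g i x - f i x = - (f i x - g i x)" by simp
    also have "\<dots> = dif N (i + 1) (- s i x) + - s (i - 1) (dif M i x)"
      unfolding s(4)[OF x] using s(2)[OF x] by (simp add: dif_linear(5)[OF assms(3)])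
    finally show "g i x - f i x = dif N (i + 1) (- s i x) + - s (i - 1) (dif M i x)" .
  qed (intro linear_on_neg s dg_moduleD(1)[OF assms(3)])
qed

lemma homotopic_trans:
  assumes "homotopic M N f g" "homotopic M N g h" "dg_module M" "dg_module N"
  shows "homotopic M N f h"
proof -
  obtain s where s: "\<And>i. linear_on (piece M i) (piece N (i + 1)) (s i)"
    "\<And>i x. x \<in> piece M i \<Longrightarrow> s i x \<in> piece N (i + 1)"
    "\<And>i x. x \<in> piece M i \<Longrightarrow> s (i + 1) (Tact M i x) = - Tact N (i + 1) (s i x)"
    "\<And>i x. x \<in> piece M i \<Longrightarrow> f i x - g i x = dif N (i + 1) (s i x) + s (i - 1) (dif M i x)"
    using assms(1,3,4) by (rule homotopicE) blast
  obtain t where t: "\<And>i. linear_on (piece M i) (piece N (i + 1)) (t i)"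
    "\<And>i x. x \<in> piece M i \<Longrightarrow> t i x \<in> piece N (i + 1)"
    "\<And>i x. x \<in> piece M i \<Longrightarrow> t (i + 1) (Tact M i x) = - Tact N (i + 1) (t i x)"
    "\<And>i x. x \<in> piece M i \<Longrightarrow> g i x - h i x = dif N (i + 1) (t i x) + t (i - 1) (dif M i x)"
    using assms(2,3,4) by (rule homotopicE) blast
  show ?thesis
  proof (rule homotopicI[OF assms(3,4), of "\<lambda>i x. s i x + t i x"])
    fix i x assume x: "x \<in> piece M i"
    show "s (i + 1) (Tact M i x) + t (i + 1) (Tact M i x) = - Tact N (i + 1) (s i x + t i x)"
      using x s(2)[OF x] t(2)[OF x] by (simp add: s(3) t(3) Tact_linear(2)[OF assms(4)])
    have "f i x - h i x = (f i x - g i x) + (g i x - h i x)" by simp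
    then show "f i x - h i x = dif N (i + 1) (s i x + t i x) + (s (i - 1) (dif M i x) + t (i - 1) (dif M i x))"
      unfolding s(4)[OF x] t(4)[OF x] using s(2)[OF x] t(2)[OF x]
      by (simp add: dif_linear(2)[OF assms(4)])
  qed (intro linear_on_add s t dg_moduleD(1)[OF assms(4)])
qed

lemma homotopic_gcomp_left:
  assumes "homotopic M N f g" "dg_hom N K h" "dg_hom M N f" "dg_hom M N g"
    "dg_module M" "dg_module N" "dg_module K"
  shows "homotopic M K (gcomp h f) (gcomp h g)"
proof -
  obtain s where s: "\<And>i. linear_on (piece M i) (piece N (i + 1)) (s i)"
    "\<And>i x. x \<in> piece M i \<Longrightarrow> s i x \<in> piece N (i + 1)"
    "\<And>i x. x \<in> piece M i \<Longrightarrow> s (i + 1) (Tact M i x) = - Tact N (i + 1) (s i x)"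
    "\<And>i x. x \<in> piece M i \<Longrightarrow> f i x - g i x = dif N (i + 1) (s i x) + s (i - 1) (dif M i x)"
    using assms(1,5,6) by (rule homotopicE) blast
  note h = dg_homD[OF assms(2,6)]
  show ?thesis
  proof (rule homotopicI[OF assms(5,7), of "\<lambda>i x. h (i + 1) (s i x)"])
    fix i x assume x: "x \<in> piece M i"
    have Ts: "Tact N (i + 1) (s i x) \<in> piece N (i + 1 + 1)"
      by (rule Tact_linear(1)[OF assms(6) s(2)[OF x]])
    show "h (i + 1 + 1) (s (i + 1) (Tact M i x)) = - Tact K (i + 1) (h (i + 1) (s i x))"
      using s(3)[OF x] h(5)[OF Ts] dg_hom_Tact[OF assms(2,6,7) s(2)[OF x]] by simp
    have d: "dif M i x \<in> piece M (i - 1)" by (rule dif_linear(1)[OF assms(5) x])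
    have "h i (f i x) - h i (g i x) = h i (f i x - g i x)"
      using dg_homD(2)[OF assms(3,5) x] dg_homD(2)[OF assms(4,5) x] by (simp add: h(6))
    also have "\<dots> = h i (dif N (i + 1) (s i x)) + h i (s (i - 1) (dif M i x))"
      unfolding s(4)[OF x] using h(3) dif_linear(1)[OF assms(6) s(2)[OF x]] s(2)[OF d] by simp
    also have "h i (dif N (i + 1) (s i x)) = dif K (i + 1) (h (i + 1) (s i x))"
      using h(7)[OF s(2)[OF x]] by simp
    finally show "gcomp h f i x - gcomp h g i x =
        dif K (i + 1) (h (i + 1) (s i x)) + h (i - 1 + 1) (s (i - 1) (dif M i x))"
      unfolding gcomp_def diff_add_cancel .
  qed (intro linear_on_comp[OF s(1) h(1)])
qed

lemma homotopic_gcomp_right: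
  assumes "homotopic M N f g" "dg_hom K M h" "dg_module K" "dg_module M" "dg_module N"
  shows "homotopic K N (gcomp f h) (gcomp g h)"
proof -
  obtain s where s: "\<And>i. linear_on (piece M i) (piece N (i + 1)) (s i)"
    "\<And>i x. x \<in> piece M i \<Longrightarrow> s i x \<in> piece N (i + 1)"
    "\<And>i x. x \<in> piece M i \<Longrightarrow> s (i + 1) (Tact M i x) = - Tact N (i + 1) (s i x)"
    "\<And>i x. x \<in> piece M i \<Longrightarrow> f i x - g i x = dif N (i + 1) (s i x) + s (i - 1) (dif M i x)"
    using assms(1,4,5) by (rule homotopicE) blast
  note h = dg_homD[OF assms(2,3)]
  show ?thesis
  proof (rule homotopicI[OF assms(3,5), of "\<lambda>i x. s i (h i x)"])
    fix i x assume x: "x \<in> piece K i"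
    show "s (i + 1) (h (i + 1) (Tact K i x)) = - Tact N (i + 1) (s i (h i x))"
      using s(3)[OF h(2)[OF x]] dg_hom_Tact[OF assms(2,3,4) x] by simp
    show "gcomp f h i x - gcomp g h i x =
        dif N (i + 1) (s i (h i x)) + s (i - 1) (h (i - 1) (dif K i x))"
      using s(4)[OF h(2)[OF x]] h(7)[OF x] by (simp add: gcomp_def)
  qed (intro linear_on_comp[OF h(1) s(1)])
qed

lemma homotopic_boundaries:
  assumes "homotopic M N f g" "dg_module M" "dg_module N" "x \<in> cycles M i"
  shows "f i x - g i x \<in> boundaries N i"
proof -
  obtain s where s: "\<And>i. linear_on (piece M i) (piece N (i + 1)) (s i)"
    "\<And>i x. x \<in> piece M i \<Longrightarrow> s i x \<in> piece N (i + 1)"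
    "\<And>i x. x \<in> piece M i \<Longrightarrow> f i x - g i x = dif N (i + 1) (s i x) + s (i - 1) (dif M i x)"
    using assms(1-3) by (rule homotopicE) blast
  have x: "x \<in> piece M i" "dif M i x = 0" using assms(4) by (auto simp: cycles_def)
  have "s (i - 1) 0 = 0" by (rule linear_onD(4)[OF s(1) dg_moduleD(1)[OF assms(2)]])
  then show ?thesis using s(3)[OF x(1)] x(2) boundariesI[OF s(2)[OF x(1)]] by simp
qed

lemma quasi_iso_homotopic:
  assumes "homotopic M N f g" "quasi_iso M N f" "dg_hom M N g" "dg_module M" "dg_module N"
  shows "quasi_iso M N g"
proof -
  note f = quasi_isoD[OF assms(2,4,5)] and b = homotopic_boundaries[OF assms(1,4,5)]
  have "x \<in> boundaries M i" if "x \<in> cycles M i" "g i x \<in> boundaries N i" for i x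
    using f(2)[OF that(1)] boundaries_add[OF assms(5) b[OF that(1)] that(2)] by simp
  moreover have "\<exists>x\<in>cycles M i. y - g i x \<in> boundaries N i" if y: "y \<in> cycles N i" for i y
  proof -
    obtain x where x: "x \<in> cycles M i" "y - f i x \<in> boundaries N i" using f(3)[OF y] by blast
    then have "y - g i x \<in> boundaries N i"
      using boundaries_add[OF assms(5) x(2) b[OF x(1)]] by simp
    then show ?thesis using x(1) by blast
  qed
  ultimately show ?thesis using assms by (auto simp: quasi_iso_iff)
qed

text \<open>The degrees of nonzero homology, phrased without quotients. The final argument compares
  objects of \<open>U\<close> with objects of \<open>V\<close> only through these sets.\<close>

definition hsupp :: "('i, 'k::field) dgmod \<Rightarrow> int set" where
  "hsupp M = {i. \<not> cycles M i \<subseteq> boundaries M i}"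

lemma hsupp_quasi_iso:
  assumes "quasi_iso M N f" "dg_module M" "dg_module N"
  shows "hsupp M = hsupp N"
proof -
  note f = quasi_isoD[OF assms]
  have "cycles M i \<subseteq> boundaries M i \<longleftrightarrow> cycles N i \<subseteq> boundaries N i" for i
  proof
    assume L: "cycles M i \<subseteq> boundaries M i"
    show "cycles N i \<subseteq> boundaries N i"
    proof
      fix y assume "y \<in> cycles N i"
      then obtain x where x: "x \<in> cycles M i" "y - f i x \<in> boundaries N i" using f(3) by blast
      then have "f i x \<in> boundaries N i" using L dg_hom_boundaries[OF f(1) assms(2)] by blast
      from boundaries_add[OF assms(3) x(2) this] show "y \<in> boundaries N i" by simp
    qed
  qed (use f(2) dg_hom_cycles[OF f(1) assms(2)] in blast)
  then show ?thesis by (auto simp: hsupp_def)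
qed

lemma quasi_iso_acyclic:
  assumes "hsupp M = {}" "hsupp N = {}" "dg_hom M N f" "dg_module M" "dg_module N"
  shows "quasi_iso M N f"
proof -
  have "\<exists>x\<in>cycles M i. y - f i x \<in> boundaries N i" if "y \<in> cycles N i" for i y
    using that assms(2) fvs.subspace_0[OF subspace_cycles[OF assms(4)], of i] dg_homD(4)[OF assms(3,4)]
    by (intro bexI[of _ 0]) (auto simp: hsupp_def)
  then show ?thesis
    using assms by (auto simp: quasi_iso_iff hsupp_def)
qed

section \<open>Finite dimensionality of homology\<close>

lemma homology_trivial_iff:
  assumes "dg_module M"
  shows "homology M i = {hclass M i 0} \<longleftrightarrow> i \<notin> hsupp M"
proof -
  have "0 \<in> cycles M i" using subspace_cycles[OF assms] by (rule fvs.subspace_0)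
  then have "homology M i = {hclass M i 0} \<longleftrightarrow> (\<forall>x\<in>cycles M i. hclass M i x = hclass M i 0)"
    by (auto simp: homology_def)
  then show ?thesis by (auto simp: hclass_eq_iff[OF assms] hsupp_def)
qed

lemma finite_dim_homology_iff:
  assumes "dg_module M"
  shows "finite_dim_homology M \<longleftrightarrow> finite (hsupp M) \<and>
    (\<forall>i. \<exists>B\<subseteq>cycles M i. finite B \<and> (\<forall>x\<in>cycles M i. \<exists>y\<in>fvs.span B. x - y \<in> boundaries M i))"
proof -
  have "homology M i = hclass M i ` fvs.span B \<longleftrightarrow>
      (\<forall>x\<in>cycles M i. \<exists>y\<in>fvs.span B. x - y \<in> boundaries M i)" if "B \<subseteq> cycles M i" for B i
  proof -
    have "fvs.span B \<subseteq> cycles M i"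
      using that subspace_cycles[OF assms] by (rule fvs.span_minimal)
    then have "homology M i = hclass M i ` fvs.span B \<longleftrightarrow>
        (\<forall>x\<in>cycles M i. \<exists>y\<in>fvs.span B. hclass M i x = hclass M i y)"
      unfolding homology_def
      using image_eq_image_iff[OF image_mono, of "fvs.span B" "cycles M i" "hclass M i"]
      by (metis (no_types))
    then show ?thesis by (simp add: hclass_eq_iff[OF assms])
  qed
  then have "(\<exists>B\<subseteq>cycles M i. finite B \<and> homology M i = hclass M i ` fvs.span B) \<longleftrightarrow>
    (\<exists>B\<subseteq>cycles M i. finite B \<and> (\<forall>x\<in>cycles M i. \<exists>y\<in>fvs.span B. x - y \<in> boundaries M i))" for i
    by (intro ex_cong1 conj_cong refl)
  then show ?thesis
    by (simp add: finite_dim_homology_def homology_trivial_iff[OF assms])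
qed

lemma span_image_linear_on:
  assumes "linear_on S S' f" "fvs.subspace S" "B \<subseteq> S" "x \<in> fvs.span B"
  shows "f x \<in> fvs.span (f ` B)"
proof -
  have sub: "fvs.span B \<subseteq> S" using assms by (intro fvs.span_minimal)
  note f = linear_onD[OF assms(1,2)]
  from assms(4) have "x \<in> fvs.span B \<and> f x \<in> fvs.span (f ` B)"
  proof (induction rule: fvs.span_induct_alt)
    case base
    show ?case unfolding f(4) by (intro conjI fvs.span_zero)
  next
    case (step c x y)
    have x: "x \<in> S" "fscale c x \<in> S" "y \<in> S"
      using step assms(2,3) sub by (auto simp: fvs.subspace_scale)
    then have "f (fscale c x + y) = fscale c (f x) + f y" using f(2,3) by simp
    moreover have "x \<in> fvs.span B" "f x \<in> fvs.span (f ` B)"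
      using step(1) by (simp_all add: fvs.span_base)
    ultimately show ?case
      using step(2) by (intro conjI) (simp_all only: fvs.span_add fvs.span_scale)
  qed
  then show ?thesis ..
qed

text \<open>Generators are pushed forward along \<open>f\<close> in one direction. In the other,
  each generator is lifted up to a boundary by a choice function \<open>g\<close>; \<open>g\<close>
  is not linear, so lifts of linear combinations are built by induction over the span.\<close>

lemma finite_dim_homology_quasi_iso:
  assumes q: "quasi_iso M N f" and M: "dg_module M" and N: "dg_module N"
  shows "finite_dim_homology M \<longleftrightarrow> finite_dim_homology N"
proof -
  note f = quasi_isoD[OF assms] note h = dg_homD[OF f(1) M]
  have "(\<exists>B\<subseteq>cycles M i. finite B \<and> (\<forall>x\<in>cycles M i. \<exists>y\<in>fvs.span B. x - y \<in> boundaries M i)) \<longleftrightarrow>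
      (\<exists>B\<subseteq>cycles N i. finite B \<and> (\<forall>x\<in>cycles N i. \<exists>y\<in>fvs.span B. x - y \<in> boundaries N i))"
    (is "?L \<longleftrightarrow> ?R") for i
  proof
    assume ?L
    then obtain B where B: "B \<subseteq> cycles M i" "finite B"
      "\<And>x. x \<in> cycles M i \<Longrightarrow> \<exists>y\<in>fvs.span B. x - y \<in> boundaries M i" by blast
    have spB: "fvs.span B \<subseteq> cycles M i"
      using B(1) subspace_cycles[OF M] by (rule fvs.span_minimal)
    show ?R
    proof (intro exI[of _ "f i ` B"] conjI ballI)
      fix z assume "z \<in> cycles N i"
      then obtain x where x: "x \<in> cycles M i" "z - f i x \<in> boundaries N i" using f(3) by blast
      obtain y where y: "y \<in> fvs.span B" "x - y \<in> boundaries M i" using B(3)[OF x(1)] by blast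
      have "f i (x - y) = f i x - f i y"
        using x y spB by (intro h(6)) (auto simp: cycles_def)
      then have "z - f i y \<in> boundaries N i"
        using boundaries_add[OF N x(2) dg_hom_boundaries[OF f(1) M y(2)]] by simp
      moreover have "f i y \<in> fvs.span (f i ` B)"
        using B(1) y(1) by (intro span_image_linear_on[OF h(1) dg_moduleD(1)[OF M]]) (auto simp: cycles_def)
      ultimately show "\<exists>y\<in>fvs.span (f i ` B). z - y \<in> boundaries N i" by blast
    qed (use B dg_hom_cycles[OF f(1) M] in auto)
  next
    assume ?R
    then obtain B where B: "B \<subseteq> cycles N i" "finite B"
      "\<And>x. x \<in> cycles N i \<Longrightarrow> \<exists>y\<in>fvs.span B. x - y \<in> boundaries N i" by blast
    have "\<forall>y\<in>B. \<exists>x\<in>cycles M i. y - f i x \<in> boundaries N i" using f(3) B(1) by blast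
    then obtain g where g: "\<And>y. y \<in> B \<Longrightarrow> g y \<in> cycles M i \<and> y - f i (g y) \<in> boundaries N i"
      by metis
    have sp: "fvs.span (g ` B) \<subseteq> cycles M i"
      using g by (intro fvs.span_minimal subspace_cycles[OF M]) auto
    have lift: "\<exists>x\<in>fvs.span (g ` B). y - f i x \<in> boundaries N i" if "y \<in> fvs.span B" for y
      using that
    proof (induction rule: fvs.span_induct_alt)
      case base
      have "0 - f i 0 \<in> boundaries N i" unfolding h(4) using boundaries_0[OF N] by simp
      then show ?case by (rule bexI[OF _ fvs.span_zero])
    next
      case (step c b y)
      then obtain x where x: "x \<in> fvs.span (g ` B)" "y - f i x \<in> boundaries N i" by blast
      have gb: "fscale c (g b) \<in> fvs.span (g ` B)"
        using step(1) by (intro fvs.span_scale fvs.span_base) auto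
      have in_M: "fscale c (g b) \<in> piece M i" "x \<in> piece M i" "g b \<in> piece M i"
        using gb x(1) sp g[OF step(1)] by (auto simp: cycles_def)
      have "f i (fscale c (g b) + x) = fscale c (f i (g b)) + f i x"
        using in_M h(3) linear_onD(3)[OF h(1) dg_moduleD(1)[OF M]] by simp
      then have "fscale c b + y - f i (fscale c (g b) + x) = fscale c (b - f i (g b)) + (y - f i x)"
        by (simp add: fvs.scale_right_diff_distrib)
      moreover have "\<dots> \<in> boundaries N i"
        using g[OF step(1)] by (intro boundaries_add[OF N] fvs.subspace_scale[OF subspace_boundaries[OF N]] x) auto
      ultimately show ?case
        using fvs.span_add[OF gb x(1)] by (metis (no_types, lifting))
    qed
    show ?L
    proof (intro exI[of _ "g ` B"] conjI ballI)
      fix x assume x: "x \<in> cycles M i"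
      obtain y where y: "y \<in> fvs.span B" "f i x - y \<in> boundaries N i"
        using B(3)[OF dg_hom_cycles[OF f(1) M x]] by blast
      obtain w where w: "w \<in> fvs.span (g ` B)" "y - f i w \<in> boundaries N i"
        using lift[OF y(1)] by blast
      have wc: "w \<in> cycles M i" using w sp by blast
      have "f i (x - w) = f i x - f i w"
        using x wc by (intro h(6)) (auto simp: cycles_def)
      then have "f i (x - w) \<in> boundaries N i"
        using boundaries_add[OF N y(2) w(2)] by simp
      then show "\<exists>y\<in>fvs.span (g ` B). x - y \<in> boundaries M i"
        using f(2) cycles_diff[OF M x wc] w(1) by blast
    qed (use B g in auto)
  qed
  then show ?thesis
    using hsupp_quasi_iso[OF assms] by (simp add: finite_dim_homology_iff M N)
qed

lemma Df_quasi_iso: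
  assumes "quasi_iso M N f" "dg_module M" "dg_module N"
  shows "M \<in> Df \<longleftrightarrow> N \<in> Df"
  using finite_dim_homology_quasi_iso[OF assms] assms by (simp add: Df_def)

section \<open>Twisted homotopy pullbacks\<close>

text \<open>Three vectors are packed into one by means of a bijection between \<open>'i + 'i + 'i\<close> and \<open>'i\<close>.\<close>

definition tri :: "'i + 'i + 'i \<Rightarrow> 'i" where
  "tri = (SOME e. bij e)"

text \<open>An infinite cardinal absorbs finite sums; this is applied twice. It is what makes
  \<open>tri\<close> meaningful, and the reason why the index type has to be infinite.\<close>

lemma bij_tri:
  assumes "infinite (UNIV :: 'i set)"
  shows "bij (tri :: 'i + 'i + 'i \<Rightarrow> 'i)"
proof -
  have 2: "(card_of (UNIV :: ('i + 'i) set), card_of (UNIV :: 'i set)) \<in> ordIso"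
    using card_of_Plus_infinite1[OF assms ordLeq_refl[OF card_of_Card_order]] by (simp add: UNIV_Plus_UNIV)
  have "(card_of (UNIV :: ('i + 'i + 'i) set), card_of (UNIV :: 'i set)) \<in> ordIso"
    using card_of_Plus_infinite1[OF assms ordIso_imp_ordLeq[OF 2]] by (simp add: UNIV_Plus_UNIV)
  then have "\<exists>e :: 'i + 'i + 'i \<Rightarrow> 'i. bij e" by (simp add: card_of_ordIso[symmetric])
  then show ?thesis unfolding tri_def by (rule someI_ex)
qed

definition pr1 :: "('i \<Rightarrow> 'k) \<Rightarrow> ('i \<Rightarrow> 'k)" where "pr1 w = (\<lambda>a. w (tri (Inl a)))"
definition pr2 :: "('i \<Rightarrow> 'k) \<Rightarrow> ('i \<Rightarrow> 'k)" where "pr2 w = (\<lambda>a. w (tri (Inr (Inl a))))"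
definition pr3 :: "('i \<Rightarrow> 'k) \<Rightarrow> ('i \<Rightarrow> 'k)" where "pr3 w = (\<lambda>a. w (tri (Inr (Inr a))))"

definition trip :: "('i \<Rightarrow> 'k) \<Rightarrow> ('i \<Rightarrow> 'k) \<Rightarrow> ('i \<Rightarrow> 'k) \<Rightarrow> ('i \<Rightarrow> 'k)" where
  "trip x y z = case_sum x (case_sum y z) \<circ> inv tri"

lemma pr_trip:
  fixes x y z :: "'i \<Rightarrow> 'k"
  assumes "infinite (UNIV :: 'i set)"
  shows "pr1 (trip x y z) = x" "pr2 (trip x y z) = y" "pr3 (trip x y z) = z"
  by (simp_all add: pr1_def pr2_def pr3_def trip_def inv_f_f[OF bij_is_inj[OF bij_tri[OF assms]]])

lemma pr_eqI:
  fixes w w' :: "'i \<Rightarrow> 'k"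
  assumes "infinite (UNIV :: 'i set)" "pr1 w = pr1 w'" "pr2 w = pr2 w'" "pr3 w = pr3 w'"
  shows "w = w'"
proof
  fix j :: 'i
  obtain u where u: "j = tri u" using bij_tri[OF assms(1)] by (metis bij_is_surj surjD)
  show "w j = w' j"
  proof (cases u)
    case (Inl a)
    then show ?thesis using u fun_cong[OF assms(2), of a] by (simp add: pr1_def)
  next
    case (Inr v)
    then show ?thesis
      using u fun_cong[OF assms(3)] fun_cong[OF assms(4)] by (cases v) (simp_all add: pr2_def pr3_def)
  qed
qed

lemma pr_linear:
  "pr1 0 = 0" "pr1 (x + y) = pr1 x + pr1 y" "pr1 (- x) = - pr1 x" "pr1 (fscale c x) = fscale c (pr1 x)"
  "pr2 0 = 0" "pr2 (x + y) = pr2 x + pr2 y" "pr2 (- x) = - pr2 x" "pr2 (fscale c x) = fscale c (pr2 x)"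
  "pr3 0 = 0" "pr3 (x + y) = pr3 x + pr3 y" "pr3 (- x) = - pr3 x" "pr3 (fscale c x) = fscale c (pr3 x)"
  by (auto simp: pr1_def pr2_def pr3_def fscale_def fun_eq_iff)

lemma linear_on_trip:
  fixes f g h :: "('i \<Rightarrow> 'k::field) \<Rightarrow> ('i \<Rightarrow> 'k)"
  assumes inf: "infinite (UNIV :: 'i set)"
    and f: "linear_on S A f" and g: "linear_on S B g" and h: "linear_on S C h"
  shows "linear_on S {w. pr1 w \<in> A \<and> pr2 w \<in> B \<and> pr3 w \<in> C} (\<lambda>x. trip (f x) (g x) (h x))"
  unfolding linear_on_def
proof (intro conjI ballI allI)
  note lin = f[unfolded linear_on_def] g[unfolded linear_on_def] h[unfolded linear_on_def]
  show "trip (f x) (g x) (h x) \<in> {w. pr1 w \<in> A \<and> pr2 w \<in> B \<and> pr3 w \<in> C}" if "x \<in> S" for x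
    using that lin by (simp add: pr_trip[OF inf])
  show "trip (f (x + y)) (g (x + y)) (h (x + y)) = trip (f x) (g x) (h x) + trip (f y) (g y) (h y)"
    if "x \<in> S" "y \<in> S" for x y
    using that lin by - (rule pr_eqI[OF inf], simp_all add: pr_trip[OF inf] pr_linear)
  show "trip (f (fscale c x)) (g (fscale c x)) (h (fscale c x)) = fscale c (trip (f x) (g x) (h x))"
    if "x \<in> S" for c x
    using that lin by - (rule pr_eqI[OF inf], simp_all add: pr_trip[OF inf] pr_linear)
qed

text \<open>
  The homotopy pullback of \<open>s : X \<rightarrow> Y\<close> and \<open>t : Z \<rightarrow> Y\<close> is \<open>X \<oplus> Z \<oplus> \<Sigma>\<^sup>-\<^sup>1Y\<close>. Its \<open>T\<close>-action may in addition be
  twisted by a chain map \<open>\<phi> : X \<rightarrow> Y\<close> of degree 2; such twists produce derived morphisms that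
  vanish on homology.
\<close>

definition pullback ::
    "('i, 'k::field) dgmod \<Rightarrow> ('i, 'k) dgmod \<Rightarrow> ('i, 'k) dgmod \<Rightarrow>
     ('i, 'i, 'k) gmap \<Rightarrow> ('i, 'i, 'k) gmap \<Rightarrow> ('i, 'i, 'k) gmap \<Rightarrow> ('i, 'k) dgmod" where
  "pullback X Z Y s t \<phi> = mk_dg
     (\<lambda>i. {w. pr1 w \<in> piece X i \<and> pr2 w \<in> piece Z i \<and> pr3 w \<in> piece Y (i + 1)})
     (\<lambda>i w. trip (dif X i (pr1 w)) (dif Z i (pr2 w))
        (s i (pr1 w) - t i (pr2 w) - dif Y (i + 1) (pr3 w)))
     (\<lambda>i w. trip (Tact X i (pr1 w)) (Tact Z i (pr2 w)) (\<phi> i (pr1 w) - Tact Y (i + 1) (pr3 w)))"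

lemma diff_diff_eq_0D: "a - b - c = (0 :: 'a::ab_group_add) \<Longrightarrow> b = a - c"
  by auto

text \<open>\<phi> need not commute with \<open>T\<close>. In the third component of the Leibniz
  rule, the terms with \<phi> read \<open>- d \<phi> x = - \<phi> d x\<close>, so the chain map
  condition is exactly what the twisted action requires. The minus signs on \<open>d\<close> and
  \<open>T\<close> there are those of Sigma^-1 Y.\<close>

locale twisted_pullback =
  fixes X Z Y :: "('i, 'k::field) dgmod" and s t \<phi> :: "('i, 'i, 'k) gmap"
  assumes inf: "infinite (UNIV :: 'i set)"
    and X: "dg_module X" and Z: "dg_module Z" and Y: "dg_module Y"
    and s: "dg_hom X Y s" and t: "dg_hom Z Y t"
    and \<phi>_linear: "\<And>i. linear_on (piece X i) (piece Y (i + 2)) (\<phi> i)"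
    and \<phi>_dif: "\<And>i x. x \<in> piece X i \<Longrightarrow> dif Y (i + 2) (\<phi> i x) = \<phi> (i - 1) (dif X i x)"
begin

definition P :: "('i, 'k) dgmod" where "P = pullback X Z Y s t \<phi>"

definition p1 :: "('i, 'i, 'k) gmap" where "p1 = (\<lambda>i. pr1)"
definition p2 :: "('i, 'i, 'k) gmap" where "p2 = (\<lambda>i. pr2)"

lemma piece_P: "w \<in> piece P i \<longleftrightarrow> pr1 w \<in> piece X i \<and> pr2 w \<in> piece Z i \<and> pr3 w \<in> piece Y (i + 1)"
  by (simp add: P_def pullback_def mk_dg_sel)

lemma dif_P: "dif P i w = trip (dif X i (pr1 w)) (dif Z i (pr2 w))
        (s i (pr1 w) - t i (pr2 w) - dif Y (i + 1) (pr3 w))"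
  by (simp add: P_def pullback_def mk_dg_sel)

lemma Tact_P: "Tact P i w = trip (Tact X i (pr1 w)) (Tact Z i (pr2 w)) (\<phi> i (pr1 w) - Tact Y (i + 1) (pr3 w))"
  by (simp add: P_def pullback_def Tact_mk_dg)

lemma linear_on_pr:
  "linear_on {w. pr1 w \<in> A \<and> pr2 w \<in> B \<and> pr3 w \<in> C} A pr1"
  "linear_on {w. pr1 w \<in> A \<and> pr2 w \<in> B \<and> pr3 w \<in> C} B pr2"
  "linear_on {w. pr1 w \<in> A \<and> pr2 w \<in> B \<and> pr3 w \<in> C} C pr3"
  by (simp_all add: linear_on_def pr_linear)

lemmas \<phi>_lin = linear_onD[OF \<phi>_linear dg_moduleD(1)[OF X]]
lemmas sD = dg_homD[OF s X] and tD = dg_homD[OF t Z]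
lemmas sT = dg_hom_Tact[OF s X Y] and tT = dg_hom_Tact[OF t Z Y]

lemma dg_module_P: "dg_module P"
  unfolding P_def pullback_def
proof (rule dg_module_mk_dg)
  fix i
  let ?P = "\<lambda>i. {w. pr1 w \<in> piece X i \<and> pr2 w \<in> piece Z i \<and> pr3 w \<in> piece Y (i + 1)}"
  let ?d = "\<lambda>i w. trip (dif X i (pr1 w)) (dif Z i (pr2 w)) (s i (pr1 w) - t i (pr2 w) - dif Y (i + 1) (pr3 w))"
  let ?t = "\<lambda>i w. trip (Tact X i (pr1 w)) (Tact Z i (pr2 w)) (\<phi> i (pr1 w) - Tact Y (i + 1) (pr3 w))"
  show "fvs.subspace (?P i)"
    by (intro fvs.subspaceI)
      (simp_all add: pr_linear piece_0 piece_add piece_scale X Y Z)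
  have "linear_on (?P i) {w. pr1 w \<in> piece X (i - 1) \<and> pr2 w \<in> piece Z (i - 1) \<and> pr3 w \<in> piece Y i} (?d i)"
    using dg_moduleD(2)[OF Y, of "i + 1"]
    by (intro linear_on_trip[OF inf] linear_on_diff dg_moduleD(1)[OF Y]
        linear_on_comp[OF linear_on_pr(1)] linear_on_comp[OF linear_on_pr(2)] linear_on_comp[OF linear_on_pr(3)]
        dg_moduleD(2) X Z sD(1) tD(1)) auto
  then show "linear_on (?P i) (?P (i - 1)) (?d i)"
    by simp
  show "linear_on (?P i) (?P (i + 1)) (?t i)"
    using \<phi>_linear[of i]
    by (intro linear_on_trip[OF inf] linear_on_diff dg_moduleD(1)[OF Y]
        linear_on_comp[OF linear_on_pr(1)] linear_on_comp[OF linear_on_pr(2)] linear_on_comp[OF linear_on_pr(3)]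
        dg_moduleD(4) X Y Z) (auto simp: add.assoc)
  fix w assume "w \<in> ?P i"
  then have w: "pr1 w \<in> piece X i" "pr2 w \<in> piece Z i" "pr3 w \<in> piece Y (i + 1)" by auto
  note in_Y = sD(2)[OF w(1)] tD(2)[OF w(2)] dif_linear(1)[OF Y w(3)] Tact_linear(1)[OF Y w(3)] \<phi>_lin(1)[OF w(1)]
  \<comment> \<open>Third component of \<open>d d = 0\<close>: the terms from \<open>s\<close> and
    \<open>t\<close> return with opposite sign because both are chain maps.\<close>
  have "dif Y i (s i (pr1 w) - t i (pr2 w) - dif Y (i + 1) (pr3 w)) =
      s (i - 1) (dif X i (pr1 w)) - t (i - 1) (dif Z i (pr2 w))"
    using in_Y dg_moduleD(3)[OF Y w(3)] sD(7)[OF w(1)] tD(7)[OF w(2)]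
    by (simp add: dif_linear(6)[OF Y] piece_diff[OF Y])
  then show "?d (i - 1) (?d i w) = 0"
    using w by - (rule pr_eqI[OF inf], simp_all only: pr_trip[OF inf] pr_linear dg_moduleD(3)[OF X] dg_moduleD(3)[OF Z] diff_add_cancel diff_self)
  have "s (i + 1) (Tact X i (pr1 w)) - t (i + 1) (Tact Z i (pr2 w)) - dif Y (i + 2) (\<phi> i (pr1 w) - Tact Y (i + 1) (pr3 w))
      = - (\<phi> (i - 1) (dif X i (pr1 w)) - Tact Y i (s i (pr1 w) - t i (pr2 w) - dif Y (i + 1) (pr3 w)))"
    using in_Y sT[OF w(1)] tT[OF w(2)] \<phi>_dif[OF w(1)] dg_moduleD(5)[OF Y w(3)]
    by (simp add: dif_linear(6)[OF Y] Tact_linear(6)[OF Y] piece_diff[OF Y] add.commute[of 2 i])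
  then show "?d (i + 1) (?t i w) = - ?t (i - 1) (?d i w)"
    using w by - (rule pr_eqI[OF inf], simp_all add: pr_trip[OF inf] pr_linear dg_moduleD(5)[OF X] dg_moduleD(5)[OF Z] add.commute[of 2 i])
qed

lemma pr_dif_P:
  "pr1 (dif P i w) = dif X i (pr1 w)"
  "pr2 (dif P i w) = dif Z i (pr2 w)"
  "pr3 (dif P i w) = s i (pr1 w) - t i (pr2 w) - dif Y (i + 1) (pr3 w)"
  by (simp_all only: dif_P pr_trip[OF inf])

lemma pr_Tact_P:
  "pr1 (Tact P i w) = Tact X i (pr1 w)"
  "pr2 (Tact P i w) = Tact Z i (pr2 w)"
  "pr3 (Tact P i w) = \<phi> i (pr1 w) - Tact Y (i + 1) (pr3 w)"
  by (simp_all only: Tact_P pr_trip[OF inf])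

lemma dg_hom_p1: "dg_hom P X p1"
  by (simp add: dg_hom_iff[OF dg_module_P X] p1_def pr_dif_P pr_Tact_P)
    (simp add: linear_on_def piece_P pr_linear)

lemma dg_hom_p2: "dg_hom P Z p2"
  by (simp add: dg_hom_iff[OF dg_module_P Z] p2_def pr_dif_P pr_Tact_P)
    (simp add: linear_on_def piece_P pr_linear)

lemma linear_on_pr3: "linear_on (piece P i) (piece Y (i + 1)) pr3"
  by (simp add: linear_on_def piece_P pr_linear)

lemma trip_cycle:
  assumes "x \<in> cycles X i" "z \<in> cycles Z i" "y \<in> piece Y (i + 1)" "s i x - t i z = dif Y (i + 1) y"
  shows "trip x z y \<in> cycles P i"
proof -
  have "dif P i (trip x z y) = 0"
    using assms by - (rule pr_eqI[OF inf], simp_all add: pr_dif_P pr_trip[OF inf] pr_linear cycles_def)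
  then show ?thesis using assms by (simp add: cycles_def piece_P pr_trip[OF inf])
qed

text \<open>Homology sees only the differential, and as a complex \<open>P\<close> is the ordinary
  homotopy pullback: the kernel of \<open>p1\<close> is the cocone of \<open>t\<close>, which is
  acyclic. The proof is the element chase behind this. Injectivity of \<open>t\<close> on homology
  yields a preimage of the second component, surjectivity repairs the third.\<close>

lemma quasi_iso_p1:
  assumes "quasi_iso Z Y t"
  shows "quasi_iso P X p1"
proof -
  note tq = quasi_isoD[OF assms Z Y]
  have "w \<in> boundaries P i" if w: "w \<in> cycles P i" "p1 i w \<in> boundaries X i" for i w
  proof -
    have wp: "pr1 w \<in> piece X i" "pr2 w \<in> piece Z i" "pr3 w \<in> piece Y (i + 1)" and wd: "dif P i w = 0"
      using w(1) by (auto simp: cycles_def piece_P)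
    have eq: "s i (pr1 w) - t i (pr2 w) - dif Y (i + 1) (pr3 w) = 0" and z0: "dif Z i (pr2 w) = 0"
      using pr_dif_P[of i w] wd by (auto simp: pr_linear)
    obtain x where x: "x \<in> piece X (i + 1)" "pr1 w = dif X (i + 1) x"
      using w(2) by (auto simp: p1_def elim: boundariesE)
    have sx: "s (i + 1) x \<in> piece Y (i + 1)" by (rule sD(2)[OF x(1)])
    have sdx: "s i (pr1 w) = dif Y (i + 1) (s (i + 1) x)" using sD(7)[OF x(1)] x(2) by simp
    have "t i (pr2 w) = dif Y (i + 1) (s (i + 1) x - pr3 w)"
      using diff_diff_eq_0D[OF eq] sdx dif_linear(6)[OF Y sx wp(3)] by simp
    then have "t i (pr2 w) \<in> boundaries Y i"
      using boundariesI[OF piece_diff[OF Y sx wp(3)]] by simp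
    moreover have "pr2 w \<in> cycles Z i" using z0 wp by (simp add: cycles_def)
    ultimately have "pr2 w \<in> boundaries Z i" by (rule tq(2)[rotated])
    then obtain z where z: "z \<in> piece Z (i + 1)" "pr2 w = dif Z (i + 1) z" by (rule boundariesE)
    have tz: "t (i + 1) z \<in> piece Y (i + 1)" by (rule tD(2)[OF z(1)])
    have tdz: "t i (pr2 w) = dif Y (i + 1) (t (i + 1) z)" using tD(7)[OF z(1)] z(2) by simp
    \<comment> \<open>\<open>trip x z 0\<close> already bounds \<open>w\<close> in its first two
      components; \<open>?c\<close> is the error in the third. It is a cycle, so up to a boundary it
      is the image of a cycle \<open>z'\<close>, and adding \<open>z'\<close> to \<open>z\<close>
      leaves \<open>d z\<close> unchanged.\<close>
    let ?c = "s (i + 1) x - pr3 w - t (i + 1) z"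
    have "?c \<in> cycles Y (i + 1)"
    proof -
      have "dif Y (i + 1) ?c = dif Y (i + 1) (s (i + 1) x) - dif Y (i + 1) (pr3 w) - dif Y (i + 1) (t (i + 1) z)"
        using sx tz wp by (simp add: dif_linear(6)[OF Y] piece_diff[OF Y])
      then have "dif Y (i + 1) ?c = 0"
        using diff_diff_eq_0D[OF eq] sdx tdz by simp
      then show ?thesis using sx tz wp by (simp add: cycles_def piece_diff[OF Y])
    qed
    then obtain z' where z': "z' \<in> cycles Z (i + 1)" "?c - t (i + 1) z' \<in> boundaries Y (i + 1)"
      using tq(3) by blast
    then obtain y where y: "y \<in> piece Y (i + 2)" "?c - t (i + 1) z' = dif Y (i + 2) y"
      by (auto elim!: boundariesE simp: add.assoc)
    have z'p: "z' \<in> piece Z (i + 1)" "dif Z (i + 1) z' = 0" using z'(1) by (auto simp: cycles_def)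
    have "pr3 w = s (i + 1) x - (t (i + 1) z + t (i + 1) z') - dif Y (i + 2) y"
      using y(2) by (simp add: algebra_simps)
    then have "w = dif P (i + 1) (trip x (z + z') y)"
      using x z z'p
      by - (rule pr_eqI[OF inf], simp_all add: pr_dif_P pr_trip[OF inf] dif_linear(2)[OF Z] tD(3) add.commute[of 2 i])
    moreover have "trip x (z + z') y \<in> piece P (i + 1)"
      using x z z'p y by (simp add: piece_P pr_trip[OF inf] piece_add[OF Z] add.assoc)
    ultimately show ?thesis using boundariesI by metis
  qed
  moreover have "\<exists>w\<in>cycles P i. x - p1 i w \<in> boundaries X i" if x: "x \<in> cycles X i" for i x
  proof -
    obtain z where z: "z \<in> cycles Z i" "s i x - t i z \<in> boundaries Y i"
      using tq(3)[OF dg_hom_cycles[OF s X x]] by blast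
    then obtain y where "y \<in> piece Y (i + 1)" "s i x - t i z = dif Y (i + 1) y"
      by (auto elim: boundariesE)
    from trip_cycle[OF x z(1) this] show ?thesis
      using boundaries_0[OF X, of i] by (intro bexI[of _ "trip x z y"]) (auto simp: p1_def pr_trip[OF inf])
  qed
  ultimately show ?thesis
    using dg_hom_p1 by (auto simp: quasi_iso_iff dg_module_P X)
qed

end

lemma gzero_apply: "gzero i x = 0"
  by (simp add: gzero_def)

text \<open>Without a twist, the third coordinate of \<open>P\<close> is the universal homotopy: a
  map into \<open>P\<close> is a pair of maps together with a homotopy between their images in
  \<open>Y\<close>.\<close>

lemma homotopy_pullback:
  fixes X Z Y :: "('i, 'k::field) dgmod"
  assumes inf: "infinite (UNIV :: 'i set)"
    and X: "dg_module X" and Z: "dg_module Z" and Y: "dg_module Y"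
    and s: "dg_hom X Y s" and t: "dg_hom Z Y t"
  obtains P :: "('i, 'k) dgmod" and p q where "dg_module P" "dg_hom P X p" "dg_hom P Z q"
    "homotopic P Y (gcomp s p) (gcomp t q)"
    "quasi_iso Z Y t \<Longrightarrow> quasi_iso P X p"
    "\<And>(W :: ('i, 'k) dgmod) a b. dg_module W \<Longrightarrow> dg_hom W X a \<Longrightarrow> dg_hom W Z b \<Longrightarrow>
       homotopic W Y (gcomp s a) (gcomp t b) \<Longrightarrow> \<exists>c. dg_hom W P c \<and> gcomp p c = a \<and> gcomp q c = b"
proof -
  interpret twisted_pullback X Z Y s t gzero
    by unfold_locales (use assms in \<open>simp_all add: gzero_def linear_on_zero[OF dg_moduleD(1)] dif_linear(4)\<close>)
  have "homotopic P Y (gcomp s p1) (gcomp t p2)"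
    by (rule homotopicI[OF dg_module_P Y, of "\<lambda>i. pr3"])
      (simp_all add: linear_on_pr3 pr_dif_P pr_Tact_P gcomp_def p1_def p2_def gzero_apply)
  moreover have "\<exists>c. dg_hom W P c \<and> gcomp p1 c = a \<and> gcomp p2 c = b"
    if W: "dg_module W" and a: "dg_hom W X a" and b: "dg_hom W Z b"
      and h: "homotopic W Y (gcomp s a) (gcomp t b)" for W :: "('i, 'k) dgmod" and a b
  proof -
    obtain \<sigma> where \<sigma>: "\<And>i. linear_on (piece W i) (piece Y (i + 1)) (\<sigma> i)"
      "\<And>i x. x \<in> piece W i \<Longrightarrow> \<sigma> (i + 1) (Tact W i x) = - Tact Y (i + 1) (\<sigma> i x)"
      "\<And>i x. x \<in> piece W i \<Longrightarrow> s i (a i x) - t i (b i x) = dif Y (i + 1) (\<sigma> i x) + \<sigma> (i - 1) (dif W i x)"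
      using h W Y unfolding gcomp_def by (rule homotopicE) blast
    \<comment> \<open>The sign of \<sigma> under \<open>T\<close> and the homotopy equation are
      precisely compatibility with \<open>T\<close> and \<open>d\<close> in the third
      coordinate.\<close>
    let ?c = "\<lambda>i x. trip (a i x) (b i x) (\<sigma> i x)"
    have "dg_hom W P ?c"
      unfolding dg_hom_iff[OF W dg_module_P]
    proof (intro conjI allI ballI)
      fix i
      have "piece P i = {w. pr1 w \<in> piece X i \<and> pr2 w \<in> piece Z i \<and> pr3 w \<in> piece Y (i + 1)}"
        by (auto simp: piece_P)
      then show "linear_on (piece W i) (piece P i) (?c i)"
        using linear_on_trip[OF inf dg_homD(1)[OF a W] dg_homD(1)[OF b W] \<sigma>(1)] by simp
      fix x assume x: "x \<in> piece W i"
      show "?c (i - 1) (dif W i x) = dif P i (?c i x)"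
        using dg_homD(7)[OF a W x] dg_homD(7)[OF b W x] \<sigma>(3)[OF x]
        by - (rule pr_eqI[OF inf], simp_all add: pr_dif_P pr_trip[OF inf])
      show "?c (i + 1) (Tact W i x) = Tact P i (?c i x)"
        using dg_hom_Tact[OF a W X x] dg_hom_Tact[OF b W Z x] \<sigma>(2)[OF x]
        by - (rule pr_eqI[OF inf], simp_all add: pr_Tact_P pr_trip[OF inf] gzero_apply)
    qed
    moreover have "gcomp p1 ?c = a" "gcomp p2 ?c = b"
      by (simp_all add: gcomp_def p1_def p2_def pr_trip[OF inf])
    ultimately show ?thesis by blast
  qed
  ultimately show ?thesis
    using that[OF dg_module_P dg_hom_p1 dg_hom_p2] quasi_iso_p1 by blast
qed

text \<open>Right cancellation in the calculus of fractions. Let \<open>F\<close> be the homotopy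
  pullback of \<open>f\<close> with itself. Its diagonal \<delta> is a quasi-isomorphism, being a
  section of the quasi-isomorphism \<open>p\<close>. The homotopy turns the pair \<open>h\<close>,
  \<open>h'\<close> into a map \<open>l\<close> to \<open>F\<close>; over the homotopy pullback
  \<open>R\<close> of \<open>l\<close> and \<delta>, both \<open>h\<close> and \<open>h'\<close>
  become homotopic to the same map \<open>m\<close>.\<close>

lemma homotopic_cancel:
  fixes Q M N :: "('i, 'k::field) dgmod"
  assumes inf: "infinite (UNIV :: 'i set)"
    and Q: "dg_module Q" and M: "dg_module M" and N: "dg_module N"
    and f: "quasi_iso M N f" and h: "dg_hom Q M h" "dg_hom Q M h'"
    and eq: "homotopic Q N (gcomp f h) (gcomp f h')"
  obtains R :: "('i, 'k) dgmod" and r where "dg_module R" "quasi_iso R Q r" "homotopic R M (gcomp h r) (gcomp h' r)"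
proof -
  note fh = quasi_iso_hom[OF f]
  obtain F :: "('i, 'k) dgmod" and p q where F: "dg_module F" "dg_hom F M p" "dg_hom F M q" "quasi_iso F M p"
    and univ: "\<And>(W :: ('i, 'k) dgmod) a b. dg_module W \<Longrightarrow> dg_hom W M a \<Longrightarrow> dg_hom W M b \<Longrightarrow>
       homotopic W N (gcomp f a) (gcomp f b) \<Longrightarrow> \<exists>c. dg_hom W F c \<and> gcomp p c = a \<and> gcomp q c = b"
    using homotopy_pullback[OF inf M M N fh fh] f by metis
  obtain \<delta> where \<delta>: "dg_hom M F \<delta>" "gcomp p \<delta> = gid" "gcomp q \<delta> = gid"
    using univ[OF M dg_hom_gid dg_hom_gid homotopic_refl[OF M N]] by auto
  have \<delta>q: "quasi_iso M F \<delta>"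
    by (rule quasi_iso_cancel_left[OF _ F(4) \<delta>(1) M F(1) M]) (simp add: \<delta> quasi_iso_gid M)
  obtain l where l: "dg_hom Q F l" "gcomp p l = h" "gcomp q l = h'"
    using univ[OF Q h eq] by auto
  obtain R :: "('i, 'k) dgmod" and r m where R: "dg_module R" "dg_hom R Q r" "dg_hom R M m" "quasi_iso R Q r"
    and hm: "homotopic R F (gcomp l r) (gcomp \<delta> m)"
    using homotopy_pullback[OF inf Q M F(1) l(1) \<delta>(1)] \<delta>q by metis
  note lr = dg_hom_gcomp[OF R(2) l(1)] and \<delta>m = dg_hom_gcomp[OF R(3) \<delta>(1)]
  have "homotopic R M (gcomp h r) m"
    using homotopic_gcomp_left[OF hm F(2) lr \<delta>m R(1) F(1) M]
    by (simp add: gcomp_assoc[symmetric] l \<delta> gcomp_gid)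
  moreover have "homotopic R M (gcomp h' r) m"
    using homotopic_gcomp_left[OF hm F(3) lr \<delta>m R(1) F(1) M]
    by (simp add: gcomp_assoc[symmetric] l \<delta> gcomp_gid)
  ultimately have "homotopic R M (gcomp h r) (gcomp h' r)"
    using homotopic_trans homotopic_sym R(1) M by blast
  with R show ?thesis using that by blast
qed

section \<open>Morphisms of the derived category\<close>

lemma ore_square:
  fixes X Z Y :: "('i, 'k::field) dgmod"
  assumes "infinite (UNIV :: 'i set)" "dg_module X" "dg_module Z" "dg_module Y"
    and "dg_hom X Y s" "quasi_iso Z Y t"
  obtains P :: "('i, 'k) dgmod" and p q where "dg_module P" "quasi_iso P X p" "dg_hom P Z q"
    "homotopic P Y (gcomp s p) (gcomp t q)"
  using homotopy_pullback[OF assms(1-5) quasi_iso_hom[OF assms(6)]] assms(6) by metis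

lemma roof_equivI:
  fixes X W :: "('i, 'k::field) dgmod"
  assumes "dg_module W" "dg_hom W Z a" "dg_hom W Z' b" "quasi_iso W X (gcomp s a)"
    "homotopic W X (gcomp s a) (gcomp s' b)" "homotopic W Y (gcomp f a) (gcomp f' b)"
  shows "roof_equiv X Y (Z, s, f) (Z', s', f')"
  unfolding roof_equiv.simps using assms by blast

text \<open>The definition only makes the composite \<open>gcomp s a\<close> a quasi-isomorphism.
  Two out of three gives \<open>a\<close>; homotopy invariance followed by two out of three gives
  \<open>b\<close>. This restores the symmetry of the relation.\<close>

lemma roof_equivE:
  fixes X Y :: "('i, 'k::field) dgmod"
  assumes "roof_equiv X Y (Z, s, f) (Z', s', f')"
    and "is_roof X Y (Z, s, f)" "is_roof X Y (Z', s', f')" "dg_module X"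
  obtains W :: "('i, 'k) dgmod" and a b where "dg_module W" "quasi_iso W Z a" "quasi_iso W Z' b"
    "quasi_iso W X (gcomp s a)" "homotopic W X (gcomp s a) (gcomp s' b)" "homotopic W Y (gcomp f a) (gcomp f' b)"
proof -
  have Z: "dg_module Z" "quasi_iso Z X s" "dg_module Z'" "quasi_iso Z' X s'" using assms by auto
  obtain W :: "('i, 'k) dgmod" and a b where W: "dg_module W" "dg_hom W Z a" "dg_hom W Z' b"
    "quasi_iso W X (gcomp s a)"
    "homotopic W X (gcomp s a) (gcomp s' b)" "homotopic W Y (gcomp f a) (gcomp f' b)"
    using assms(1) by auto
  have "quasi_iso W Z a"
    using quasi_iso_cancel_left[OF W(4) Z(2) W(2,1) Z(1) assms(4)] .
  moreover have "quasi_iso W X (gcomp s' b)"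
    using quasi_iso_homotopic[OF W(5,4)] dg_hom_gcomp[OF W(3) quasi_iso_hom[OF Z(4)]] W(1) assms(4) by blast
  then have "quasi_iso W Z' b"
    using quasi_iso_cancel_left[OF _ Z(4) W(3,1) Z(3) assms(4)] by blast
  ultimately show ?thesis using that W by blast
qed

lemma roof_equiv_refl:
  assumes "is_roof X Y r" "dg_module X" "dg_module Y"
  shows "roof_equiv X Y r r"
proof (cases r)
  case (fields Z s f)
  then show ?thesis
    using assms by (auto intro!: exI[of _ Z] exI[of _ gid] homotopic_refl simp: dg_hom_gid gcomp_gid)
qed

lemma roof_equiv_sym:
  fixes X Y :: "('i, 'k::field) dgmod"
  assumes "roof_equiv X Y r r'" "is_roof X Y r" "is_roof X Y r'" "dg_module X" "dg_module Y"
  shows "roof_equiv X Y r' r"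
proof (cases r, cases r')
  fix Z s f Z' s' f' assume r: "r = (Z, s, f)" "r' = (Z', s', f')"
  obtain W :: "('i, 'k) dgmod" and a b where W: "dg_module W" "quasi_iso W Z a" "quasi_iso W Z' b"
    "quasi_iso W X (gcomp s a)" "homotopic W X (gcomp s a) (gcomp s' b)" "homotopic W Y (gcomp f a) (gcomp f' b)"
    using assms(1-4) unfolding r by (rule roof_equivE)
  have "quasi_iso Z' X s'" using assms r by auto
  then have "quasi_iso W X (gcomp s' b)"
    using quasi_iso_homotopic[OF W(5,4)] dg_hom_gcomp[OF quasi_iso_hom[OF W(3)] quasi_iso_hom] W(1) assms(4) by blast
  then show ?thesis
    unfolding r using W assms(4,5)
    by (intro roof_equivI[of W]) (auto intro: quasi_iso_hom homotopic_sym)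
qed

text \<open>The refinements \<open>W\<close> and \<open>W'\<close> both map to the middle apex
  \<open>Z'\<close>, and an Ore square over \<open>Z'\<close> refines them both.\<close>

lemma roof_equiv_trans:
  fixes X Y :: "('i, 'k::field) dgmod"
  assumes inf: "infinite (UNIV :: 'i set)" and X: "dg_module X" and Y: "dg_module Y"
    and e: "roof_equiv X Y r r'" "roof_equiv X Y r' r''"
    and roofs: "is_roof X Y r" "is_roof X Y r'" "is_roof X Y r''"
  shows "roof_equiv X Y r r''"
proof (cases r, cases r', cases r'')
  fix Z s f Z' s' f' Z'' s'' f''
  assume r: "r = (Z, s, f)" "r' = (Z', s', f')" "r'' = (Z'', s'', f'')"
  have Z: "dg_module Z" "dg_hom Z X s" "dg_hom Z Y f" "dg_module Z'" "dg_hom Z' X s'" "dg_hom Z' Y f'"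
    "dg_module Z''" "dg_hom Z'' X s''" "dg_hom Z'' Y f''"
    using roofs unfolding r by (auto intro: quasi_iso_hom)
  obtain W :: "('i, 'k) dgmod" and a b where W: "dg_module W" "quasi_iso W Z a" "quasi_iso W Z' b"
    "quasi_iso W X (gcomp s a)" "homotopic W X (gcomp s a) (gcomp s' b)" "homotopic W Y (gcomp f a) (gcomp f' b)"
    using e(1) roofs(1,2) X unfolding r by (rule roof_equivE)
  obtain W' :: "('i, 'k) dgmod" and a' b' where W': "dg_module W'" "quasi_iso W' Z' a'" "quasi_iso W' Z'' b'"
    "quasi_iso W' X (gcomp s' a')" "homotopic W' X (gcomp s' a') (gcomp s'' b')"
    "homotopic W' Y (gcomp f' a') (gcomp f'' b')"
    using e(2) roofs(2,3) X unfolding r by (rule roof_equivE)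
  note ah = quasi_iso_hom[OF W(2)] quasi_iso_hom[OF W(3)] quasi_iso_hom[OF W'(2)] quasi_iso_hom[OF W'(3)]
  obtain P :: "('i, 'k) dgmod" and p q where P: "dg_module P" "quasi_iso P W p" "dg_hom P W' q"
    "homotopic P Z' (gcomp b p) (gcomp a' q)"
    using ore_square[OF inf W(1) W'(1) Z(4) ah(2) W'(2)] .
  note ph = quasi_iso_hom[OF P(2)]
  \<comment> \<open>Stated for a general leg \<open>h\<close>, so that it covers the legs to
    \<open>X\<close> and the legs to \<open>Y\<close>.\<close>
  have chain: "homotopic P V (gcomp h (gcomp a p)) (gcomp h'' (gcomp b' q))"
    if "homotopic W V (gcomp h a) (gcomp h' b)" "homotopic W' V (gcomp h' a') (gcomp h'' b')"
      and h: "dg_hom Z' V h'" and V: "dg_module V" for V :: "('i, 'k) dgmod" and h h' h''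
  proof -
    have "homotopic P V (gcomp h (gcomp a p)) (gcomp h' (gcomp b p))"
      using homotopic_gcomp_right[OF that(1) ph P(1) W(1) V] by (simp add: gcomp_assoc)
    moreover have "homotopic P V (gcomp h' (gcomp b p)) (gcomp h' (gcomp a' q))"
      by (rule homotopic_gcomp_left[OF P(4) h dg_hom_gcomp[OF ph ah(2)] dg_hom_gcomp[OF P(3) ah(3)] P(1) Z(4) V])
    moreover have "homotopic P V (gcomp h' (gcomp a' q)) (gcomp h'' (gcomp b' q))"
      using homotopic_gcomp_right[OF that(2) P(3,1) W'(1) V] by (simp add: gcomp_assoc)
    ultimately show ?thesis using homotopic_trans P(1) V by blast
  qed
  show ?thesis
    unfolding r
  proof (rule roof_equivI[OF P(1) dg_hom_gcomp[OF ph ah(1)] dg_hom_gcomp[OF P(3) ah(4)]])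
    show "quasi_iso P X (gcomp s (gcomp a p))"
      using quasi_iso_gcomp[OF P(2) W(4) P(1) W(1) X] by (simp add: gcomp_assoc)
  qed (intro chain[OF W(5) W'(5) Z(5) X] chain[OF W(6) W'(6) Z(6) Y])+
qed

lemma Hom_memD:
  fixes X Y :: "('i, 'k::field) dgmod"
  assumes inf: "infinite (UNIV :: 'i set)" and X: "dg_module X" and Y: "dg_module Y"
    and F: "F \<in> Hom X Y" "r \<in> F" "r' \<in> F"
  shows "is_roof X Y r" "roof_equiv X Y r r'"
proof -
  obtain r0 where r0: "is_roof X Y r0" "F = roof_class X Y r0" using F(1) by (auto simp: Hom_def)
  then have r: "is_roof X Y r" "roof_equiv X Y r0 r" "is_roof X Y r'" "roof_equiv X Y r0 r'"
    using F by (auto simp: roof_class_def)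
  then show "is_roof X Y r" by blast
  show "roof_equiv X Y r r'"
    using roof_equiv_trans[OF inf X Y roof_equiv_sym[OF r(2) r0(1) r(1) X Y] r(4)] r r0 by blast
qed

lemma is_roof_gid: "dg_module X \<Longrightarrow> dg_hom X Y f \<Longrightarrow> is_roof X Y (X, gid, f)"
  by (simp add: quasi_iso_gid)

lemma roof_class_mem: "is_roof X Y r \<Longrightarrow> dg_module X \<Longrightarrow> dg_module Y \<Longrightarrow> r \<in> roof_class X Y r"
  by (simp add: roof_class_def roof_equiv_refl)


subsection \<open>Isomorphisms\<close>

text \<open>The two halves of being a quasi-isomorphism are separated because a one-sided inverse in
  the derived category yields only one of them.\<close>

definition hinj :: "('i, 'k::field) dgmod \<Rightarrow> ('j, 'k) dgmod \<Rightarrow> ('i, 'j, 'k) gmap \<Rightarrow> bool" where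
  "hinj M N f \<longleftrightarrow> (\<forall>i. \<forall>x\<in>cycles M i. f i x \<in> boundaries N i \<longrightarrow> x \<in> boundaries M i)"

definition hsurj :: "('i, 'k::field) dgmod \<Rightarrow> ('j, 'k) dgmod \<Rightarrow> ('i, 'j, 'k) gmap \<Rightarrow> bool" where
  "hsurj M N f \<longleftrightarrow> (\<forall>i. \<forall>y\<in>cycles N i. \<exists>x\<in>cycles M i. y - f i x \<in> boundaries N i)"

lemma quasi_iso_iff_hinj_hsurj:
  "dg_module M \<Longrightarrow> dg_module N \<Longrightarrow> quasi_iso M N f \<longleftrightarrow> dg_hom M N f \<and> hinj M N f \<and> hsurj M N f"
  by (simp add: quasi_iso_iff hinj_def hsurj_def)

lemma hinj_homotopic:
  assumes "homotopic M N f g" "hinj M N f" "dg_module M" "dg_module N"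
  shows "hinj M N g"
  unfolding hinj_def
proof (intro allI ballI impI)
  fix i x assume x: "x \<in> cycles M i" "g i x \<in> boundaries N i"
  from boundaries_add[OF assms(4) homotopic_boundaries[OF assms(1,3,4) x(1)] x(2)]
  show "x \<in> boundaries M i" using assms(2) x(1) by (simp add: hinj_def)
qed

lemma hsurj_homotopic:
  assumes "homotopic M N f g" "hsurj M N f" "dg_module M" "dg_module N"
  shows "hsurj M N g"
  unfolding hsurj_def
proof (intro allI ballI)
  fix i y assume "y \<in> cycles N i"
  then obtain x where x: "x \<in> cycles M i" "y - f i x \<in> boundaries N i"
    using assms(2) by (auto simp: hsurj_def)
  from boundaries_add[OF assms(4) x(2) homotopic_boundaries[OF assms(1,3,4) x(1)]]
  show "\<exists>x\<in>cycles M i. y - g i x \<in> boundaries N i" using x(1) by (intro bexI[of _ x]) simp_all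
qed

lemma hinj_gcomp:
  "hinj N K g \<Longrightarrow> hinj M N f \<Longrightarrow> dg_hom M N f \<Longrightarrow> dg_module M \<Longrightarrow> hinj M K (gcomp g f)"
  by (auto simp: hinj_def gcomp_def dg_hom_cycles)

lemma hinj_gcompD:
  "hinj M K (gcomp g f) \<Longrightarrow> dg_hom N K g \<Longrightarrow> dg_module N \<Longrightarrow> hinj M N f"
  by (auto simp: hinj_def gcomp_def dg_hom_boundaries)

lemma hsurj_gcompD:
  "hsurj M K (gcomp g f) \<Longrightarrow> dg_hom M N f \<Longrightarrow> dg_module M \<Longrightarrow> hsurj N K g"
  unfolding hsurj_def gcomp_def by (meson dg_hom_cycles)

lemma hinj_gcomp_cancel:
  assumes "hinj M K (gcomp g f)" "quasi_iso M N f" "dg_hom N K g" "dg_module M" "dg_module N" "dg_module K"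
  shows "hinj N K g"
  unfolding hinj_def
proof (intro allI ballI impI)
  note f = quasi_isoD[OF assms(2,4,5)]
  fix i y assume y: "y \<in> cycles N i" "g i y \<in> boundaries K i"
  obtain x where x: "x \<in> cycles M i" "y - f i x \<in> boundaries N i"
    using f(3)[OF y(1)] by blast
  have fx: "f i x \<in> cycles N i" by (rule dg_hom_cycles[OF f(1) assms(4) x(1)])
  have "g i (y - f i x) = g i y - g i (f i x)"
    using y fx by (intro dg_homD(6)[OF assms(3,5)]) (auto simp: cycles_def)
  then have "g i (f i x) = g i y - g i (y - f i x)" by simp
  then have "g i (f i x) \<in> boundaries K i"
    using boundaries_diff[OF assms(6) y(2) dg_hom_boundaries[OF assms(3,5) x(2)]] by simp
  then have "x \<in> boundaries M i" using assms(1) x(1) by (simp add: hinj_def gcomp_def)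
  from boundaries_add[OF assms(5) x(2) dg_hom_boundaries[OF f(1) assms(4) this]]
  show "y \<in> boundaries N i" by simp
qed

lemma hsurj_gcomp_quasi_iso:
  assumes "hsurj N K g" "quasi_iso M N f" "dg_hom N K g" "dg_module M" "dg_module N" "dg_module K"
  shows "hsurj M K (gcomp g f)"
  unfolding hsurj_def
proof (intro allI ballI)
  note f = quasi_isoD[OF assms(2,4,5)]
  fix i z assume "z \<in> cycles K i"
  then obtain y where y: "y \<in> cycles N i" "z - g i y \<in> boundaries K i"
    using assms(1) by (auto simp: hsurj_def)
  obtain x where x: "x \<in> cycles M i" "y - f i x \<in> boundaries N i"
    using f(3)[OF y(1)] by blast
  have fx: "f i x \<in> cycles N i" by (rule dg_hom_cycles[OF f(1) assms(4) x(1)])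
  have "g i (y - f i x) = g i y - g i (f i x)"
    using y fx by (intro dg_homD(6)[OF assms(3,5)]) (auto simp: cycles_def)
  with boundaries_add[OF assms(6) y(2) dg_hom_boundaries[OF assms(3,5) x(2)]]
  have "z - gcomp g f i x \<in> boundaries K i" by (simp add: gcomp_def)
  then show "\<exists>x\<in>cycles M i. z - gcomp g f i x \<in> boundaries K i" using x(1) by blast
qed

text \<open>The identity roof lies in the composite, so for suitable representatives the composite
  roof is equivalent to it and \<open>gcomp g b\<close> is a quasi-isomorphism. Hence
  \<open>g\<close> is surjective and \<open>b\<close> injective on homology. Injectivity passes to
  \<open>gcomp t b\<close>, then to the homotopic map \<open>gcomp f a\<close>, and to
  \<open>f\<close> because \<open>a\<close> is a quasi-isomorphism.\<close>

lemma D_comp_eq_id: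
  fixes X Y :: "('i, 'k::field) dgmod"
  assumes inf: "infinite (UNIV :: 'i set)" and X: "dg_module X" and Y: "dg_module Y"
    and F: "F \<in> Hom X Y" and G: "G \<in> Hom Y X" and id: "D_comp X Y X G F = D_id X"
  shows "(\<exists>W s f. (W, s, f) \<in> F \<and> hinj W Y f) \<and> (\<exists>W t g. (W, t, g) \<in> G \<and> hsurj W X g)"
proof -
  note rX = is_roof_gid[OF X dg_hom_gid]
  have "(X, gid, gid) \<in> D_comp X Y X G F"
    unfolding id D_id_def hom_class_def by (rule roof_class_mem[OF rX X X])
  then obtain W s f W' t g P a b where
    m: "(W, s, f) \<in> F" "(W', t, g) \<in> G" and P: "dg_module P" "quasi_iso P W a" "dg_hom P W' b"
      "homotopic P Y (gcomp f a) (gcomp t b)"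
    and e: "roof_equiv X X (P, gcomp s a, gcomp g b) (X, gid, gid)"
    unfolding D_comp_def by blast
  have W: "dg_module W" "quasi_iso W X s" "dg_hom W Y f"
    using Hom_memD(1)[OF inf X Y F m(1) m(1)] by auto
  have W': "dg_module W'" "quasi_iso W' Y t" "dg_hom W' X g"
    using Hom_memD(1)[OF inf Y X G m(2) m(2)] by auto
  note gb = dg_hom_gcomp[OF P(3) W'(3)] and sa = quasi_iso_gcomp[OF P(2) W(2) P(1) W(1) X]
  have "is_roof X X (P, gcomp s a, gcomp g b)" using P(1) sa gb by simp
  then obtain V :: "('i, 'k) dgmod" and c d where V: "dg_module V" "quasi_iso V P c" "quasi_iso V X d"
    "homotopic V X (gcomp (gcomp g b) c) d"
    using roof_equivE[OF e _ rX X] by (metis gcomp_gid(2))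
  have "quasi_iso V X (gcomp (gcomp g b) c)"
    using quasi_iso_homotopic[OF homotopic_sym[OF V(4,1) X] V(3)]
      dg_hom_gcomp[OF quasi_iso_hom[OF V(2)] gb] V(1) X by blast
  then have "quasi_iso P X (gcomp g b)"
    by (rule quasi_iso_cancel_right[OF _ V(2) gb V(1) P(1) X])
  then have h: "hinj P X (gcomp g b)" "hsurj P X (gcomp g b)"
    by (simp_all add: quasi_iso_iff_hinj_hsurj P(1) X)
  have "hinj W' Y t" using W' Y by (simp add: quasi_iso_iff_hinj_hsurj)
  then have "hinj P Y (gcomp t b)"
    by (rule hinj_gcomp[OF _ hinj_gcompD[OF h(1) W'(3,1)] P(3,1)])
  then have "hinj P Y (gcomp f a)"
    by (rule hinj_homotopic[OF homotopic_sym[OF P(4,1) Y] _ P(1) Y])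
  then have "hinj W Y f" by (rule hinj_gcomp_cancel[OF _ P(2) W(3) P(1) W(1) Y])
  then show ?thesis using m hsurj_gcompD[OF h(2) P(3,1)] by blast
qed

text \<open>One inverse law makes the numerator of some representative of \<open>F\<close> injective
  on homology, the other makes the numerator of a possibly different representative surjective. A
  common refinement \<open>V\<close> transfers surjectivity to the first.\<close>

lemma D_iso_quasi_isos:
  fixes X Y :: "('i, 'k::field) dgmod"
  assumes inf: "infinite (UNIV :: 'i set)" and X: "dg_module X" and Y: "dg_module Y" and "D_iso X Y F"
  obtains Z :: "('i, 'k) dgmod" and s f where "dg_module Z" "quasi_iso Z X s" "quasi_iso Z Y f"
proof -
  obtain G where F: "F \<in> Hom X Y" and G: "G \<in> Hom Y X"
    and id: "D_comp X Y X G F = D_id X" "D_comp Y X Y F G = D_id Y"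
    using assms(4) by (auto simp: D_iso_def)
  obtain W s f where W: "(W, s, f) \<in> F" "hinj W Y f"
    using D_comp_eq_id[OF inf X Y F G id(1)] by blast
  obtain W' s' f' where W': "(W', s', f') \<in> F" "hsurj W' Y f'"
    using D_comp_eq_id[OF inf Y X G F id(2)] by blast
  have r: "is_roof X Y (W, s, f)" "is_roof X Y (W', s', f')"
    using Hom_memD(1)[OF inf X Y F] W(1) W'(1) by blast+
  then have m: "dg_module W" "quasi_iso W X s" "dg_hom W Y f" "dg_module W'" "dg_hom W' Y f'" by auto
  obtain V :: "('i, 'k) dgmod" and a b where V: "dg_module V" "quasi_iso V W a" "quasi_iso V W' b"
    "homotopic V Y (gcomp f a) (gcomp f' b)"
    using roof_equivE[OF Hom_memD(2)[OF inf X Y F W(1) W'(1)] r X] by metis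
  have "hsurj V Y (gcomp f' b)" by (rule hsurj_gcomp_quasi_iso[OF W'(2) V(3) m(5) V(1) m(4) Y])
  then have "hsurj V Y (gcomp f a)" by (rule hsurj_homotopic[OF homotopic_sym[OF V(4,1) Y] _ V(1) Y])
  then have "hsurj W Y f" by (rule hsurj_gcompD[OF _ quasi_iso_hom[OF V(2)] V(1)])
  then have "quasi_iso W Y f" using W(2) m Y by (simp add: quasi_iso_iff_hinj_hsurj)
  then show ?thesis using that m by blast
qed

lemma D_iso_sym: "D_iso X Y F \<Longrightarrow> \<exists>G. D_iso Y X G"
  by (auto simp: D_iso_def)

text \<open>\<open>D_comp\<close> collects the results of all representatives and all completing
  squares, so two things are needed: every choice gives a roof equivalent to the identity, and at
  least one choice exists. A composite roof is equivalent to the identity once its two legs become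
  homotopic after a quasi-isomorphism \<open>q\<close>.\<close>

lemma D_comp_eq_idI:
  fixes X Y P0 :: "('i, 'k::field) dgmod"
  assumes inf: "infinite (UNIV :: 'i set)" and X: "dg_module X" and Y: "dg_module Y"
    and F: "F \<in> Hom X Y" and G: "G \<in> Hom Y X"
    and ex: "(W0, s0, f0) \<in> F" "(W0', t0, g0) \<in> G" "dg_module P0" "quasi_iso P0 W0 a0" "dg_hom P0 W0' b0"
      "homotopic P0 Y (gcomp f0 a0) (gcomp t0 b0)"
    and all: "\<And>W s f W' t g (P :: ('i, 'k) dgmod) a b. (W, s, f) \<in> F \<Longrightarrow> (W', t, g) \<in> G \<Longrightarrow> dg_module P \<Longrightarrow>
      quasi_iso P W a \<Longrightarrow> dg_hom P W' b \<Longrightarrow> homotopic P Y (gcomp f a) (gcomp t b) \<Longrightarrow>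
      \<exists>(Q :: ('i, 'k) dgmod) q. dg_module Q \<and> quasi_iso Q P q \<and>
        homotopic Q X (gcomp s (gcomp a q)) (gcomp g (gcomp b q))"
  shows "D_comp X Y X G F = D_id X"
proof -
  note rX = is_roof_gid[OF X dg_hom_gid]
  have roof: "is_roof X X (P, gcomp s a, gcomp g b)"
    and equiv: "roof_equiv X X (P, gcomp s a, gcomp g b) (X, gid, gid)"
    if m: "(W, s, f) \<in> F" "(W', t, g) \<in> G" "dg_module P" "quasi_iso P W a" "dg_hom P W' b"
      "homotopic P Y (gcomp f a) (gcomp t b)" for W s f W' t g and P :: "('i, 'k) dgmod" and a b
  proof -
    have W: "dg_module W" "quasi_iso W X s" using Hom_memD(1)[OF inf X Y F m(1) m(1)] by auto
    have W': "dg_hom W' X g" using Hom_memD(1)[OF inf Y X G m(2) m(2)] by auto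
    note sa = quasi_iso_gcomp[OF m(4) W(2) m(3) W(1) X] and gb = dg_hom_gcomp[OF m(5) W']
    show "is_roof X X (P, gcomp s a, gcomp g b)" using m(3) sa gb by simp
    obtain Q :: "('i, 'k) dgmod" and q where Q: "dg_module Q" "quasi_iso Q P q"
        "homotopic Q X (gcomp s (gcomp a q)) (gcomp g (gcomp b q))"
      using all[OF m] by blast
    have saq: "quasi_iso Q X (gcomp (gcomp s a) q)" by (rule quasi_iso_gcomp[OF Q(2) sa Q(1) m(3) X])
    show "roof_equiv X X (P, gcomp s a, gcomp g b) (X, gid, gid)"
    proof (rule roof_equivI[OF Q(1) quasi_iso_hom[OF Q(2)] quasi_iso_hom[OF saq] saq])
      show "homotopic Q X (gcomp (gcomp s a) q) (gcomp gid (gcomp (gcomp s a) q))"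
        unfolding gcomp_gid by (rule homotopic_refl[OF Q(1) X refl])
      show "homotopic Q X (gcomp (gcomp g b) q) (gcomp gid (gcomp (gcomp s a) q))"
        unfolding gcomp_gid using homotopic_sym[OF Q(3,1) X] by (simp add: gcomp_assoc)
    qed
  qed
  note tr = roof_equiv_trans[OF inf X X] and sy = roof_equiv_sym[OF _ _ _ X X]
  show ?thesis
  proof (intro set_eqI iffI)
    fix r assume "r \<in> D_comp X Y X G F"
    then obtain W s f W' t g and P :: "('i, 'k) dgmod" and a b where r: "is_roof X X r" and m: "(W, s, f) \<in> F" "(W', t, g) \<in> G"
      "dg_module P" "quasi_iso P W a" "dg_hom P W' b" "homotopic P Y (gcomp f a) (gcomp t b)"
      and e: "roof_equiv X X (P, gcomp s a, gcomp g b) r"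
      unfolding D_comp_def by blast
    have "roof_equiv X X (X, gid, gid) r"
      using tr[OF sy[OF equiv[OF m] roof[OF m] rX] e rX roof[OF m] r] .
    then show "r \<in> D_id X" using r by (simp add: D_id_def hom_class_def roof_class_def del: is_roof.simps roof_equiv.simps)
  next
    fix r assume "r \<in> D_id X"
    then have r: "is_roof X X r" "roof_equiv X X (X, gid, gid) r"
      by (auto simp: D_id_def hom_class_def roof_class_def simp del: is_roof.simps roof_equiv.simps)
    have "roof_equiv X X (P0, gcomp s0 a0, gcomp g0 b0) r"
      using tr[OF equiv[OF ex] r(2) roof[OF ex] rX r(1)] .
    then show "r \<in> D_comp X Y X G F"
      unfolding D_comp_def using r(1) ex by blast
  qed
qed

text \<open>Used to trade an arbitrary representative for a standard one: up to refining
  \<open>P\<close>, a map to one apex can be replaced by a map to the other with the same two legs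
  up to homotopy. The refinement is the Ore square of \<open>a\<close> with the common refinement of
  the two roofs.\<close>

lemma roof_equiv_lift:
  fixes X Y P :: "('i, 'k::field) dgmod"
  assumes inf: "infinite (UNIV :: 'i set)" and X: "dg_module X" and Y: "dg_module Y"
    and e: "roof_equiv X Y (Z, s, f) (Z', s', f')" "is_roof X Y (Z, s, f)" "is_roof X Y (Z', s', f')"
    and P: "dg_module P" and a: "dg_hom P Z a"
  obtains Q :: "('i, 'k) dgmod" and u w where "dg_module Q" "quasi_iso Q P u" "dg_hom Q Z' w"
    "homotopic Q X (gcomp s (gcomp a u)) (gcomp s' w)" "homotopic Q Y (gcomp f (gcomp a u)) (gcomp f' w)"
proof -
  have Z: "dg_module Z" "dg_hom Z X s" "dg_hom Z Y f" using e(2) by (auto intro: quasi_iso_hom)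
  obtain W :: "('i, 'k) dgmod" and c d where W: "dg_module W" "quasi_iso W Z c" "quasi_iso W Z' d"
    "homotopic W X (gcomp s c) (gcomp s' d)" "homotopic W Y (gcomp f c) (gcomp f' d)"
    using e X by (rule roof_equivE)
  note ch = quasi_iso_hom[OF W(2)] and dh = quasi_iso_hom[OF W(3)]
  obtain Q :: "('i, 'k) dgmod" and u v where Q: "dg_module Q" "quasi_iso Q P u" "dg_hom Q W v"
    "homotopic Q Z (gcomp a u) (gcomp c v)"
    using ore_square[OF inf P W(1) Z(1) a W(2)] .
  note au = dg_hom_gcomp[OF quasi_iso_hom[OF Q(2)] a] and cv = dg_hom_gcomp[OF Q(3) ch]
  have "homotopic Q V (gcomp h (gcomp a u)) (gcomp h' (gcomp d v))"
    if "homotopic W V (gcomp h c) (gcomp h' d)" "dg_hom Z V h" "dg_module V"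
    for V :: "('i, 'k) dgmod" and h h'
  proof -
    have "homotopic Q V (gcomp h (gcomp a u)) (gcomp h (gcomp c v))"
      by (rule homotopic_gcomp_left[OF Q(4) that(2) au cv Q(1) Z(1) that(3)])
    moreover have "homotopic Q V (gcomp h (gcomp c v)) (gcomp h' (gcomp d v))"
      using homotopic_gcomp_right[OF that(1) Q(3,1) W(1) that(3)] by (simp add: gcomp_assoc)
    ultimately show ?thesis using homotopic_trans Q(1) that(3) by blast
  qed
  from this[OF W(4) Z(2) X] this[OF W(5) Z(3) Y] show ?thesis
    using that[OF Q(1,2) dg_hom_gcomp[OF Q(3) dh]] by blast
qed

text \<open>The inverse is the roof with denominator \<open>f\<close> and numerator the identity. In
  both composites, arbitrary representatives are first traded for these two roofs, giving maps
  \<open>w\<close> and \<open>w'\<close> to \<open>M\<close> that have to be compared.\<close>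

lemma quasi_iso_D_iso:
  fixes M N :: "('i, 'k::field) dgmod"
  assumes inf: "infinite (UNIV :: 'i set)" and M: "dg_module M" and N: "dg_module N"
    and f: "quasi_iso M N f"
  shows "\<exists>F. D_iso M N F"
proof -
  let ?r = "(M, gid, f)" and ?r' = "(M, f, gid)"
  let ?F = "roof_class M N ?r" and ?G = "roof_class N M ?r'"
  note fh = quasi_iso_hom[OF f]
  have r: "is_roof M N ?r" "is_roof N M ?r'"
    using M f fh by (auto simp: quasi_iso_gid dg_hom_gid)
  have F: "?F \<in> Hom M N" "?r \<in> ?F" and G: "?G \<in> Hom N M" "?r' \<in> ?G"
    using r roof_class_mem[OF r(1) M N] roof_class_mem[OF r(2) N M] by (auto simp: Hom_def simp del: is_roof.simps)
  note tr = homotopic_trans and sy = homotopic_sym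
  have "D_comp M N M ?G ?F = D_id M"
  proof (rule D_comp_eq_idI[OF inf M N F(1) G(1) F(2) G(2) M quasi_iso_gid[OF M] dg_hom_gid homotopic_refl[OF M N refl]])
    fix W s f1 W' t g and P :: "('i, 'k) dgmod" and a b
    assume m: "(W, s, f1) \<in> ?F" "(W', t, g) \<in> ?G" and P: "dg_module P"
      and a: "quasi_iso P W a" and b: "dg_hom P W' b" and sq: "homotopic P N (gcomp f1 a) (gcomp t b)"
    note mF = Hom_memD[OF inf M N F(1) m(1) F(2)] and mG = Hom_memD[OF inf N M G(1) m(2) G(2)]
    note ah = quasi_iso_hom[OF a]
    obtain Q :: "('i, 'k) dgmod" and u w where Q: "dg_module Q" "quasi_iso Q P u" "dg_hom Q M w"
      "homotopic Q M (gcomp s (gcomp a u)) (gcomp gid w)" "homotopic Q N (gcomp f1 (gcomp a u)) (gcomp f w)"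
      using roof_equiv_lift[OF inf M N mF(2,1) r(1) P ah] .
    note uh = quasi_iso_hom[OF Q(2)]
    obtain Q' :: "('i, 'k) dgmod" and u' w' where Q': "dg_module Q'" "quasi_iso Q' Q u'" "dg_hom Q' M w'"
      "homotopic Q' N (gcomp t (gcomp (gcomp b u) u')) (gcomp f w')"
      "homotopic Q' M (gcomp g (gcomp (gcomp b u) u')) (gcomp gid w')"
      using roof_equiv_lift[OF inf N M mG(2,1) r(2) Q(1) dg_hom_gcomp[OF uh b]] .
    note u'h = quasi_iso_hom[OF Q'(2)]
    have "homotopic Q' N (gcomp f (gcomp w u')) (gcomp f1 (gcomp a (gcomp u u')))"
      using sy[OF homotopic_gcomp_right[OF Q(5) u'h Q'(1) Q(1) N] Q'(1) N] by (simp add: gcomp_assoc)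
    moreover have "homotopic Q' N (gcomp f1 (gcomp a (gcomp u u'))) (gcomp t (gcomp b (gcomp u u')))"
      using homotopic_gcomp_right[OF sq dg_hom_gcomp[OF u'h uh] Q'(1) P N] by (simp add: gcomp_assoc)
    moreover have "homotopic Q' N (gcomp t (gcomp b (gcomp u u'))) (gcomp f w')"
      using Q'(4) by (simp add: gcomp_assoc)
    ultimately have "homotopic Q' N (gcomp f (gcomp w u')) (gcomp f w')"
      using tr Q'(1) N by blast
    \<comment> \<open>The completing square lies over \<open>N\<close> and so only compares
      \<open>w\<close> and \<open>w'\<close> after applying \<open>f\<close>; removing
      \<open>f\<close> costs one more refinement.\<close>
    then obtain R :: "('i, 'k) dgmod" and \<rho> where R: "dg_module R" "quasi_iso R Q' \<rho>"
      "homotopic R M (gcomp (gcomp w u') \<rho>) (gcomp w' \<rho>)"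
      using homotopic_cancel[OF inf Q'(1) M N f dg_hom_gcomp[OF u'h Q(3)] Q'(3)] by blast
    note \<rho>h = quasi_iso_hom[OF R(2)]
    let ?q = "gcomp u (gcomp u' \<rho>)"
    have "quasi_iso R P ?q"
      by (rule quasi_iso_gcomp[OF quasi_iso_gcomp[OF R(2) Q'(2) R(1) Q'(1) Q(1)] Q(2) R(1) Q(1) P])
    moreover have "homotopic R M (gcomp s (gcomp a ?q)) (gcomp (gcomp w u') \<rho>)"
      using homotopic_gcomp_right[OF Q(4) dg_hom_gcomp[OF \<rho>h u'h] R(1) Q(1) M] by (simp add: gcomp_assoc gcomp_gid)
    moreover have "homotopic R M (gcomp w' \<rho>) (gcomp g (gcomp b ?q))"
      using sy[OF homotopic_gcomp_right[OF Q'(5) \<rho>h R(1) Q'(1) M] R(1) M] by (simp add: gcomp_assoc gcomp_gid)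
    ultimately show "\<exists>(Q :: ('i, 'k) dgmod) q. dg_module Q \<and> quasi_iso Q P q \<and>
        homotopic Q M (gcomp s (gcomp a q)) (gcomp g (gcomp b q))"
      using tr[OF tr[OF _ R(3) R(1) M] _ R(1) M] R(1) by blast
  qed
  moreover have "D_comp N M N ?F ?G = D_id N"
  proof (rule D_comp_eq_idI[OF inf N M G(1) F(1) G(2) F(2) M quasi_iso_gid[OF M] dg_hom_gid homotopic_refl[OF M M refl]])
    fix W' t g W s f1 and P :: "('i, 'k) dgmod" and a b
    assume m: "(W', t, g) \<in> ?G" "(W, s, f1) \<in> ?F" and P: "dg_module P"
      and a: "quasi_iso P W' a" and b: "dg_hom P W b" and sq: "homotopic P M (gcomp g a) (gcomp s b)"
    note mF = Hom_memD[OF inf M N F(1) m(2) F(2)] and mG = Hom_memD[OF inf N M G(1) m(1) G(2)]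
    note ah = quasi_iso_hom[OF a]
    have W: "dg_hom W M s" "dg_hom W' M g" using mF(1) mG(1) by (auto intro: quasi_iso_hom)
    obtain Q :: "('i, 'k) dgmod" and u w where Q: "dg_module Q" "quasi_iso Q P u" "dg_hom Q M w"
      "homotopic Q N (gcomp t (gcomp a u)) (gcomp f w)" "homotopic Q M (gcomp g (gcomp a u)) (gcomp gid w)"
      using roof_equiv_lift[OF inf N M mG(2,1) r(2) P ah] .
    note uh = quasi_iso_hom[OF Q(2)]
    obtain Q' :: "('i, 'k) dgmod" and u' w' where Q': "dg_module Q'" "quasi_iso Q' Q u'" "dg_hom Q' M w'"
      "homotopic Q' M (gcomp s (gcomp (gcomp b u) u')) (gcomp gid w')"
      "homotopic Q' N (gcomp f1 (gcomp (gcomp b u) u')) (gcomp f w')"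
      using roof_equiv_lift[OF inf M N mF(2,1) r(1) Q(1) dg_hom_gcomp[OF uh b]] .
    note u'h = quasi_iso_hom[OF Q'(2)]
    let ?q = "gcomp u u'"
    note qh = dg_hom_gcomp[OF u'h uh]
    have "homotopic Q' M (gcomp w u') (gcomp g (gcomp a ?q))"
      using sy[OF homotopic_gcomp_right[OF Q(5) u'h Q'(1) Q(1) M] Q'(1) M] by (simp add: gcomp_assoc gcomp_gid)
    moreover have "homotopic Q' M (gcomp g (gcomp a ?q)) (gcomp s (gcomp b ?q))"
      using homotopic_gcomp_right[OF sq qh Q'(1) P M] by (simp add: gcomp_assoc)
    moreover have "homotopic Q' M (gcomp s (gcomp b ?q)) w'"
      using Q'(4) by (simp add: gcomp_assoc gcomp_gid)
    ultimately have "homotopic Q' M (gcomp w u') w'"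
      using tr Q'(1) M by blast
    \<comment> \<open>Here the square lies over \<open>M\<close>, so \<open>f\<close> only has to be
      applied, not cancelled.\<close>
    then have "homotopic Q' N (gcomp f (gcomp w u')) (gcomp f w')"
      by (rule homotopic_gcomp_left[OF _ fh dg_hom_gcomp[OF u'h Q(3)] Q'(3,1) M N])
    moreover have "homotopic Q' N (gcomp t (gcomp a ?q)) (gcomp f (gcomp w u'))"
      using homotopic_gcomp_right[OF Q(4) u'h Q'(1) Q(1) N] by (simp add: gcomp_assoc)
    moreover have "homotopic Q' N (gcomp f w') (gcomp f1 (gcomp b ?q))"
      using sy[OF Q'(5,1) N] by (simp add: gcomp_assoc)
    moreover have "quasi_iso Q' P ?q"
      by (rule quasi_iso_gcomp[OF Q'(2) Q(2) Q'(1) Q(1) P])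
    ultimately show "\<exists>(Q :: ('i, 'k) dgmod) q. dg_module Q \<and> quasi_iso Q P q \<and>
        homotopic Q N (gcomp t (gcomp a q)) (gcomp f1 (gcomp b q))"
      using tr[OF tr[OF _ _ Q'(1) N] _ Q'(1) N] Q'(1) by blast
  qed
  ultimately show ?thesis unfolding D_iso_def using F(1) G(1) by blast
qed


subsection \<open>Acyclic modules\<close>

definition zero_dg :: "('i, 'k::field) dgmod" where
  "zero_dg = mk_dg (\<lambda>_. {0}) gzero gzero"

lemma piece_zero_dg: "piece zero_dg i = {0}"
  by (simp add: zero_dg_def mk_dg_sel)

lemma dg_module_zero_dg: "dg_module zero_dg"
  unfolding zero_dg_def
  by (rule dg_module_mk_dg) (simp_all add: linear_on_def gzero_apply fvs.subspace_single_0)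

lemma hsupp_zero_dg: "hsupp (zero_dg :: ('i, 'k::field) dgmod) = {}"
  using boundaries_0[OF dg_module_zero_dg] by (auto simp: hsupp_def cycles_def piece_zero_dg)

lemma roof_class_eqI:
  fixes X Y :: "('i, 'k::field) dgmod"
  assumes "infinite (UNIV :: 'i set)" "dg_module X" "dg_module Y"
    and "is_roof X Y r" "is_roof X Y r'" "roof_equiv X Y r r'"
  shows "roof_class X Y r = roof_class X Y r'"
  using roof_equiv_trans[OF assms(1-3)] roof_equiv_sym[OF assms(6,4,5,2,3)] assms(4-6)
  unfolding roof_class_def by blast

lemma Hom_uniqueI:
  fixes X Y :: "('i, 'k::field) dgmod"
  assumes "infinite (UNIV :: 'i set)" "dg_module X" "dg_module Y"
    and "\<And>r r'. is_roof X Y r \<Longrightarrow> is_roof X Y r' \<Longrightarrow> roof_equiv X Y r r'"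
  shows "\<exists>!F. F \<in> Hom X Y"
proof -
  have "is_roof X Y (X, gid, gzero)"
    by (rule is_roof_gid[OF assms(2) dg_hom_gzero[OF assms(2,3)]])
  then show ?thesis
    using roof_class_eqI[OF assms(1-3)] assms(4) unfolding Hom_def by blast
qed

text \<open>Needed to extract homology from a nonzero object of \<open>U\<close>. For morphisms out
  of \<open>Z\<close>, the zero module is a common refinement of any two roofs. For morphisms into
  \<open>Z\<close>, any two numerators agree after the quasi-isomorphism from \<open>Z\<close> to
  the zero module, which is then cancelled.\<close>

lemma acyclic_zero_object:
  fixes Z :: "('i, 'k::field) dgmod"
  assumes inf: "infinite (UNIV :: 'i set)" and Z: "Z \<in> Df" "hsupp Z = {}"
  shows "zero_object Z"
  unfolding zero_object_def
proof (intro conjI ballI)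
  have mZ: "dg_module Z" using Z(1) by (simp add: Df_def)
  note O = dg_module_zero_dg[where 'a = 'i and 'b = 'k]
  fix X :: "('i, 'k) dgmod" assume "X \<in> Df"
  then have X: "dg_module X" by (simp add: Df_def)
  show "\<exists>!F. F \<in> Hom Z X"
  proof (rule Hom_uniqueI[OF inf mZ X])
    fix r r' assume roofs: "is_roof Z X r" "is_roof Z X r'"
    obtain W s f W' s' f' where r: "r = (W, s, f)" "r' = (W', s', f')" by (metis prod_cases3)
    have W: "dg_module W" "dg_hom W Z s" "dg_hom W X f" "dg_module W'" "dg_hom W' Z s'" "dg_hom W' X f'"
      using roofs unfolding r by (auto intro: quasi_iso_hom)
    have "quasi_iso (zero_dg :: ('i, 'k) dgmod) Z (gcomp s gzero)"
      by (rule quasi_iso_acyclic[OF hsupp_zero_dg Z(2) dg_hom_gcomp[OF dg_hom_gzero[OF O W(1)] W(2)] O mZ])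
    then show "roof_equiv Z X r r'"
      unfolding r
      by (rule roof_equivI[OF O dg_hom_gzero[OF O W(1)] dg_hom_gzero[OF O W(4)]])
        (simp_all only: homotopic_refl O mZ X gcomp_def gzero_apply dg_homD(4)[OF W(2,1)]
          dg_homD(4)[OF W(5,4)] dg_homD(4)[OF W(3,1)] dg_homD(4)[OF W(6,4)])
  qed
  show "\<exists>!F. F \<in> Hom X Z"
  proof (rule Hom_uniqueI[OF inf X mZ])
    fix r r' assume roofs: "is_roof X Z r" "is_roof X Z r'"
    obtain W s f W' s' f' where r: "r = (W, s, f)" "r' = (W', s', f')" by (metis prod_cases3)
    have W: "dg_module W" "quasi_iso W X s" "dg_hom W Z f" "dg_module W'" "quasi_iso W' X s'" "dg_hom W' Z f'"
      using roofs unfolding r by auto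
    obtain P :: "('i, 'k) dgmod" and p q where P: "dg_module P" "quasi_iso P W p" "dg_hom P W' q"
      "homotopic P X (gcomp s p) (gcomp s' q)"
      using ore_square[OF inf W(1,4) X quasi_iso_hom[OF W(2)] W(5)] .
    note ph = quasi_iso_hom[OF P(2)]
    have "quasi_iso Z (zero_dg :: ('i, 'k) dgmod) gzero"
      by (rule quasi_iso_acyclic[OF Z(2) hsupp_zero_dg dg_hom_gzero[OF mZ O] mZ O])
    moreover have "homotopic P (zero_dg :: ('i, 'k) dgmod) (gcomp gzero (gcomp f p)) (gcomp gzero (gcomp f' q))"
      unfolding gcomp_gzero by (rule homotopic_refl[OF P(1) O refl])
    ultimately obtain R :: "('i, 'k) dgmod" and \<rho> where R: "dg_module R" "quasi_iso R P \<rho>"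
      "homotopic R Z (gcomp (gcomp f p) \<rho>) (gcomp (gcomp f' q) \<rho>)"
      using homotopic_cancel[OF inf P(1) mZ O _ dg_hom_gcomp[OF ph W(3)] dg_hom_gcomp[OF P(3) W(6)]] by blast
    note \<rho>h = quasi_iso_hom[OF R(2)]
    show "roof_equiv X Z r r'"
      unfolding r
    proof (rule roof_equivI[OF R(1) dg_hom_gcomp[OF \<rho>h ph] dg_hom_gcomp[OF \<rho>h P(3)]])
      show "quasi_iso R X (gcomp s (gcomp p \<rho>))"
        by (rule quasi_iso_gcomp[OF quasi_iso_gcomp[OF R(2) P(2) R(1) P(1) W(1)] W(2) R(1) W(1) X])
      show "homotopic R X (gcomp s (gcomp p \<rho>)) (gcomp s' (gcomp q \<rho>))"
        using homotopic_gcomp_right[OF P(4) \<rho>h R(1) P(1) X] by (simp add: gcomp_assoc)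
      show "homotopic R Z (gcomp f (gcomp p \<rho>)) (gcomp f' (gcomp q \<rho>))"
        using R(3) by (simp add: gcomp_assoc)
    qed
  qed
qed (fact Z(1))

section \<open>A nonvanishing criterion\<close>

text \<open>A basis of \<open>S\<close> stays independent when \<open>x\<close> is added. With
  \<open>S\<close> the boundaries, the functional turns a nonzero homology class into a nonzero
  scalar.\<close>

lemma separating_functional:
  fixes S :: "('i \<Rightarrow> 'k::field) set"
  assumes S: "fvs.subspace S" and x: "x \<notin> S"
  obtains l :: "('i \<Rightarrow> 'k) \<Rightarrow> 'k" where "\<And>a b. l (a + b) = l a + l b" "\<And>c a. l (fscale c a) = c * l a"
    "\<And>a. a \<in> S \<Longrightarrow> l a = 0" "l x = 1"
proof -
  interpret vs: vector_space_pair "fscale :: 'k \<Rightarrow> ('i \<Rightarrow> 'k) \<Rightarrow> _" "(*) :: 'k \<Rightarrow> 'k \<Rightarrow> 'k"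
    by unfold_locales (simp_all add: algebra_simps)
  obtain B where B: "B \<subseteq> S" "fvs.independent B" "S \<subseteq> fvs.span B" by (rule fvs.basis_exists[of S])
  have sp: "fvs.span B = S" using B S by (metis fvs.span_minimal subset_antisym)
  then have "fvs.independent (insert x B)" using B(2) x by (simp add: fvs.independent_insert)
  from vs.linear_independent_extend[OF this, of "\<lambda>b. if b = x then 1 else 0"]
  obtain l where l: "Vector_Spaces.linear fscale (*) l" "\<And>b. b \<in> insert x B \<Longrightarrow> l b = (if b = x then 1 else 0)"
    by blast
  have "x \<notin> B" using B(1) x by blast
  then have "l b = 0" if "b \<in> B" for b using l(2)[of b] that by auto
  then have "l a = 0" if "a \<in> S" for a
    using vs.linear_eq_0_on_span[OF l(1), of B a] that sp by auto
  then show ?thesis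
    using that[of l] l vs.linear_add[OF l(1)] vs.linear_scale[OF l(1)] by simp
qed

text \<open>
  A linear functional on the top homology of \<open>X\<close> and a bottom class of \<open>Y\<close> define a twist \<open>\<phi>\<close>.
  A homotopy trivializing the resulting morphism would give a chain map \<open>\<tau>\<close> of degree 1 with
  \<open>\<phi>(x) = T \<tau>(x) + \<tau>(T x)\<close>; for a top class \<open>x\<close> both terms on the right are boundaries.
\<close>

lemma Hom_nonzero:
  fixes X Y :: "('i, 'k::field) dgmod"
  assumes inf: "infinite (UNIV :: 'i set)" and X: "dg_module X" and Y: "dg_module Y"
    and top: "i \<in> hsupp X" "i + 1 \<notin> hsupp X" and bot: "i + 2 \<in> hsupp Y" "i + 1 \<notin> hsupp Y"
  shows "Hom X Y \<noteq> {D_zero X Y}"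
proof
  assume trivial: "Hom X Y = {D_zero X Y}"
  obtain x where x: "x \<in> cycles X i" "x \<notin> boundaries X i" using top(1) by (auto simp: hsupp_def)
  obtain z where z: "z \<in> cycles Y (i + 2)" "z \<notin> boundaries Y (i + 2)" using bot(1) by (auto simp: hsupp_def)
  have zp: "z \<in> piece Y (i + 2)" "dif Y (i + 2) z = 0" using z(1) by (auto simp: cycles_def)
  obtain l where l: "\<And>a b. l (a + b) = l a + l b" "\<And>c a. l (fscale c a) = c * l a"
    "\<And>a. a \<in> boundaries X i \<Longrightarrow> l a = 0" "l x = 1"
    using separating_functional[OF subspace_boundaries[OF X] x(2)] by blast
  \<comment> \<open>A chain map of degree 2, although it lives in a single degree: \<open>l\<close>
    kills the boundaries in degree \<open>i\<close>, and \<open>z\<close> is a cycle.\<close>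
  define \<phi> where "\<phi> = (\<lambda>n a. if n = i then fscale (l a) z else 0)"
  have neg_hom: "dg_hom Y Y (\<lambda>_ y. - y)"
    unfolding dg_hom_iff[OF Y Y]
    by (simp add: linear_on_neg[OF linear_on_gid dg_moduleD(1)[OF Y]] dif_linear(5)[OF Y] Tact_linear(5)[OF Y])
  \<comment> \<open>The kernel of \<open>p2\<close> is the extension of \<open>X\<close> by Sigma^-1
    Y whose action of \<open>T\<close> is twisted by \<phi>. The additional copy of \<open>Y\<close>
    cancels Sigma^-1 Y homologically, so that \<open>p1\<close> becomes a quasi-isomorphism and the
    roof \<open>(P, p1, p2)\<close> represents the class of that extension up to sign. With minus
    the identity for \<open>t\<close>, the second coordinate enters the differential with a plus
    sign.\<close>
  interpret twisted_pullback X Y Y gzero "\<lambda>_ y. - y" \<phi>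
  proof
    fix n
    show "linear_on (piece X n) (piece Y (n + 2)) (\<phi> n)"
      using zp by (auto simp: linear_on_def \<phi>_def l fvs.scale_left_distrib piece_scale[OF Y] piece_0[OF Y])
    fix a assume a: "a \<in> piece X n"
    have "l (dif X n a) = 0" if "n - 1 = i"
      using l(3) boundariesI[of a X i] a that by (simp add: algebra_simps)
    then show "dif Y (n + 2) (\<phi> n a) = \<phi> (n - 1) (dif X n a)"
      using zp dif_linear(3)[OF Y zp(1)] by (auto simp: \<phi>_def dif_linear(4)[OF Y])
  qed (use inf X Y neg_hom dg_hom_gzero in auto)
  have "quasi_iso Y Y (\<lambda>_ y. - y)"
  proof -
    have "\<exists>y'\<in>cycles Y n. y - (- y') \<in> boundaries Y n" if "y \<in> cycles Y n" for y n
      using that boundaries_0[OF Y, of n] fvs.subspace_neg[OF subspace_cycles[OF Y] that]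
      by (intro bexI[of _ "- y"]) simp_all
    then show ?thesis
      using neg_hom boundaries_neg[OF Y] by (force simp: quasi_iso_iff Y)
  qed
  then have p1: "quasi_iso P X p1" by (rule quasi_iso_p1)
  let ?r = "(P, p1, p2)" and ?o = "(X, gid, gzero)"
  have r: "is_roof X Y ?r" using dg_module_P p1 dg_hom_p2 by simp
  have r0: "is_roof X Y ?o" by (rule is_roof_gid[OF X dg_hom_gzero[OF X Y]])
  have "roof_class X Y ?r = roof_class X Y ?o"
    using trivial r unfolding Hom_def D_zero_def hom_class_def by blast
  then have "roof_equiv X Y ?o ?r"
    using roof_class_mem[OF r X Y] unfolding roof_class_def by blast
  then obtain W :: "('i, 'k) dgmod" and a b where W: "dg_module W" "quasi_iso W X a" "quasi_iso W P b"
    "homotopic W X a (gcomp p1 b)" "homotopic W Y gzero (gcomp p2 b)"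
    using roof_equivE[OF _ r0 r X] by (metis gcomp_gid(2) gcomp_gzero)
  note bh = quasi_iso_hom[OF W(3)] and bD = dg_homD[OF quasi_iso_hom[OF W(3)] W(1)]
  have q: "quasi_iso W X (gcomp p1 b)" by (rule quasi_iso_gcomp[OF W(3) p1 W(1) dg_module_P X])
  obtain \<sigma> where \<sigma>: "\<And>n. linear_on (piece W n) (piece Y (n + 1)) (\<sigma> n)"
    "\<And>n w. w \<in> piece W n \<Longrightarrow> \<sigma> n w \<in> piece Y (n + 1)"
    "\<And>n w. w \<in> piece W n \<Longrightarrow> \<sigma> (n + 1) (Tact W n w) = - Tact Y (n + 1) (\<sigma> n w)"
    "\<And>n w. w \<in> piece W n \<Longrightarrow> gzero n w - gcomp p2 b n w = dif Y (n + 1) (\<sigma> n w) + \<sigma> (n - 1) (dif W n w)"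
    using W(5,1) Y by (rule homotopicE) blast
  \<comment> \<open>Both summands measure \<open>gcomp p2 b\<close>: the first because
    \<open>b\<close> is a chain map, the second because \<sigma> is a null homotopy. In the sum it
    cancels, so \<tau> anticommutes with the differentials, while the twist survives in its
    behaviour under \<open>T\<close>.\<close>
  define \<tau> where "\<tau> = (\<lambda>n w. pr3 (b n w) + \<sigma> n w)"
  have b3: "pr3 (b n w) \<in> piece Y (n + 1)" if "w \<in> piece W n" for n w
    using bD(2)[OF that] by (simp add: piece_P)
  have \<tau>_in: "\<tau> n w \<in> piece Y (n + 1)" if "w \<in> piece W n" for n w
    unfolding \<tau>_def by (rule piece_add[OF Y b3[OF that] \<sigma>(2)[OF that]])
  have \<tau>_dif: "dif Y (n + 1) (\<tau> n w) = - \<tau> (n - 1) (dif W n w)" if w: "w \<in> piece W n" for n w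
  proof -
    have "pr3 (b (n - 1) (dif W n w)) = pr2 (b n w) - dif Y (n + 1) (pr3 (b n w))"
      unfolding bD(7)[OF w, symmetric] pr_dif_P by (simp add: gzero_apply)
    moreover have "- pr2 (b n w) = dif Y (n + 1) (\<sigma> n w) + \<sigma> (n - 1) (dif W n w)"
      using \<sigma>(4)[OF w] by (simp add: gzero_apply gcomp_def p2_def)
    then have "\<sigma> (n - 1) (dif W n w) = - pr2 (b n w) - dif Y (n + 1) (\<sigma> n w)"
      by (simp add: algebra_simps)
    moreover have "dif Y (n + 1) (\<tau> n w) = dif Y (n + 1) (pr3 (b n w)) + dif Y (n + 1) (\<sigma> n w)"
      unfolding \<tau>_def by (rule dif_linear(2)[OF Y b3[OF w] \<sigma>(2)[OF w]])
    ultimately show ?thesis by (simp add: \<tau>_def)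
  qed
  have \<tau>_Tact: "\<tau> (n + 1) (Tact W n w) = \<phi> n (pr1 (b n w)) - Tact Y (n + 1) (\<tau> n w)" if w: "w \<in> piece W n" for n w
  proof -
    have "pr3 (b (n + 1) (Tact W n w)) = \<phi> n (pr1 (b n w)) - Tact Y (n + 1) (pr3 (b n w))"
      unfolding dg_hom_Tact[OF bh W(1) dg_module_P w, symmetric] pr_Tact_P ..
    then show ?thesis
      using \<sigma>(3)[OF w] Tact_linear(2)[OF Y b3[OF w] \<sigma>(2)[OF w]] by (simp add: \<tau>_def)
  qed
  have \<tau>_0: "\<tau> n 0 = 0" for n
    unfolding \<tau>_def using bD(4) linear_onD(4)[OF \<sigma>(1) dg_moduleD(1)[OF W(1)]] by (simp add: pr_linear)
  obtain w where w: "w \<in> cycles W i" "x - gcomp p1 b i w \<in> boundaries X i"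
    using quasi_isoD(3)[OF q W(1) X x(1)] by blast
  have wp: "w \<in> piece W i" "dif W i w = 0" using w(1) by (auto simp: cycles_def)
  \<comment> \<open>\<open>l\<close> depends only on the homology class, so the value 1 passes from
    \<open>x\<close> to the image of its lift \<open>w\<close>.\<close>
  have "l ((x - gcomp p1 b i w) + gcomp p1 b i w) = 1" using l(4) by simp
  then have "l (pr1 (b i w)) = 1"
    unfolding l(1) l(3)[OF w(2)] by (simp add: gcomp_def p1_def)
  then have z_eq: "z = \<tau> (i + 1) (Tact W i w) + Tact Y (i + 1) (\<tau> i w)"
    using \<tau>_Tact[OF wp(1)] by (simp add: \<phi>_def)
  have "\<tau> i w \<in> cycles Y (i + 1)"
    using \<tau>_in[OF wp(1)] \<tau>_dif[OF wp(1)] wp(2) \<tau>_0 by (simp add: cycles_def)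
  then have "\<tau> i w \<in> boundaries Y (i + 1)" using bot(2) by (auto simp: hsupp_def)
  then obtain \<eta> where \<eta>: "\<eta> \<in> piece Y (i + 2)" "\<tau> i w = dif Y (i + 2) \<eta>"
    by (auto elim: boundariesE simp: add.assoc)
  \<comment> \<open>\<open>T\<close> anticommutes with the differential, hence the sign of the
    witness.\<close>
  have "dif Y (i + 2 + 1) (- Tact Y (i + 2) \<eta>) = Tact Y (i + 1) (\<tau> i w)"
    using dg_moduleD(5)[OF Y \<eta>(1)] dif_linear(5)[OF Y Tact_linear(1)[OF Y \<eta>(1)]] \<eta>(2)
    by (simp add: add_diff_eq[symmetric])
  then have 1: "Tact Y (i + 1) (\<tau> i w) \<in> boundaries Y (i + 2)"
    using boundariesI[OF piece_neg[OF Y Tact_linear(1)[OF Y \<eta>(1)]]] by metis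
  \<comment> \<open>The other summand already bounds before \<tau> is applied: \<open>W\<close> has
    the homology of \<open>X\<close>, which is zero in degree \<open>i + 1\<close>.\<close>
  have "Tact W i w \<in> cycles W (i + 1)"
    using Tact_linear(1)[OF W(1) wp(1)] dg_moduleD(5)[OF W(1) wp(1)] wp(2)
    by (simp add: cycles_def Tact_linear(4)[OF W(1)])
  then have "Tact W i w \<in> boundaries W (i + 1)"
    using top(2) hsupp_quasi_iso[OF q W(1) X] by (auto simp: hsupp_def)
  then obtain w' where w': "w' \<in> piece W (i + 2)" "Tact W i w = dif W (i + 2) w'"
    by (auto elim: boundariesE simp: add.assoc)
  have "dif Y (i + 2 + 1) (- \<tau> (i + 2) w') = \<tau> (i + 1) (Tact W i w)"
    using \<tau>_dif[OF w'(1)] dif_linear(5)[OF Y \<tau>_in[OF w'(1)]] w'(2) by (simp add: add_diff_eq[symmetric])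
  then have 2: "\<tau> (i + 1) (Tact W i w) \<in> boundaries Y (i + 2)"
    using boundariesI[OF piece_neg[OF Y \<tau>_in[OF w'(1)]]] by metis
  show False using z(2) boundaries_add[OF Y 2 1] z_eq by simp
qed


section \<open>Shifts, triangles and simple modules\<close>

text \<open>Besides moving degrees, the shift changes the differential only by a sign, under which
  cycles and boundaries are stable.\<close>

lemma hsupp_shift:
  assumes M: "dg_module M"
  shows "hsupp (shift r M) = {i. i - r \<in> hsupp M}"
proof -
  have "cycles (shift r M) i = cycles M (i - r)" for i
    by (auto simp: cycles_def shift_def ksign_def)
  moreover have "boundaries (shift r M) i = boundaries M (i - r)" for i
  proof -
    have "boundaries (shift r M) i = ksign r ` boundaries M (i - r)"
      by (simp add: boundaries_def shift_def image_image algebra_simps)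
    also have "\<dots> = boundaries M (i - r)"
      using boundaries_neg[OF M, of _ "i - r"] by (force simp: ksign_def)
    finally show ?thesis .
  qed
  ultimately show ?thesis by (simp add: hsupp_def)
qed

section \<open>Mapping cones and exactness\<close>

lemma piece_cone: "case_sum y x \<in> piece (cone M N f) i \<longleftrightarrow> y \<in> piece N i \<and> x \<in> piece M (i - 1)"
proof -
  have "case_sum y x = case_sum y' x' \<Longrightarrow> y = y' \<and> x = x'" for y' x'
    by (metis case_sum_o_inj(1,2))
  then show ?thesis by (auto simp: cone_def shift_def)
qed

lemma dif_cone:
  "dif (cone M N f) i (case_sum y x) = case_sum (dif N i y + f (i - 1) x) (- dif M (i - 1) x)"
  by (simp add: cone_def shift_def ksign_def case_sum_o_inj)

text \<open>A boundary of \<open>C\<close> is carried back through the bijection \<open>e\<close> to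
  an explicit boundary of the cone. With its companion \<open>cone_cycle\<close> this gives access
  to the homology of \<open>C\<close> without treating the cone itself as a DG module.\<close>

lemma cone_boundary:
  assumes e: "dg_iso (cone M N f) C e" and M: "dg_module M" and N: "dg_module N" and f: "dg_hom M N f"
    and y: "y \<in> piece N i" and x: "x \<in> piece M (i - 1)" and bd: "e i (case_sum y x) \<in> boundaries C i"
  obtains y' x' where "y' \<in> piece N (i + 1)" "x' \<in> piece M i" "y = dif N (i + 1) y' + f i x'" "x = - dif M i x'"
proof -
  have eh: "dg_hom (cone M N f) C e" and eb: "\<And>i. bij_betw (e i) (piece (cone M N f) i) (piece C i)"
    using e by (auto simp: dg_iso_def)
  obtain c where c: "c \<in> piece C (i + 1)" "e i (case_sum y x) = dif C (i + 1) c"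
    using bd by (rule boundariesE)
  obtain w where w: "w \<in> piece (cone M N f) (i + 1)" "c = e (i + 1) w"
    using c(1) eb by (metis bij_betw_imp_surj_on imageE)
  obtain y' x' where yx: "w = case_sum y' x'" "y' \<in> piece N (i + 1)" "x' \<in> piece M i"
    using w(1) by (auto simp: cone_def shift_def)
  have "e i (case_sum y x) = e i (dif (cone M N f) (i + 1) w)"
    using eh w c(2) unfolding dg_hom_def by (metis add_diff_cancel_right')
  moreover have "dif (cone M N f) (i + 1) w \<in> piece (cone M N f) i"
    using yx dif_linear(1)[OF N yx(2)] dif_linear(1)[OF M yx(3)] dg_homD(2)[OF f M yx(3)]
    by (simp add: dif_cone piece_cone piece_add[OF N] piece_neg[OF M])
  moreover have "case_sum y x \<in> piece (cone M N f) i" using x y by (simp add: piece_cone)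
  ultimately have "case_sum y x = dif (cone M N f) (i + 1) w"
    using eb[of i] by (auto simp: bij_betw_def inj_on_def)
  then have "case_sum y x = case_sum (dif N (i + 1) y' + f i x') (- dif M i x')"
    by (simp add: yx(1) dif_cone)
  then have "y = dif N (i + 1) y' + f i x'" "x = - dif M i x'"
    by (metis case_sum_o_inj(1)) (metis \<open>case_sum y x = case_sum (dif N (i + 1) y' + f i x') (- dif M i x')\<close> case_sum_o_inj(2))
  then show ?thesis using that yx by blast
qed

lemma cone_cycle:
  fixes M :: "('i, 'k::field) dgmod" and N :: "('j, 'k) dgmod"
  assumes e: "dg_iso (cone M N f) C e" and C: "dg_module C"
    and y: "y \<in> piece N i" and x: "x \<in> piece M (i - 1)"
    and eq: "dif N i y + f (i - 1) x = 0" "dif M (i - 1) x = 0" "0 \<in> piece N (i - 1)" "0 \<in> piece M (i - 2)"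
  shows "e i (case_sum y x) \<in> cycles C i"
proof -
  have eh: "dg_hom (cone M N f) C e" using e by (auto simp: dg_iso_def)
  have w: "case_sum y x \<in> piece (cone M N f) i" using x y by (simp add: piece_cone)
  have z: "case_sum 0 0 \<in> piece (cone M N f) (i - 1)" using eq by (simp add: piece_cone)
  \<comment> \<open>That \<open>e\<close> preserves zero is read off from its compatibility with the
    scalar 0.\<close>
  have "e (i - 1) (fscale 0 (case_sum 0 0)) = fscale 0 (e (i - 1) (case_sum 0 0))"
    using eh z unfolding dg_hom_def linear_on_def by blast
  then have "e (i - 1) 0 = 0" by simp
  moreover have "(case_sum 0 0 :: 'j + 'i \<Rightarrow> 'k) = 0" by (auto split: sum.split)
  moreover have "dif C i (e i (case_sum y x)) = e (i - 1) (case_sum 0 0)"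
    using eh w eq unfolding dg_hom_def by (metis dif_cone minus_zero)
  moreover have "e i (case_sum y x) \<in> piece C i"
    using eh w by (auto simp: dg_hom_def linear_on_def)
  ultimately show ?thesis by (simp add: cycles_def)
qed

text \<open>The two consequences of the long exact homology sequence that the theorem uses, each
  obtained by writing down a cycle of the cone that must be a boundary.\<close>

lemma standard_triangle_exact:
  assumes "standard_triangle M N C f g h"
  shows "hsupp N \<subseteq> hsupp M \<union> hsupp C"
    and "hsupp C = {} \<Longrightarrow> quasi_iso M N f"
proof -
  have M: "dg_module M" and N: "dg_module N" and C: "dg_module C" and f: "dg_hom M N f"
    using assms by (auto simp: standard_triangle_def)
  obtain e where e: "dg_iso (cone M N f) C e"
    using assms by (auto simp: standard_triangle_def)
  have surj: "\<exists>x\<in>cycles M i. y - f i x \<in> boundaries N i" if y: "y \<in> cycles N i" and "i \<notin> hsupp C" for i y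
  proof -
    have yp: "y \<in> piece N i" "dif N i y = 0" using y by (auto simp: cycles_def)
    have "e i (case_sum y 0) \<in> cycles C i"
      using yp by (intro cone_cycle[OF e C])
        (simp_all add: piece_0[OF M] piece_0[OF N] dg_homD(4)[OF f M] dif_linear(4)[OF M])
    then have bd: "e i (case_sum y 0) \<in> boundaries C i" using that(2) by (auto simp: hsupp_def)
    obtain y' x' where yx: "y' \<in> piece N (i + 1)" "x' \<in> piece M i" "y = dif N (i + 1) y' + f i x'" "0 = - dif M i x'"
      using cone_boundary[OF e M N f yp(1) piece_0[OF M] bd] .
    then have "x' \<in> cycles M i" by (simp add: cycles_def)
    moreover have "y - f i x' \<in> boundaries N i" using yx boundariesI by simp
    ultimately show ?thesis by blast
  qed
  show "hsupp N \<subseteq> hsupp M \<union> hsupp C"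
  proof
    fix i assume i: "i \<in> hsupp N"
    show "i \<in> hsupp M \<union> hsupp C"
    proof (rule ccontr)
      assume n: "i \<notin> hsupp M \<union> hsupp C"
      have "y \<in> boundaries N i" if y: "y \<in> cycles N i" for y
      proof -
        obtain x where x: "x \<in> cycles M i" "y - f i x \<in> boundaries N i" using surj[OF y] n by blast
        then have "x \<in> boundaries M i" using n by (auto simp: hsupp_def)
        from boundaries_add[OF N x(2) dg_hom_boundaries[OF f M this]] show ?thesis by simp
      qed
      then show False using i by (auto simp: hsupp_def)
    qed
  qed
  assume ac: "hsupp C = {}"
  have "x \<in> boundaries M i" if x: "x \<in> cycles M i" "f i x \<in> boundaries N i" for i x
  proof -
    have xp: "x \<in> piece M i" "dif M i x = 0" using x(1) by (auto simp: cycles_def)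
    obtain y where y: "y \<in> piece N (i + 1)" "f i x = dif N (i + 1) y" using x(2) by (rule boundariesE)
    \<comment> \<open>From \<open>f x = d y\<close>, the pair of \<open>- y\<close> and
      \<open>x\<close> is a cycle of the cone. It sits in degree \<open>i + 1\<close> because
      \<open>x\<close> is regarded as an element of the suspension of \<open>M\<close>.\<close>
    have "e (i + 1) (case_sum (- y) x) \<in> cycles C (i + 1)"
      using xp y by (intro cone_cycle[OF e C])
        (simp_all add: piece_0[OF M] piece_0[OF N] piece_neg[OF N] dif_linear(5)[OF N])
    then have bd: "e (i + 1) (case_sum (- y) x) \<in> boundaries C (i + 1)" using ac by (auto simp: hsupp_def)
    have "x \<in> piece M (i + 1 - 1)" using xp by simp
    then obtain y' x' where "x' \<in> piece M (i + 1)" "x = - dif M (i + 1) x'"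
      using cone_boundary[OF e M N f piece_neg[OF N y(1)] _ bd] by blast
    then show ?thesis using boundaries_neg[OF M boundariesI] by metis
  qed
  then show "quasi_iso M N f" using f surj ac by (auto simp: quasi_iso_iff M N)
qed

section \<open>One-dimensional modules\<close>

lemma ex_Df_hsupp:
  "\<exists>S :: ('i, 'k::field) dgmod. S \<in> Df \<and> n \<in> hsupp S"
proof -
  \<comment> \<open>The constant function 1 is a nonzero vector; it spans the only nonzero piece, on
    which \<open>d\<close> and \<open>T\<close> vanish.\<close>
  let ?e = "1 :: 'i \<Rightarrow> 'k"
  let ?P = "\<lambda>i. if i = n then fvs.span {?e} else {0}"
  let ?S = "mk_dg ?P gzero gzero"
  have P: "fvs.subspace (?P i)" for i by (simp add: fvs.subspace_span fvs.subspace_single_0)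
  have S: "dg_module ?S"
    by (rule dg_module_mk_dg[OF P]) (simp_all add: linear_on_def gzero_apply fvs.span_zero)
  have cyc: "cycles ?S i = ?P i" for i by (simp add: cycles_def mk_dg_sel gzero_apply)
  have bd: "boundaries ?S i = {0}" for i
    using boundaries_0[OF S, of i] by (auto simp: boundaries_def mk_dg_sel gzero_apply)
  have "?e \<in> cycles ?S n" "?e \<notin> boundaries ?S n"
    by (simp_all add: cyc bd fvs.span_base)
  then have "n \<in> hsupp ?S" by (auto simp: hsupp_def)
  moreover have "finite (hsupp ?S)"
  proof (rule finite_subset[of _ "{n}"])
    show "hsupp ?S \<subseteq> {n}" by (auto simp: hsupp_def cyc bd split: if_splits)
  qed simp
  moreover have "\<exists>B\<subseteq>cycles ?S i. finite B \<and> (\<forall>x\<in>cycles ?S i. \<exists>y\<in>fvs.span B. x - y \<in> boundaries ?S i)" for i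
  proof (rule exI[of _ "if i = n then {?e} else {0}"], intro conjI ballI)
    fix x assume "x \<in> cycles ?S i"
    then have "x \<in> fvs.span (if i = n then {?e} else {0})" by (simp add: cyc split: if_splits)
    then show "\<exists>y\<in>fvs.span (if i = n then {?e} else {0}). x - y \<in> boundaries ?S i"
      by (rule bexI[rotated]) (simp add: bd)
  qed (simp_all add: cyc fvs.span_base)
  ultimately show ?thesis
    using S by (intro exI[of _ ?S]) (auto simp: Df_def finite_dim_homology_iff)
qed


section \<open>Co-t-structures\<close>

lemma co_t_structure_separated:
  fixes U V :: "('i, 'k::field) dgmod set"
  assumes inf: "infinite (UNIV :: 'i set)" and co: "co_t_structure U V"
    and u: "u \<in> U" "i \<in> hsupp u" and v: "v \<in> V" "j \<in> hsupp v"
  shows "i + 2 < j"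
proof (rule ccontr)
  assume "\<not> i + 2 < j"
  have tt: "torsion_theory U V" and sh: "\<And>u. u \<in> U \<Longrightarrow> shift (- 1) u \<in> U"
    using co unfolding co_t_structure_def by blast+
  have sub: "U \<subseteq> Df" "V \<subseteq> Df"
    using tt by (simp_all add: torsion_theory_def subcategory_def)
  have orth: "Hom u v = {D_zero u v}" if "u \<in> U" "v \<in> V" for u v
    using tt that by (simp add: torsion_theory_def)
  have mod: "\<And>u. u \<in> U \<Longrightarrow> dg_module u" and mv: "dg_module v"
    using sub v(1) by (auto simp: Df_def)
  have fin: "finite (hsupp u)" "finite (hsupp v)"
    using sub u(1) v(1) by (auto simp: Df_def finite_dim_homology_iff)
  define i0 where "i0 = Max (hsupp u)"
  define j0 where "j0 = Min (hsupp v)"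
  have i0: "i0 \<in> hsupp u" "\<And>k. k \<in> hsupp u \<Longrightarrow> k \<le> i0"
    unfolding i0_def using fin u(2) by (auto intro: Max_in)
  have j0: "j0 \<in> hsupp v" "\<And>k. k \<in> hsupp v \<Longrightarrow> j0 \<le> k"
    unfolding j0_def using fin v(2) by (auto intro: Min_in)
  \<comment> \<open>Desuspending \<open>u\<close> this often moves its top degree to
    \<open>j0 - 2\<close>, where \<open>Hom_nonzero\<close> applies. Only nonnegative numbers of
    desuspensions stay in \<open>U\<close>, and i0 + 2 \<ge> i + 2 \<ge> j \<ge> j0 provides
    this.\<close>
  define n where "n = nat (i0 + 2 - j0)"
  have n: "int n = i0 + 2 - j0"
    using i0(2)[OF u(2)] j0(2)[OF v(2)] \<open>\<not> i + 2 < j\<close> by (simp add: n_def)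
  have pow: "(shift (- 1) ^^ m) u \<in> U \<and> hsupp ((shift (- 1) ^^ m) u) = {k. k + int m \<in> hsupp u}" for m
  proof (induction m)
    case (Suc m)
    then show ?case
      using sh hsupp_shift[OF mod, of "(shift (- 1) ^^ m) u" "- 1"] by (auto simp: ac_simps)
  qed (use u(1) in simp)
  let ?u = "(shift (- 1) ^^ n) u"
  have eq: "j0 - 2 + int n = i0" "j0 - 2 + 1 + int n = i0 + 1" using n by auto
  have "Hom ?u v \<noteq> {D_zero ?u v}"
  proof (rule Hom_nonzero[OF inf mod mv])
    show "?u \<in> U" using pow by blast
    show "j0 - 2 \<in> hsupp ?u"
      unfolding pow[of n, THEN conjunct2] mem_Collect_eq eq by (rule i0(1))
    show "j0 - 2 + 1 \<notin> hsupp ?u"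
      unfolding pow[of n, THEN conjunct2] mem_Collect_eq eq using i0(2)[of "i0 + 1"] by auto
    show "j0 - 2 + 2 \<in> hsupp v" "j0 - 2 + 1 \<notin> hsupp v" using j0(1) j0(2)[of "j0 - 1"] by auto
  qed
  then show False using orth pow v(1) by blast
qed

lemma dist_triangleE:
  fixes X Y Z :: "('i, 'k::field) dgmod"
  assumes "dist_triangle X Y Z F G H"
  obtains M N C :: "('i, 'k) dgmod" and f g h A B E where "standard_triangle M N C f g h"
    "D_iso X M A" "D_iso Y N B" "D_iso Z C E"
  using assms unfolding dist_triangle_def by blast

lemma D_iso_invariants:
  fixes X Y :: "('i, 'k::field) dgmod"
  assumes "infinite (UNIV :: 'i set)" "dg_module X" "dg_module Y" "D_iso X Y F"
  shows "hsupp X = hsupp Y" "X \<in> Df \<longleftrightarrow> Y \<in> Df"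
proof -
  obtain Z :: "('i, 'k) dgmod" and s f where Z: "dg_module Z" "quasi_iso Z X s" "quasi_iso Z Y f"
    using D_iso_quasi_isos[OF assms] .
  show "hsupp X = hsupp Y"
    using hsupp_quasi_iso[OF Z(2,1) assms(2)] hsupp_quasi_iso[OF Z(3,1) assms(3)] by simp
  show "X \<in> Df \<longleftrightarrow> Y \<in> Df"
    using Df_quasi_iso[OF Z(2,1) assms(2)] Df_quasi_iso[OF Z(3,1) assms(3)] by simp
qed

theorem theorem4p2:
  fixes U V :: "('i, 'k::field) dgmod set"
  assumes "infinite (UNIV :: 'i set)"
    and "co_t_structure U V"
    and "\<exists>u\<in>U. \<not> zero_object u"
  shows "U = Df"
proof -
  note inf = assms(1) and sep = co_t_structure_separated[OF assms(1,2)]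
  note iso = D_iso_invariants[OF inf]
  have tt: "subcategory U" "subcategory V"
    "\<And>d. d \<in> Df \<Longrightarrow> \<exists>u\<in>U. \<exists>v\<in>V. \<exists>F G H. dist_triangle u d v F G H"
    using assms(2) by (simp_all add: co_t_structure_def torsion_theory_def)
  note tri = tt(3)
  have sub: "U \<subseteq> Df" "V \<subseteq> Df"
    using tt(1,2) by (simp_all add: subcategory_def)
  have closed: "Y \<in> U" if "X \<in> U" "Y \<in> Df" "D_iso X Y F" for X Y F
  proof -
    have "\<forall>X\<in>U. \<forall>Y\<in>Df. (\<exists>F. D_iso X Y F) \<longrightarrow> Y \<in> U"
      using tt(1) unfolding subcategory_def by (elim conjE)
    then show ?thesis using that by blast
  qed
  have mod: "dg_module X" if "X \<in> U \<or> X \<in> V \<or> X \<in> Df" for X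
  proof -
    have "X \<in> Df" using that sub by blast
    then show ?thesis by (simp add: Df_def)
  qed
  obtain u0 where u0: "u0 \<in> U" "\<not> zero_object u0" using assms(3) by blast
  \<comment> \<open>An object of \<open>U\<close> without homology would be a zero object.\<close>
  then have "hsupp u0 \<noteq> {}" using acyclic_zero_object[OF inf, of u0] sub(1) by blast
  have V0: "hsupp v = {}" if v: "v \<in> V" for v
  proof (rule ccontr)
    assume "hsupp v \<noteq> {}"
    then obtain j where j: "j \<in> hsupp v" by blast
    obtain i0 where i0: "i0 \<in> hsupp u0" using \<open>hsupp u0 \<noteq> {}\<close> by blast
    let ?S = "\<lambda>i. \<exists>u\<in>U. i \<in> hsupp u"
    have bound: "i < j" if "?S i" for i using sep that v j by fastforce
    \<comment> \<open>\<open>U\<close> is closed under desuspension, so its degrees are unbounded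
      below; cutting off at \<open>i0\<close> makes the set finite without affecting its
      maximum.\<close>
    define t where "t = Max {i. i0 \<le> i \<and> ?S i}"
    have fin: "finite {i. i0 \<le> i \<and> ?S i}"
      by (rule finite_subset[of _ "{i0..j}"]) (use bound in fastforce)+
    have "i0 \<in> {i. i0 \<le> i \<and> ?S i}" using u0(1) i0 by auto
    then have t: "?S t" "i0 \<le> t" and t_max: "\<And>i. ?S i \<Longrightarrow> i \<le> t"
    proof -
      assume *: "i0 \<in> {i. i0 \<le> i \<and> ?S i}"
      then have "t \<in> {i. i0 \<le> i \<and> ?S i}" unfolding t_def using fin by (intro Max_in) auto
      then show "?S t" "i0 \<le> t" by auto
      fix i assume i: "?S i"
      show "i \<le> t"
      proof (cases "i0 \<le> i")
        case True
        then show ?thesis unfolding t_def using fin i by (intro Max_ge) auto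
      qed (use \<open>i0 \<le> t\<close> in simp)
    qed
    obtain d :: "('i, 'k) dgmod" where d: "d \<in> Df" "t + 1 \<in> hsupp d" using ex_Df_hsupp by blast
    obtain u' v' F G H where uv: "u' \<in> U" "v' \<in> V" "dist_triangle u' d v' F G H" using tri[OF d(1)] by blast
    obtain M N C :: "('i, 'k) dgmod" and f g h A B E where T: "standard_triangle M N C f g h"
      "D_iso u' M A" "D_iso d N B" "D_iso v' C E"
      using uv(3) by (rule dist_triangleE)
    then have m: "dg_module M" "dg_module N" "dg_module C" by (auto simp: standard_triangle_def)
    have "t + 1 \<in> hsupp N" using iso(1)[OF mod m(2) T(3)] d by simp
    moreover have "t + 1 \<notin> hsupp M" using iso(1)[OF mod m(1) T(2)] uv(1) t_max[of "t + 1"] by auto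
    ultimately have "t + 1 \<in> hsupp C" using standard_triangle_exact(1)[OF T(1)] by blast
    then have "t + 1 \<in> hsupp v'" using iso(1)[OF mod m(3) T(4)] uv(2) by simp
    \<comment> \<open>Separation of the degree \<open>t\<close> of \<open>U\<close> from the degree
      \<open>t + 1\<close> of \<open>V\<close> would require t + 2 < t + 1.\<close>
    then show False using sep[OF _ _ uv(2), of _ t "t + 1"] t(1) by auto
  qed
  have "d \<in> U" if d: "d \<in> Df" for d
  proof -
    obtain u v F G H where uv: "u \<in> U" "v \<in> V" "dist_triangle u d v F G H" using tri[OF d] by blast
    obtain M N C :: "('i, 'k) dgmod" and f g h A B E where T: "standard_triangle M N C f g h"
      "D_iso u M A" "D_iso d N B" "D_iso v C E"
      using uv(3) by (rule dist_triangleE)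
    then have m: "dg_module M" "dg_module N" "dg_module C" by (auto simp: standard_triangle_def)
    have "hsupp C = {}" using iso(1)[OF mod m(3) T(4)] uv(2) V0 by simp
    then have "quasi_iso M N f" by (rule standard_triangle_exact(2)[OF T(1)])
    then obtain F' where F': "D_iso M N F'" using quasi_iso_D_iso[OF inf m(1,2)] by blast
    \<comment> \<open>Membership in \<open>U\<close> is passed along \<open>u\<close>,
      \<open>M\<close>, \<open>N\<close>, \<open>d\<close> one isomorphism at a time, which avoids
      composing isomorphisms. Closure under isomorphism applies within \<open>Df\<close>, so each
      intermediate object is first placed there.\<close>
    have "M \<in> Df" using iso(2)[OF mod m(1) T(2)] uv(1) sub by auto
    then have "M \<in> U" using closed uv(1) T(2) by blast
    moreover have "N \<in> Df" using iso(2)[OF mod m(2) T(3)] d by auto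
    ultimately have "N \<in> U" using closed F' by blast
    then show "d \<in> U" using closed d D_iso_sym[OF T(3)] by blast
  qed
  then show ?thesis using sub(1) by blast
qed

end
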